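(* Let $G$ be a finite graph whose vertex set $V$ is partitioned into $V_1 \sqcup V_2 \sqcup \dots \sqcup V_m$. (a) Suppose there is a prime power $q \ge 2$ with $|V_j| \ge q-1$ for all $j$ and $|V| \ge (q-1)(m+2)+1$. Suppose further that after deleting the edges of some simple path from $G$, every vertex $v \in V$ satisfies $2N(v) + N^2(v) < q$ (computed in the graph with the path edges deleted). Then $G$ admits an almost fair splitting by $q$ independent sets. (b) Let $q \ge 2$ be a prime with $|V_j| \ge q-1$ for all $j$. Suppose $G$ has $(q-1)n+1$ vertices for some integer $n \ge m+1$ and is the edge-disjoint union of a path and pairwise vertex-disjoint cliques of size $q-1$. Then $G$ admits an almost fair splitting by $q$ independent sets.
   Context: For a vertex $v$, $N(v)$ denotes the number of neighbors of $v$, and $N^2(v)$ denotes the number of vertices at distance exactly two from $v$. A set of vertices is independent if it contains no two endpoints of an edge of $G$. Given the partition, pairwise disjoint sets $S_1, \dots, S_q \subseteq V$ form an almost fair splitting if $|S_i \cap V_j| \ge \lfloor \frac{|V_j|+1}{q} \rfloor - 1$ for all $i,j$ and $|V_j \setminus \bigcup_i S_i| \le q-1$ for all $j$. *)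

theory Defs
  imports Complex_Main "HOL-Library.Extended_Nat" "HOL-Library.Disjoint_Sets"
    "HOL-Number_Theory.Prime_Powers"
begin

text \<open>A finite simple graph is given by its vertex set and its set of edges, an edge being the
  two-element set of its endpoints.\<close>

definition complete_edges :: "'a set \<Rightarrow> 'a set set" where
  "complete_edges K = {e. e \<subseteq> K \<and> card e = 2}"

definition finite_graph :: "'a set \<Rightarrow> 'a set set \<Rightarrow> bool" where
  "finite_graph V E \<longleftrightarrow> finite V \<and> E \<subseteq> complete_edges V"

definition independent_set :: "'a set \<Rightarrow> 'a set set \<Rightarrow> 'a set \<Rightarrow> bool" where
  "independent_set V E S \<longleftrightarrow> S \<subseteq> V \<and> (\<forall>x\<in>S. \<forall>y\<in>S. {x, y} \<notin> E)"

definition walk_edges :: "'a list \<Rightarrow> 'a set set" where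
  "walk_edges p = {{p ! i, p ! Suc i} | i. Suc i < length p}"

definition is_walk :: "'a set \<Rightarrow> 'a set set \<Rightarrow> 'a list \<Rightarrow> bool" where
  "is_walk V E p \<longleftrightarrow> p \<noteq> [] \<and> set p \<subseteq> V \<and> walk_edges p \<subseteq> E"

text \<open>A single vertex counts as a path without edges.\<close>

definition is_simple_path :: "'a set \<Rightarrow> 'a set set \<Rightarrow> 'a list \<Rightarrow> bool" where
  "is_simple_path V E p \<longleftrightarrow> is_walk V E p \<and> distinct p"

text \<open>The infimum of the empty set is \<open>\<infinity>\<close>: vertices in different components are at infinite
  distance.\<close>

definition graph_dist :: "'a set \<Rightarrow> 'a set set \<Rightarrow> 'a \<Rightarrow> 'a \<Rightarrow> enat" where
  "graph_dist V E u v =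
     Inf {enat (length p - 1) | p. is_walk V E p \<and> hd p = u \<and> last p = v}"

definition num_neighbors :: "'a set \<Rightarrow> 'a set set \<Rightarrow> 'a \<Rightarrow> nat" where
  "num_neighbors V E v = card {w \<in> V. {v, w} \<in> E}"

definition num_dist_two :: "'a set \<Rightarrow> 'a set set \<Rightarrow> 'a \<Rightarrow> nat" where
  "num_dist_two V E v = card {w \<in> V. graph_dist V E v w = 2}"

definition vertex_partition :: "'a set \<Rightarrow> nat \<Rightarrow> (nat \<Rightarrow> 'a set) \<Rightarrow> bool" where
  "vertex_partition V m P \<longleftrightarrow>
     (\<Union>j\<in>{1..m}. P j) = V \<and> disjoint_family_on P {1..m} \<and> (\<forall>j\<in>{1..m}. P j \<noteq> {})"

text \<open>The lower bound is an integer inequality, so that the subtraction does not truncate.\<close>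

definition almost_fair_splitting ::
  "'a set \<Rightarrow> nat \<Rightarrow> (nat \<Rightarrow> 'a set) \<Rightarrow> nat \<Rightarrow> (nat \<Rightarrow> 'a set) \<Rightarrow> bool" where
  "almost_fair_splitting V m P q S \<longleftrightarrow>
     (\<forall>i\<in>{1..q}. S i \<subseteq> V) \<and>
     disjoint_family_on S {1..q} \<and>
     (\<forall>i\<in>{1..q}. \<forall>j\<in>{1..m}.
        int (card (S i \<inter> P j)) \<ge> \<lfloor>(real (card (P j)) + 1) / real q\<rfloor> - 1) \<and>
     (\<forall>j\<in>{1..m}. card (P j - (\<Union>i\<in>{1..q}. S i)) \<le> q - 1)"

definition admits_almost_fair_independent_splitting ::
  "'a set \<Rightarrow> 'a set set \<Rightarrow> nat \<Rightarrow> (nat \<Rightarrow> 'a set) \<Rightarrow> nat \<Rightarrow> bool" where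
  "admits_almost_fair_independent_splitting V E m P q \<longleftrightarrow>
     (\<exists>S. almost_fair_splitting V m P q S \<and> (\<forall>i\<in>{1..q}. independent_set V E (S i)))"

text \<open>The cliques need not cover all vertices, and they may share vertices, but no edges, with the
  path. Distinct cliques are vertex-disjoint and hence automatically edge-disjoint.\<close>

definition edge_disjoint_path_cliques :: "'a set \<Rightarrow> 'a set set \<Rightarrow> nat \<Rightarrow> bool" where
  "edge_disjoint_path_cliques V E k \<longleftrightarrow>
     (\<exists>p C. is_simple_path V E p \<and>
        (\<forall>K\<in>C. card K = k) \<and> disjoint C \<and>
        V = set p \<union> \<Union>C \<and>
        E = walk_edges p \<union> (\<Union>K\<in>C. complete_edges K) \<and>
        walk_edges p \<inter> (\<Union>K\<in>C. complete_edges K) = {})"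

end

theory Submission
  imports Defs "HOL-Computational_Algebra.Polynomial" "HOL-Library.Function_Algebras"
    "HOL-Library.FuncSet" "HOL-Number_Theory.Cong"
begin

text \<open>
  Order the vertices with the path first and let \<open>q = p\<^sup>k\<close>. Suppose that there is no almost fair
  splitting, and consider the complex of partial colourings with \<open>q\<close> colours that are proper for the
  graph without the path edges. A partial colouring is labelled by the sets of colours that are used
  too often on (most of) some \<open>V\<^sub>j\<close>, if there are any, and otherwise by its first colour and its
  number of colour runs along the ordering. A colouring with enough runs and no colour used too often
  would yield a splitting by keeping only the vertex at which each run starts; hence the labels form a
  poset of dimension \<open>|V| - 2\<close>, on which the group \<open>(Z/p)\<^sup>k\<close> of translations of the colours acts
  without fixed points. The complex of colourings, however, is acyclic up to dimension \<open>|V| - 2\<close> in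
  (a), and in (b) it receives an equivariant chain map of degree prime to \<open>q\<close> from a complex that is.
  By Volovikov's Borsuk--Ulam theorem there is no equivariant map between the two.

  That theorem is proved here by algebra. Put \<open>y = \<Sum> t\<^sup>i (g\<^sub>i - 1)\<close> over \<open>Z[t]\<close> modulo \<open>p\<close>, so that
  \<open>y\<^sup>p = 0\<close>. Acyclicity provides chains \<open>c\<^sub>1, c\<^sub>2, \<dots>, c\<^sub>N\<close>, \<open>N = |V|\<close>, with \<open>\<partial>c\<^sub>1 = 1\<close> and
  \<open>\<partial>c\<^sub>i\<^sub>+\<^sub>1\<close> alternately equal to \<open>y c\<^sub>i\<close> and \<open>y\<^sup>p\<^sup>-\<^sup>1 c\<^sub>i\<close>. Filter the chains by the level of the label.
  On each level, an index of the labels in \<open>Z/p\<close> gives an operator \<open>x\<close> that commutes with the boundary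
  and satisfies the Weyl relation \<open>[y, x] = const \<noteq> 0\<close>. It contracts the periodic complex with
  differentials \<open>y\<close> and \<open>y\<^sup>p\<^sup>-\<^sup>1\<close>, so that the sequence of chains can be pushed to the next lower
  level at the cost of its last term. After \<open>N - 1\<close> levels \<open>c\<^sub>1\<close> has become zero although
  \<open>\<partial>c\<^sub>1\<close> is a nonzero constant.
\<close>

section \<open>Weyl relations modulo a prime\<close>

text \<open>Why the numbers fit: put \<open>q = p ^ k\<close> and shrink each class to
  \<open>Q j\<close> with \<open>q * (a j + 1) - 1\<close> vertices. If no colour occurs more than
  \<open>a j\<close> times on \<open>Q j\<close>, at most \<open>q * a j\<close> run starts lie in
  \<open>Q j\<close>, hence at most \<open>card (P j) - (q - 1)\<close> in \<open>P j\<close>. These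
  bounds add up to \<open>card V - (q - 1) * m\<close>, so a colouring with that many runs attains
  each of them, and this is almost fairness. One run less is \<open>max_runs\<close>; above it the
  overused colours, never all \<open>q\<close> of them, add at most \<open>q - 1\<close> levels per
  class. The top level is thus \<open>card V - 1\<close>, one below the number of chains that
  acyclicity provides. No scalar is ever inverted: a contraction exists only up to a scalar that
  \<open>p\<close> does not divide, and these scalars accumulate in the boundary of the first chain.
  As \<open>p\<close> is a prime element of \<open>Z[t]\<close>, their product never becomes
  divisible by \<open>p\<close>. Congruences over \<open>Z[t]\<close> replace a coefficient field
  because the absence of 2-torsion lets plain alternation describe simplicial chains for
  \<open>p = 2\<close> as well.\<close>

definition eqm :: "nat \<Rightarrow> 'a::ring_1 \<Rightarrow> 'a \<Rightarrow> bool" where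
  "eqm p a b \<longleftrightarrow> (\<exists>c. a - b = of_nat p * c)"

lemma eqmI: "a = b + of_nat p * c \<Longrightarrow> eqm p a b"
  unfolding eqm_def by (rule exI[of _ c]) simp

lemma eqmE:
  assumes "eqm p a b" obtains c where "a = b + of_nat p * c"
  using assms unfolding eqm_def by (metis add.commute diff_add_cancel)

lemma eqm_refl [simp]: "eqm p a a"
  unfolding eqm_def by (rule exI[of _ 0]) simp

lemma eqm_sym: "eqm p a b \<Longrightarrow> eqm p b a"
  unfolding eqm_def by (metis minus_diff_eq mult_minus_right)

lemma eqm_trans [trans]:
  assumes "eqm p a b" "eqm p b c" shows "eqm p a c"
proof -
  obtain u v where "a = b + of_nat p * u" "b = c + of_nat p * v" using assms by (metis eqmE)
  then show ?thesis by (intro eqmI[of _ _ _ "v + u"]) (simp add: distrib_left add.assoc)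
qed

lemma eq_eqm_trans [trans]: "a = b \<Longrightarrow> eqm p b c \<Longrightarrow> eqm p a c"
  by simp

lemma eqm_eq_trans [trans]: "eqm p a b \<Longrightarrow> b = c \<Longrightarrow> eqm p a c"
  by simp

lemma eqm_add:
  assumes "eqm p a b" "eqm p c d" shows "eqm p (a + c) (b + d)"
proof -
  obtain u v where "a = b + of_nat p * u" "c = d + of_nat p * v" using assms by (metis eqmE)
  then show ?thesis by (intro eqmI[of _ _ _ "u + v"]) (simp add: distrib_left add_ac)
qed

lemma eqm_minus:
  assumes "eqm p a b" shows "eqm p (- a) (- b)"
proof -
  obtain u where "a = b + of_nat p * u" using assms by (metis eqmE)
  then show ?thesis by (intro eqmI[of _ _ _ "- u"]) simp
qed

lemma eqm_diff: "eqm p a b \<Longrightarrow> eqm p c d \<Longrightarrow> eqm p (a - c) (b - d)"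
  using eqm_add[of p a b "- c" "- d"] eqm_minus[of p c d] by simp

lemma eqm_mult_left: "eqm p a b \<Longrightarrow> eqm p (c * a) (c * b)"
  unfolding eqm_def by (metis mult.assoc mult_of_nat_commute right_diff_distrib)

lemma eqm_mult_right: "eqm p a b \<Longrightarrow> eqm p (a * c) (b * c)"
  unfolding eqm_def by (metis left_diff_distrib mult.assoc)

lemma eqm_sum: "(\<And>i. i \<in> I \<Longrightarrow> eqm p (f i) (g i)) \<Longrightarrow> eqm p (sum f I) (sum g I)"
proof (induction I rule: infinite_finite_induct)
  case (insert i I)
  then show ?case using eqm_add[of p "f i" "g i" "sum f I" "sum g I"] by simp
qed auto

lemma nat_left: "(a :: 'a::ring_1) * (of_nat m * c) = of_nat m * (a * c)"
  by (metis mult.assoc mult_of_nat_commute)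

text \<open>Operators do not commute in general, so the expansion is stated under the sole
  assumption that the two summands do.\<close>

lemma commuting_binomial:
  fixes a b :: "'a::ring_1"
  assumes ab: "a * b = b * a"
  shows "(a + b) ^ n = (\<Sum>j\<le>n. of_nat (n choose j) * (a ^ j * b ^ (n - j)))"
proof (induction n)
  case (Suc n)
  have ca: "a * (of_nat m * (a ^ j * c)) = of_nat m * (a ^ Suc j * c)" for m j c
    by (simp only: nat_left power_Suc mult.assoc)
  have pc: "b * a ^ j = a ^ j * b" for j
    using ab power_commuting_commutes[of a b j] by simp
  have cb: "b * (of_nat m * (a ^ j * b ^ i)) = of_nat m * (a ^ j * b ^ Suc i)" for m j i
    unfolding nat_left mult.assoc[symmetric, of b] pc by (simp add: mult.assoc)
  have "(a + b) ^ Suc n = a * (a + b) ^ n + b * (a + b) ^ n"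
    by (simp add: distrib_right)
  also have "\<dots> = (\<Sum>j\<le>n. of_nat (n choose j) * (a ^ Suc j * b ^ (n - j)))
      + (\<Sum>j\<le>n. of_nat (n choose j) * (a ^ j * b ^ Suc (n - j)))"
    unfolding Suc sum_distrib_left ca cb ..
  also have "(\<Sum>j\<le>n. of_nat (n choose j) * (a ^ j * b ^ Suc (n - j)))
      = (\<Sum>j\<le>Suc n. of_nat (n choose j) * (a ^ j * b ^ (Suc n - j)))"
    by (simp add: binomial_eq_0 Suc_diff_le)
  also have "\<dots> = b ^ Suc n + (\<Sum>j\<le>n. of_nat (n choose Suc j) * (a ^ Suc j * b ^ (n - j)))"
    by (subst sum.atMost_Suc_shift) simp
  also have "(\<Sum>j\<le>n. of_nat (n choose j) * (a ^ Suc j * b ^ (n - j))) + \<dots>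
      = b ^ Suc n + (\<Sum>j\<le>n. of_nat (Suc n choose Suc j) * (a ^ Suc j * b ^ (n - j)))"
    by (simp add: sum.distrib distrib_right algebra_simps)
  also have "\<dots> = (\<Sum>j\<le>Suc n. of_nat (Suc n choose j) * (a ^ j * b ^ (Suc n - j)))"
    by (subst sum.atMost_Suc_shift) simp
  finally show ?case .
qed simp

lemma frobenius_add:
  fixes a b :: "'a::ring_1"
  assumes ab: "a * b = b * a" and p: "prime p"
  shows "eqm p ((a + b) ^ p) (a ^ p + b ^ p)"
proof -
  have p1: "p > 0" using p prime_gt_0_nat by blast
  have *: "eqm p (of_nat (p choose j) * (a ^ j * b ^ (p - j))) 0" if j: "j \<in> {1..<p}" for j
  proof -
    have "p dvd (p choose j)"
      using j p by (intro dvd_choose_prime) auto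
    then obtain c where "p choose j = p * c" by blast
    then show ?thesis
      by (intro eqmI[of _ _ _ "of_nat c * (a ^ j * b ^ (p - j))"]) (simp add: mult.assoc)
  qed
  have "{..p} = insert 0 (insert p {1..<p})" using p1 by auto
  then have "(a + b) ^ p = b ^ p + (a ^ p + (\<Sum>j\<in>{1..<p}. of_nat (p choose j) * (a ^ j * b ^ (p - j))))"
    unfolding commuting_binomial[OF ab] using p1 by simp
  also have "eqm p \<dots> (b ^ p + (a ^ p + (\<Sum>j\<in>{1..<p}. 0)))"
    by (intro eqm_add eqm_refl eqm_sum *)
  finally show ?thesis by (simp add: add.commute)
qed

lemma frobenius_sum:
  fixes a :: "'i \<Rightarrow> 'a::ring_1"
  assumes "finite I" and "\<And>i j. i \<in> I \<Longrightarrow> j \<in> I \<Longrightarrow> a i * a j = a j * a i" and p: "prime p"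
  shows "eqm p ((\<Sum>i\<in>I. a i) ^ p) (\<Sum>i\<in>I. a i ^ p)"
  using assms(1,2)
proof (induction I rule: finite_induct)
  case empty
  have "p > 0" using p prime_gt_0_nat by blast
  then show ?case by (simp add: zero_power)
next
  case (insert i I)
  have "a i * (\<Sum>j\<in>I. a j) = (\<Sum>j\<in>I. a j) * a i"
    using insert.prems by (simp add: sum_distrib_left sum_distrib_right)
  from frobenius_add[OF this p] have "eqm p ((\<Sum>j\<in>insert i I. a j) ^ p) (a i ^ p + (\<Sum>j\<in>I. a j) ^ p)"
    using insert.hyps by simp
  also have "eqm p \<dots> (a i ^ p + (\<Sum>j\<in>I. a j ^ p))"
    using insert by (intro eqm_add) auto
  finally show ?case using insert.hyps by simp
qed

lemma eqm_uminus_one_power: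
  assumes "prime p" shows "eqm p ((- 1 :: 'a::ring_1) ^ p) (- 1)"
proof (cases "p = 2")
  case True
  then show ?thesis by (intro eqmI[of _ _ _ 1]) simp
next
  case False
  then have "odd p" using assms primes_dvd_imp_eq two_is_prime_nat by blast
  then show ?thesis by simp
qed

text \<open>The corner at an idempotent \<open>e\<close>: identities that hold there carry a trailing factor
  \<open>e\<close>, and \<open>S\<close> is a subring whose elements commute with \<open>e\<close>.\<close>

locale weyl_relation =
  fixes p :: nat and S :: "'a::ring_1 set" and e y x d :: 'a
  assumes S_add: "a \<in> S \<Longrightarrow> b \<in> S \<Longrightarrow> a + b \<in> S"
    and S_mult: "a \<in> S \<Longrightarrow> b \<in> S \<Longrightarrow> a * b \<in> S"
    and S_minus: "a \<in> S \<Longrightarrow> - a \<in> S"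
    and S_one: "1 \<in> S"
    and S_e: "a \<in> S \<Longrightarrow> a * e = e * a"
    and ee: "e * e = e"
    and y: "y \<in> S" and x: "x \<in> S" and d: "d \<in> S"
    and d_comm: "a \<in> S \<Longrightarrow> d * a = a * d"
    and weyl: "eqm p (y * x * e) (x * y * e + d * e)"
begin

definition cg :: "'a \<Rightarrow> 'a \<Rightarrow> bool" where "cg a b \<longleftrightarrow> eqm p (a * e) (b * e)"

lemma S_diff: "a \<in> S \<Longrightarrow> b \<in> S \<Longrightarrow> a - b \<in> S"
  using S_add S_minus by (metis diff_conv_add_uminus)

lemma S_zero: "0 \<in> S" using S_diff[OF S_one S_one] by simp

lemma S_of_nat: "of_nat n \<in> S"
  by (induction n) (auto simp: S_zero S_one intro: S_add)

lemma S_power: "a \<in> S \<Longrightarrow> a ^ n \<in> S"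
  by (induction n) (auto simp: S_one intro: S_mult)

lemmas S_intros = S_add S_mult S_diff S_minus S_one S_zero S_of_nat S_power y x d

lemma cg_refl [simp]: "cg a a" by (simp add: cg_def)
lemma cg_sym: "cg a b \<Longrightarrow> cg b a" by (simp add: cg_def eqm_sym)
lemma cg_trans [trans]: "cg a b \<Longrightarrow> cg b c \<Longrightarrow> cg a c" unfolding cg_def by (rule eqm_trans)
lemma eq_cg_trans [trans]: "a = b \<Longrightarrow> cg b c \<Longrightarrow> cg a c" by simp
lemma cg_eq_trans [trans]: "cg a b \<Longrightarrow> b = c \<Longrightarrow> cg a c" by simp
lemma cg_add: "cg a b \<Longrightarrow> cg c c' \<Longrightarrow> cg (a + c) (b + c')"
  by (simp add: cg_def distrib_right eqm_add)
lemma cg_diff: "cg a b \<Longrightarrow> cg c c' \<Longrightarrow> cg (a - c) (b - c')"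
  by (simp add: cg_def left_diff_distrib eqm_diff)
lemma cg_left: "cg a b \<Longrightarrow> cg (c * a) (c * b)"
  by (simp add: cg_def mult.assoc eqm_mult_left)
text \<open>The factor \<open>e\<close> stands on the right, so left multiplication is harmless,
  whereas a right factor has to be moved past \<open>e\<close> and must therefore lie in
  \<open>S\<close>.\<close>

lemma cg_right: "cg a b \<Longrightarrow> c \<in> S \<Longrightarrow> cg (a * c) (b * c)"
  unfolding cg_def by (metis S_e eqm_mult_right mult.assoc)

lemma weyl_cg: "cg (y * x) (x * y + d)"
  using weyl by (simp add: cg_def distrib_right)

lemma d_pow_comm: "a \<in> S \<Longrightarrow> d ^ n * a = a * d ^ n"
  using power_commuting_commutes[OF d_comm] by simp

lemma scalar_left:
  assumes "a \<in> S" shows "a * (of_nat n * d * c) = of_nat n * d * (a * c)"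
proof -
  have "a * (of_nat n * d * c) = (a * of_nat n) * d * c" by (simp only: mult.assoc)
  also have "a * of_nat n = of_nat n * a" by (simp only: mult_of_nat_commute)
  also have "of_nat n * a * d * c = of_nat n * (a * d) * c" by (simp only: mult.assoc)
  also have "a * d = d * a" using d_comm[OF assms] by simp
  finally show ?thesis by (simp only: mult.assoc)
qed

text \<open>Commutation with \<open>y\<close> is the derivation \<open>d * (d/dx)\<close> on powers
  of \<open>x\<close>; \<open>y_power_x\<close> is the mirror image with the roles of
  \<open>x\<close> and \<open>y\<close> exchanged.\<close>

lemma y_x_power: "cg (y * x ^ Suc n) (x ^ Suc n * y + of_nat (Suc n) * d * x ^ n)"
proof (induction n)
  case 0
  then show ?case using weyl_cg by simp
next
  case (Suc n)
  have "y * x ^ Suc (Suc n) = y * x * x ^ Suc n" by (simp add: mult.assoc)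
  also have "cg \<dots> ((x * y + d) * x ^ Suc n)"
    by (intro cg_right weyl_cg S_intros)
  also have "(x * y + d) * x ^ Suc n = x * (y * x ^ Suc n) + d * x ^ Suc n"
    by (simp add: distrib_right mult.assoc)
  also have "cg \<dots> (x * (x ^ Suc n * y + of_nat (Suc n) * d * x ^ n) + d * x ^ Suc n)"
    by (intro cg_add cg_left cg_refl Suc)
  also have "x * (of_nat (Suc n) * d * x ^ n) = of_nat (Suc n) * d * x ^ Suc n"
    using scalar_left[OF x, of "Suc n" "x ^ n"] by (simp add: mult.assoc)
  then have "x * (x ^ Suc n * y + of_nat (Suc n) * d * x ^ n) + d * x ^ Suc n
      = x ^ Suc (Suc n) * y + of_nat (Suc (Suc n)) * d * x ^ Suc n"
    by (simp add: distrib_left distrib_right mult.assoc)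
  finally show ?case .
qed

lemma y_power_x: "cg (y ^ Suc n * x) (x * y ^ Suc n + of_nat (Suc n) * d * y ^ n)"
proof (induction n)
  case 0
  then show ?case using weyl_cg by simp
next
  case (Suc n)
  have "y ^ Suc (Suc n) * x = y * (y ^ Suc n * x)" by (simp add: mult.assoc)
  also have "cg \<dots> (y * (x * y ^ Suc n + of_nat (Suc n) * d * y ^ n))"
    by (intro cg_left Suc)
  also have "\<dots> = y * x * y ^ Suc n + of_nat (Suc n) * d * y ^ Suc n"
    using scalar_left[OF y, of "Suc n" "y ^ n"] by (simp add: distrib_left mult.assoc)
  also have "cg \<dots> ((x * y + d) * y ^ Suc n + of_nat (Suc n) * d * y ^ Suc n)"
    by (intro cg_add cg_right weyl_cg S_intros cg_refl)
  also have "\<dots> = x * y ^ Suc (Suc n) + of_nat (Suc (Suc n)) * d * y ^ Suc n"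
    by (simp add: distrib_left distrib_right mult.assoc)
  finally show ?case .
qed

text \<open>The \<open>n\<close>-fold commutator of \<open>y\<close> with \<open>x ^ n\<close>. For
  \<open>n = p - 1\<close> the factorial is prime to \<open>p\<close>, so this constant can stand in
  for 1 where no division is available.\<close>

definition unit_const :: "nat \<Rightarrow> 'a" where "unit_const n = of_nat (fact n) * d ^ n"

lemma unit_const_S: "unit_const n \<in> S"
  unfolding unit_const_def by (intro S_intros)

lemma unit_const_comm: "a \<in> S \<Longrightarrow> unit_const n * a = a * unit_const n"
  unfolding unit_const_def by (metis d_pow_comm mult.assoc mult_of_nat_commute)

lemma unit_const_Suc: "unit_const (Suc n) = unit_const n * (of_nat (Suc n) * d)"
  unfolding unit_const_def
proof -
  have "of_nat (fact (Suc n)) * d ^ Suc n = of_nat (fact n) * (of_nat (Suc n) * d ^ n) * d"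
    by (simp only: fact_Suc of_nat_mult of_nat_id mult.commute[of "Suc n" "fact n"] mult.assoc power_Suc2)
  also have "of_nat (Suc n) * d ^ n = d ^ n * of_nat (Suc n)" by (rule mult_of_nat_commute)
  finally show "of_nat (fact (Suc n)) * d ^ Suc n = of_nat (fact n) * d ^ n * (of_nat (Suc n) * d)"
    by (simp only: mult.assoc)
qed

text \<open>Modulo the left ideal generated by \<open>y\<close>, powers of \<open>x\<close> behave
  as in the polynomial representation of the Weyl algebra: applying \<open>y ^ n\<close>
  differentiates \<open>x ^ n\<close> down to the constant.\<close>

lemma split_y_power: "\<exists>a\<in>S. cg (unit_const n) (y ^ n * x ^ n + a * y)"
proof (induction n)
  case 0
  have "cg (unit_const 0) (y ^ 0 * x ^ 0 + 0 * y)" by (simp add: unit_const_def)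
  then show ?case using S_zero by blast
next
  case (Suc n)
  then obtain a where a: "a \<in> S" "cg (unit_const n) (y ^ n * x ^ n + a * y)" by blast
  have "y ^ Suc n * x ^ Suc n = y ^ n * (y * x ^ Suc n)"
    by (simp only: power_Suc2[of y] mult.assoc)
  also have "cg \<dots> (y ^ n * (x ^ Suc n * y + of_nat (Suc n) * d * x ^ n))"
    by (intro cg_left y_x_power)
  finally have 1: "cg (y ^ Suc n * x ^ Suc n) (y ^ n * (x ^ Suc n * y + of_nat (Suc n) * d * x ^ n))" .
  have k: "(of_nat (Suc n) * d) * b = b * (of_nat (Suc n) * d)" if "b \<in> S" for b
    using scalar_left[OF that, of "Suc n" 1] by simp
  have "unit_const (Suc n) = (of_nat (Suc n) * d) * unit_const n"
    unfolding unit_const_Suc by (rule k[symmetric]) (rule unit_const_S)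
  also have "cg \<dots> ((of_nat (Suc n) * d) * (y ^ n * x ^ n + a * y))"
    by (intro cg_left a)
  also have "\<dots> = of_nat (Suc n) * d * y ^ n * x ^ n + of_nat (Suc n) * d * a * y"
    by (simp only: distrib_left mult.assoc)
  also have "\<dots> = y ^ n * (of_nat (Suc n) * d) * x ^ n + of_nat (Suc n) * d * a * y"
    by (simp only: k[OF S_power[OF y]])
  also have "\<dots> = y ^ n * (x ^ Suc n * y + of_nat (Suc n) * d * x ^ n)
        + (of_nat (Suc n) * d * a - y ^ n * x ^ Suc n) * y"
    by (simp only: distrib_left left_diff_distrib mult.assoc) simp
  also have "cg \<dots> (y ^ Suc n * x ^ Suc n + (of_nat (Suc n) * d * a - y ^ n * x ^ Suc n) * y)"
    by (intro cg_add cg_refl cg_sym[OF 1])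
  finally show ?case
    by (intro bexI[of _ "of_nat (Suc n) * d * a - y ^ n * x ^ Suc n"] S_intros a)
qed

lemma split_y: "\<exists>a\<in>S. \<exists>b\<in>S. cg (unit_const n) (y * a + b * y ^ n)"
proof (induction n)
  case 0
  have "cg (unit_const 0) (y * 0 + 1 * y ^ 0)" by (simp add: unit_const_def)
  then show ?case using S_zero S_one by blast
next
  case (Suc n)
  then obtain a b where ab: "a \<in> S" "b \<in> S" "cg (unit_const n) (y * a + b * y ^ n)" by blast
  \<comment> \<open>\<open>w\<close> agrees with \<open>Suc n * d\<close> up to the right multiple
    \<open>y * x\<close> of \<open>y\<close>, and it trades \<open>y ^ n\<close> for
    \<open>y ^ Suc n\<close>: by \<open>y_power_x\<close> the terms in \<open>d\<close> cancel in
    \<open>y ^ n * w\<close> and leave \<open>- (x * y ^ Suc n)\<close>.\<close>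
  define w where "w = of_nat (Suc n) * d - y * x"
  have wS: "w \<in> S" unfolding w_def by (intro S_intros)
  have "y ^ n * w = of_nat (Suc n) * d * y ^ n - y ^ Suc n * x"
  proof -
    have "y ^ n * (of_nat (Suc n) * d) = of_nat (Suc n) * (d * y ^ n)"
      using scalar_left[OF S_power[OF y, of n], of "Suc n" 1] by (simp only: mult_1_right mult.assoc)
    then show ?thesis
      by (simp only: w_def right_diff_distrib mult.assoc power_Suc2)
  qed
  also have "cg \<dots> (of_nat (Suc n) * d * y ^ n - (x * y ^ Suc n + of_nat (Suc n) * d * y ^ n))"
    by (intro cg_diff cg_refl y_power_x)
  also have "\<dots> = - (x * y ^ Suc n)" by simp
  finally have 1: "cg (y ^ n * w) (- (x * y ^ Suc n))" .
  have "unit_const (Suc n) = unit_const n * w + unit_const n * y * x"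
    unfolding unit_const_Suc w_def by (simp add: right_diff_distrib mult.assoc)
  also have "unit_const n * y * x = y * unit_const n * x"
    by (simp add: unit_const_comm y)
  also have "cg (unit_const n * w + y * unit_const n * x)
      ((y * a + b * y ^ n) * w + y * unit_const n * x)"
    by (intro cg_add cg_right ab wS cg_refl)
  also have "\<dots> = y * (a * w + unit_const n * x) + b * (y ^ n * w)"
    by (simp only: distrib_left distrib_right mult.assoc add_ac)
  also have "cg \<dots> (y * (a * w + unit_const n * x) + b * (- (x * y ^ Suc n)))"
    by (intro cg_add cg_left cg_refl 1)
  also have "\<dots> = y * (a * w + unit_const n * x) + (- (b * x)) * y ^ Suc n"
    by (simp add: mult.assoc)
  finally have 2: "cg (unit_const (Suc n)) (y * (a * w + unit_const n * x) + (- (b * x)) * y ^ Suc n)" .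
  have 3: "a * w + unit_const n * x \<in> S" and 4: "- (b * x) \<in> S"
    by (intro S_intros ab wS unit_const_S)+
  show ?case by (rule bexI[OF _ 3], rule bexI[OF _ 4], rule 2)
qed

text \<open>The pointwise splittings combine to a contracting homotopy \<open>(s, t)\<close> of the
  2-periodic complex with differentials \<open>y\<close> and \<open>y ^ n\<close>.\<close>

lemma periodic_contraction:
  assumes nil: "eqm p (y ^ Suc n * e) 0"
  shows "\<exists>s\<in>S. \<exists>t\<in>S. cg (unit_const n * unit_const n) (y * s + t * y ^ n)
      \<and> cg (unit_const n * unit_const n) (y ^ n * t + s * y)"
proof -
  let ?z = "y ^ n" and ?D = "unit_const n"
  obtain W where W: "W \<in> S" "cg ?D (?z * x ^ n + W * y)" using split_y_power by blast
  obtain A B where AB: "A \<in> S" "B \<in> S" "cg ?D (y * A + B * ?z)" using split_y by blast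
  define U where "U = x ^ n"
  have U: "U \<in> S" unfolding U_def by (intro S_intros)
  note W = W(1) W(2)[folded U_def]
  have z: "?z \<in> S" by (intro S_intros)
  have D: "?D * c = c * ?D" if "c \<in> S" for c using unit_const_comm that .
  have yz: "cg (y * ?z) 0" and zy: "cg (?z * y) 0"
    using nil by (simp_all add: cg_def power_commutes)
  have zero: "cg (a * b * c) 0" if "cg (a * b) 0" "c \<in> S" for a b c
    using cg_right[OF that] by simp
  have "?D * y = y * ?D" using D y by blast
  also have "cg \<dots> (y * (?z * U + W * y))" by (intro cg_left W)
  also have "\<dots> = y * ?z * U + y * W * y" by (simp add: distrib_left mult.assoc)
  also have "cg \<dots> (0 + y * W * y)" by (intro cg_add zero yz U cg_refl)
  finally have 1: "cg (?D * y) (y * W * y)" by simp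
  have "cg (?D * ?z) ((?z * U + W * y) * ?z)" by (intro cg_right W z)
  also have "\<dots> = ?z * U * ?z + W * (y * ?z)" by (simp add: distrib_right mult.assoc)
  also have "cg \<dots> (?z * U * ?z + W * 0)" by (intro cg_add cg_left yz cg_refl)
  finally have 2: "cg (?D * ?z) (?z * U * ?z)" by simp
  have "?D * ?z = ?z * ?D" using D z by blast
  also have "cg \<dots> (?z * (y * A + B * ?z))" by (intro cg_left AB)
  also have "\<dots> = ?z * y * A + ?z * B * ?z" by (simp add: distrib_left mult.assoc)
  also have "cg \<dots> (0 + ?z * B * ?z)" by (intro cg_add zero zy AB cg_refl)
  finally have 3: "cg (?D * ?z) (?z * B * ?z)" by simp
  have "cg (?D * y) ((y * A + B * ?z) * y)" by (intro cg_right AB y)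
  also have "\<dots> = y * A * y + B * (?z * y)" by (simp add: distrib_right mult.assoc)
  also have "cg \<dots> (y * A * y + B * 0)" by (intro cg_add cg_left zy cg_refl)
  finally have 4: "cg (?D * y) (y * A * y)" by simp
  \<comment> \<open>By 1 to 4, \<open>W\<close> and \<open>A\<close> are both generalised inverses
    of \<open>y\<close> up to the factor \<open>?D\<close>, and \<open>B\<close> and
    \<open>U\<close> are both generalised inverses of \<open>?z\<close>. Sandwiching
    \<open>y\<close> between \<open>W\<close> and \<open>A\<close>, and \<open>?z\<close> between
    \<open>B\<close> and \<open>U\<close>, gives a pair that fits both splittings at once.\<close>
  define s where "s = W * y * A"
  define t where "t = B * ?z * U"
  have st: "s \<in> S" "t \<in> S" unfolding s_def t_def by (intro S_intros W AB U)+
  have "cg (?D * ?D) (?D * (y * A + B * ?z))" by (intro cg_left AB)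
  also have "\<dots> = (?D * y) * A + B * (?D * ?z)"
    using D[OF AB(2)] by (simp add: distrib_left mult.assoc[symmetric])
  also have "cg \<dots> (y * W * y * A + B * (?z * U * ?z))"
    by (intro cg_add cg_left cg_right 1 2 AB)
  also have "\<dots> = y * s + t * ?z" by (simp add: s_def t_def mult.assoc)
  finally have I: "cg (?D * ?D) (y * s + t * ?z)" .
  have "cg (?D * ?D) (?D * (?z * U + W * y))" by (intro cg_left W)
  also have "\<dots> = (?D * ?z) * U + W * (?D * y)"
    using D[OF W(1)] by (simp add: distrib_left mult.assoc[symmetric])
  also have "cg \<dots> (?z * B * ?z * U + W * (y * A * y))"
    by (intro cg_add cg_left cg_right 3 4 U)
  also have "\<dots> = ?z * t + s * y" by (simp add: s_def t_def mult.assoc)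
  finally have II: "cg (?D * ?D) (?z * t + s * y)" .
  from I II st show ?thesis by blast
qed

end

section \<open>Alternating chains\<close>

typedef (overloaded) 'a endo = "{f :: 'a::comm_ring_1 \<Rightarrow> 'a. \<forall>x y. f (x + y) = f x + f y}"
  morphisms app Endo
  by (rule exI[of _ "\<lambda>x. x"]) simp

setup_lifting type_definition_endo

instantiation endo :: (comm_ring_1) ring_1
begin
lift_definition zero_endo :: "'a endo" is "\<lambda>x. 0" by simp
lift_definition one_endo :: "'a endo" is "\<lambda>x. x" by simp
lift_definition plus_endo :: "'a endo \<Rightarrow> 'a endo \<Rightarrow> 'a endo" is "\<lambda>f g x. f x + g x" by simp
lift_definition minus_endo :: "'a endo \<Rightarrow> 'a endo \<Rightarrow> 'a endo" is "\<lambda>f g x. f x - g x" by simp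
lift_definition uminus_endo :: "'a endo \<Rightarrow> 'a endo" is "\<lambda>f x. - f x" by simp
lift_definition times_endo :: "'a endo \<Rightarrow> 'a endo \<Rightarrow> 'a endo" is "\<lambda>f g x. f (g x)" by simp
instance
proof
  fix a b c :: "'a endo"
  show "a + b + c = a + (b + c)" by transfer (auto simp: fun_eq_iff algebra_simps)
  show "a + b = b + a" by transfer (auto simp: fun_eq_iff algebra_simps)
  show "0 + a = a" by transfer (auto simp: fun_eq_iff)
  show "- a + a = 0" by transfer (auto simp: fun_eq_iff)
  show "a - b = a + - b" by transfer (auto simp: fun_eq_iff)
  show "a * b * c = a * (b * c)" by transfer (auto simp: fun_eq_iff)
  show "1 * a = a" by transfer (auto simp: fun_eq_iff)
  show "a * 1 = a" by transfer (auto simp: fun_eq_iff)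
  show "(a + b) * c = a * c + b * c" by transfer (auto simp: fun_eq_iff)
  show "a * (b + c) = a * b + a * c" by transfer (auto simp: fun_eq_iff)
  show "(0 :: 'a endo) \<noteq> 1" by transfer (metis zero_neq_one)
qed
end

lemma endo_eqI: "(\<And>f. app A f = app B f) \<Longrightarrow> A = B"
  by transfer (auto simp: fun_eq_iff)

lemma app_add [simp]: "app A (f + g) = app A f + app A g"
  using app[of A] by simp

lemma app_endo_zero [simp]: "app 0 f = 0" by transfer simp
lemma app_endo_one [simp]: "app 1 f = f" by transfer simp
lemma app_endo_add [simp]: "app (A + B) f = app A f + app B f" by transfer simp
lemma app_endo_diff [simp]: "app (A - B) f = app A f - app B f" by transfer simp
lemma app_endo_minus [simp]: "app (- A) f = - app A f" by transfer simp
lemma app_endo_mult [simp]: "app (A * B) f = app A (app B f)" by transfer simp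

lemma app_zero [simp]: "app A 0 = 0"
  using app_add[of A 0 0] by simp

lemma app_minus [simp]: "app A (- f) = - app A f"
  using app_add[of A f "- f"] by (simp add: eq_neg_iff_add_eq_0 add.commute)

lemma app_diff [simp]: "app A (f - g) = app A f - app A g"
  using app_add[of A f "- g"] by simp

lemma app_endo_sum: "app (\<Sum>i\<in>I. A i) f = (\<Sum>i\<in>I. app (A i) f)"
  by (induction I rule: infinite_finite_induct) auto

lemma app_of_nat [simp]: "app (of_nat n) f = of_nat n * f"
  by (induction n) (auto simp: distrib_right)

lemma app_nat_mult: "app A (of_nat n * f) = of_nat n * app A f"
  by (induction n) (auto simp: distrib_right)

lemma eqm_endo:
  assumes "eqm p A B" shows "eqm p (app A f) (app B f)"
proof -
  obtain C where "A = B + of_nat p * C" using assms by (rule eqmE)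
  then show ?thesis by (intro eqmI[of _ _ _ "app C f"]) simp
qed

lemma eqm_app:
  assumes "eqm p f g" shows "eqm p (app A f) (app A g)"
proof -
  obtain h where "f = g + of_nat p * h" using assms by (rule eqmE)
  then show ?thesis by (intro eqmI[of _ _ _ "app A h"]) (simp add: app_nat_mult)
qed

lemma eqm_fun: "eqm p f g \<longleftrightarrow> (\<forall>x. eqm p (f x) (g x))"
proof
  assume "eqm p f g"
  then obtain h where "f = g + of_nat p * h" by (rule eqmE)
  then show "\<forall>x. eqm p (f x) (g x)" by (auto intro: eqmI)
next
  assume *: "\<forall>x. eqm p (f x) (g x)"
  then have "\<forall>x. \<exists>c. f x = g x + of_nat p * c" by (metis eqmE)
  then obtain h where "\<forall>x. f x = g x + of_nat p * h x" by metis
  then have "f = g + of_nat p * h" by (auto simp: fun_eq_iff)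
  then show "eqm p f g" by (rule eqmI)
qed

text \<open>A chain is given by its coefficients on lists of vertices. For the simplicial chains below
  these are alternating, so that an oriented simplex corresponds to all orderings of its vertices at
  once and the boundary \<open>bd\<close> only has to remove the head of the list.\<close>

type_synonym 'v chain = "'v list \<Rightarrow> int poly"

definition mulE :: "'v chain \<Rightarrow> 'v chain endo" where
  "mulE \<phi> = Endo (\<lambda>f. \<phi> * f)"

definition pull :: "('v \<Rightarrow> 'v) \<Rightarrow> 'v chain endo" where
  "pull g = Endo (\<lambda>f xs. f (map g xs))"

definition bd :: "'v set \<Rightarrow> 'v chain endo" where
  "bd X = Endo (\<lambda>f ys. \<Sum>a\<in>X. f (a # ys))"

lemma app_mulE: "app (mulE \<phi>) f = \<phi> * f"
  unfolding mulE_def by (subst Endo_inverse) (auto simp: distrib_left)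

lemma app_pull: "app (pull g) f xs = f (map g xs)"
  unfolding pull_def by (subst Endo_inverse) (auto simp: fun_eq_iff)

lemma app_bd: "app (bd X) f ys = (\<Sum>a\<in>X. f (a # ys))"
  unfolding bd_def by (subst Endo_inverse) (auto simp: fun_eq_iff sum.distrib)

lemma mulE_mult: "mulE \<phi> * mulE \<psi> = mulE (\<phi> * \<psi>)"
  by (rule endo_eqI) (simp add: app_mulE mult.assoc)

lemma mulE_comm: "mulE \<phi> * mulE \<psi> = mulE \<psi> * mulE \<phi>"
  by (simp add: mulE_mult mult.commute)

lemma mulE_add: "mulE \<phi> + mulE \<psi> = mulE (\<phi> + \<psi>)"
  by (rule endo_eqI) (simp add: app_mulE distrib_right)

lemma mulE_zero: "mulE 0 = 0" by (rule endo_eqI) (simp add: app_mulE)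
lemma mulE_one: "mulE 1 = 1" by (rule endo_eqI) (simp add: app_mulE)

lemma mulE_of_nat: "of_nat n = mulE (of_nat n)" by (rule endo_eqI) (simp add: app_mulE)

lemma mulE_sum: "(\<Sum>i\<in>I. mulE (\<phi> i)) = mulE (\<Sum>i\<in>I. \<phi> i)"
  by (induction I rule: infinite_finite_induct) (auto simp: mulE_zero[unfolded zero_fun_def] mulE_add plus_fun_def)

lemma mulE_power: "mulE \<phi> ^ n = mulE (\<phi> ^ n)"
  by (induction n) (auto simp: mulE_one[unfolded one_fun_def] mulE_mult times_fun_def)

lemma eqm_mulE: assumes "eqm p \<phi> \<psi>" shows "eqm p (mulE \<phi>) (mulE \<psi>)"
proof -
  obtain c where "\<phi> = \<psi> + of_nat p * c" using assms by (rule eqmE)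
  then have "mulE \<phi> = mulE \<psi> + of_nat p * mulE c"
    by (simp only: mulE_of_nat mulE_mult mulE_add)
  then show ?thesis by (rule eqmI)
qed

lemma pull_mulE: "pull g * mulE \<phi> = mulE (\<lambda>xs. \<phi> (map g xs)) * pull g"
  by (rule endo_eqI) (auto simp: app_mulE app_pull fun_eq_iff)

lemma pull_id: "pull (\<lambda>x. x) = 1"
  by (rule endo_eqI) (auto simp: app_pull fun_eq_iff)

lemma pull_mult: "pull g * pull h = pull (h \<circ> g)"
  by (rule endo_eqI) (auto simp: app_pull fun_eq_iff)

lemma pull_power: "pull g ^ n = pull (g ^^ n)"
  by (induction n) (auto simp: pull_id[symmetric] pull_mult fun_eq_iff id_def funpow_swap1 o_def
      intro!: arg_cong[of _ _ pull])

lemma bd_mulE_const: "bd X * mulE (\<lambda>_. c) = mulE (\<lambda>_. c) * bd X"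
  by (rule endo_eqI) (auto simp: app_mulE app_bd fun_eq_iff sum_distrib_left)

lemma bd_pull:
  fixes g :: "'v \<Rightarrow> 'v"
  assumes "bij_betw g X X" shows "bd X * pull g = pull g * bd X"
proof (rule endo_eqI, rule ext)
  fix f :: "'v chain" and ys
  have "(\<Sum>a\<in>X. f (g a # map g ys)) = (\<Sum>a\<in>X. f (a # map g ys))"
    using sum.reindex_bij_betw[OF assms, of "\<lambda>a. f (a # map g ys)"] .
  then show "app (bd X * pull g) f ys = app (pull g * bd X) f ys"
    by (simp add: app_pull app_bd)
qed

section \<open>Alternating chains of a simplicial complex\<close>

definition alternating :: "'v chain \<Rightarrow> bool" where
  "alternating f \<longleftrightarrow> (\<forall>us a b vs. f (us @ a # b # vs) = - f (us @ b # a # vs))"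

text \<open>The index counts vertices and is thus the dimension plus one; \<open>chains K 0\<close>
  is the augmentation term of the reduced complex, spanned by the empty simplex if it belongs to
  \<open>K\<close>.\<close>

definition chains :: "'v set set \<Rightarrow> nat \<Rightarrow> 'v chain set" where
  "chains K n = {f. alternating f \<and> (\<forall>xs. f xs \<noteq> 0 \<longrightarrow> length xs = n \<and> set xs \<in> K)}"

lemma alternatingD: "alternating f \<Longrightarrow> f (us @ a # b # vs) = - f (us @ b # a # vs)"
  unfolding alternating_def
  by (drule spec[of _ us], drule spec[of _ a], drule spec[of _ b], drule spec[of _ vs])

lemma alternatingI:
  "(\<And>us a b vs. f (us @ a # b # vs) = - f (us @ b # a # vs)) \<Longrightarrow> alternating f"
  unfolding alternating_def by (intro allI)

lemma alternating_Cons: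
  assumes "alternating f" shows "alternating (\<lambda>xs. f (a # xs))"
proof (rule alternatingI)
  fix us b c vs
  show "f (a # us @ b # c # vs) = - f (a # us @ c # b # vs)"
    using alternatingD[OF assms, of "a # us" b c vs] by simp
qed

lemma alternating_swap: "alternating f \<Longrightarrow> f (a # b # vs) = - f (b # a # vs)"
  using alternatingD[of f "[]" a b vs] by simp

text \<open>Exchanging the two removed vertices turns the double sum into its negative, and
  \<open>int poly\<close> has no 2-torsion.\<close>

lemma bd_bd:
  assumes "alternating f" shows "app (bd X) (app (bd X) f) = 0"
proof (rule ext)
  fix ys
  let ?s = "\<Sum>a\<in>X. \<Sum>b\<in>X. f (b # a # ys)"
  have "?s = (\<Sum>a\<in>X. \<Sum>b\<in>X. - f (a # b # ys))"
    by (intro sum.cong refl alternating_swap assms)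
  also have "\<dots> = - ?s" by (subst sum.swap) (simp add: sum_negf)
  finally have "?s = 0" by simp
  then show "app (bd X) (app (bd X) f) ys = 0 ys" by (simp add: app_bd)
qed

lemma chainsI:
  "alternating f \<Longrightarrow> (\<And>xs. f xs \<noteq> 0 \<Longrightarrow> length xs = n \<and> set xs \<in> K) \<Longrightarrow> f \<in> chains K n"
  unfolding chains_def by blast

lemma chainsD: "f \<in> chains K n \<Longrightarrow> alternating f"
    "f \<in> chains K n \<Longrightarrow> f xs \<noteq> 0 \<Longrightarrow> length xs = n"
    "f \<in> chains K n \<Longrightarrow> f xs \<noteq> 0 \<Longrightarrow> set xs \<in> K"
  unfolding chains_def by blast+

lemma chains_zero: "0 \<in> chains K n"
  by (auto intro!: chainsI alternatingI)

lemma chains_add: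
  assumes "f \<in> chains K n" "g \<in> chains K n" shows "f + g \<in> chains K n"
proof (rule chainsI)
  show "alternating (f + g)"
  proof (rule alternatingI)
    fix us a b vs
    show "(f + g) (us @ a # b # vs) = - (f + g) (us @ b # a # vs)"
      using alternatingD[OF chainsD(1)[OF assms(1)], of us a b vs]
        alternatingD[OF chainsD(1)[OF assms(2)], of us a b vs] by simp
  qed
  fix xs assume "(f + g) xs \<noteq> 0"
  then have "f xs \<noteq> 0 \<or> g xs \<noteq> 0" by auto
  then show "length xs = n \<and> set xs \<in> K"
    using chainsD(2,3)[OF assms(1), of xs] chainsD(2,3)[OF assms(2), of xs] by blast
qed

lemma chains_set_mult:
  assumes "f \<in> chains K n" shows "(\<lambda>xs. \<phi> (set xs)) * f \<in> chains K n"
proof (rule chainsI)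
  show "alternating ((\<lambda>xs. \<phi> (set xs)) * f)"
  proof (rule alternatingI)
    fix us a b vs
    show "((\<lambda>xs. \<phi> (set xs)) * f) (us @ a # b # vs) = - ((\<lambda>xs. \<phi> (set xs)) * f) (us @ b # a # vs)"
      using alternatingD[OF chainsD(1)[OF assms], of us a b vs] by (simp add: insert_commute)
  qed
  fix xs assume "((\<lambda>xs. \<phi> (set xs)) * f) xs \<noteq> 0"
  then show "length xs = n \<and> set xs \<in> K" using chainsD(2,3)[OF assms, of xs] by auto
qed

lemma chains_const_mult: "f \<in> chains K n \<Longrightarrow> (\<lambda>_. c) * f \<in> chains K n"
  by (rule chains_set_mult)

lemma chains_minus:
  assumes "f \<in> chains K n" shows "- f \<in> chains K n"
proof -
  have "- f = (\<lambda>_. - 1) * f" by (simp add: fun_eq_iff)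
  then show ?thesis using chains_const_mult[OF assms] by simp
qed

lemma chains_diff: "f \<in> chains K n \<Longrightarrow> g \<in> chains K n \<Longrightarrow> f - g \<in> chains K n"
  using chains_add[of f K n "- g"] chains_minus[of g K n] by simp

lemma chains_pull:
  assumes "f \<in> chains K n" "\<And>x. g ` x \<in> K \<Longrightarrow> x \<in> K" shows "app (pull g) f \<in> chains K n"
proof (rule chainsI)
  show "alternating (app (pull g) f)"
  proof (rule alternatingI)
    fix us a b vs
    show "app (pull g) f (us @ a # b # vs) = - app (pull g) f (us @ b # a # vs)"
      using alternatingD[OF chainsD(1)[OF assms(1)], of "map g us" "g a" "g b" "map g vs"]
      by (simp add: app_pull)
  qed
  show "length xs = n \<and> set xs \<in> K" if "app (pull g) f xs \<noteq> 0" for xs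
    using that chainsD(2,3)[OF assms(1), of "map g xs"] assms(2)[of "set xs"] by (auto simp: app_pull)
qed

lemma chains_bd:
  assumes f: "f \<in> chains K (Suc n)" and K: "\<And>x y. y \<in> K \<Longrightarrow> x \<subseteq> y \<Longrightarrow> x \<in> K"
  shows "app (bd X) f \<in> chains K n"
proof (rule chainsI)
  show "alternating (app (bd X) f)"
  proof (rule alternatingI)
    fix us a b vs
    have "f (c # us @ a # b # vs) = - f (c # us @ b # a # vs)" for c
      using alternatingD[OF chainsD(1)[OF f], of "c # us" a b vs] by simp
    then show "app (bd X) f (us @ a # b # vs) = - app (bd X) f (us @ b # a # vs)"
      unfolding app_bd sum_negf[symmetric] by (intro sum.cong refl)
  qed
  show "length xs = n \<and> set xs \<in> K" if nz: "app (bd X) f xs \<noteq> 0" for xs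
  proof -
    obtain a where "f (a # xs) \<noteq> 0" using nz by (auto simp: app_bd intro: sum.neutral)
    then show ?thesis using chainsD(2,3)[OF f, of "a # xs"] K[of "set (a # xs)" "set xs"] by auto
  qed
qed

lemma chains_bd_0: "f \<in> chains K 0 \<Longrightarrow> app (bd X) f = 0"
  using chainsD(2)[of f K 0] by (fastforce simp: fun_eq_iff app_bd intro!: sum.neutral)

lemma chains_mono: "K \<subseteq> L \<Longrightarrow> chains K n \<subseteq> chains L n"
  unfolding chains_def by blast

text \<open>The value ring has no 2-torsion, so alternation already forces vanishing on lists with
  repetitions.\<close>

lemma alternating_repeat:
  assumes "alternating f" "\<not> distinct xs" shows "f xs = 0"
proof -
  have move: "f (us @ a # vs @ ws) = 0 \<longleftrightarrow> f (us @ vs @ a # ws) = 0" for us a vs ws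
  proof (induction vs arbitrary: us)
    case (Cons b vs)
    have "f (us @ a # (b # vs) @ ws) = - f (us @ b # a # vs @ ws)"
      using alternatingD[OF assms(1), of us a b "vs @ ws"] by simp
    also have "\<dots> = 0 \<longleftrightarrow> f ((us @ [b]) @ a # vs @ ws) = 0" by simp
    also have "\<dots> \<longleftrightarrow> f (us @ (b # vs) @ a # ws) = 0" using Cons[of "us @ [b]"] by simp
    finally show ?case .
  qed simp
  obtain us a vs ws where xs: "xs = us @ a # vs @ a # ws"
    using not_distinct_decomp[OF assms(2)] by (metis append.assoc append_Cons append_Nil)
  have "f (us @ vs @ a # a # ws) = 0"
    using alternatingD[OF assms(1), of "us @ vs" a a ws] by simp
  then show ?thesis using move[of us a vs "a # ws"] by (simp add: xs)
qed

section \<open>Descent through the levels\<close>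

lemma eqm_poly_iff: "eqm p (f :: int poly) 0 \<longleftrightarrow> (\<forall>n. int p dvd coeff f n)"
proof
  assume "eqm p f 0"
  then obtain c where "f = 0 + of_nat p * c" by (rule eqmE)
  then show "\<forall>n. int p dvd coeff f n" by (simp add: of_nat_mult_conv_smult)
next
  assume "\<forall>n. int p dvd coeff f n"
  then have "[:int p:] dvd f" by (simp add: const_poly_dvd_iff)
  then obtain c where "f = [:int p:] * c" by blast
  then have "f = 0 + of_nat p * c" by (simp add: of_nat_poly)
  then show "eqm p f 0" by (rule eqmI)
qed

lemma eqm_poly_dvd: "eqm p (f :: int poly) 0 \<longleftrightarrow> [:int p:] dvd f"
  by (simp add: eqm_poly_iff const_poly_dvd_iff)

lemma prime_elem_const_poly: "prime p \<Longrightarrow> prime_elem [:int p:]"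
  by (intro lift_prime_elem_poly) simp

lemma eqm_poly_mult:
  "prime p \<Longrightarrow> eqm p (f * g :: int poly) 0 \<longleftrightarrow> eqm p f 0 \<or> eqm p g 0"
  unfolding eqm_poly_dvd by (simp add: prime_elem_dvd_mult_iff prime_elem_const_poly)

lemma eqm_poly_power: "prime p \<Longrightarrow> eqm p (f ^ n :: int poly) 0 \<Longrightarrow> eqm p f 0"
  unfolding eqm_poly_dvd using prime_elem_dvd_power prime_elem_const_poly by blast

lemma eqm_poly_prod:
  fixes f :: "'i \<Rightarrow> int poly"
  assumes "prime p" "finite I" "\<And>i. i \<in> I \<Longrightarrow> \<not> eqm p (f i) 0"
  shows "\<not> eqm p (prod f I) 0"
  using assms(2,3)
proof (induction I rule: finite_induct)
  case empty
  show ?case using prime_gt_1_nat[OF assms(1)] by (auto simp: eqm_poly_iff intro!: exI[of _ 0])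
qed (use assms(1) in \<open>auto simp: eqm_poly_mult\<close>)

lemma eqm_poly_of_nat: "prime p \<Longrightarrow> eqm p (of_nat n :: int poly) 0 \<longleftrightarrow> p dvd n"
  unfolding eqm_poly_dvd by (simp add: of_nat_poly const_poly_dvd_const_poly_iff)

lemma monom_one_mult_const: "monom 1 i * [:a :: int:] = monom a i"
  using mult_monom[of 1 i a 0] by (simp add: monom_0)

lemma comm_mult:
  fixes a :: "'a::ring_1"
  assumes "a * c = c * a" "b * c = c * b" shows "(a * b) * c = c * (a * b)"
  by (metis assms mult.assoc)

lemma comm_mult_mult:
  fixes a :: "'a::ring_1"
  assumes "a * c = c * a" "a * d = d * a" "b * c = c * b" "b * d = d * b"
  shows "(a * b) * (c * d) = (c * d) * (a * b)"
  by (rule comm_mult; rule comm_mult[symmetric]) (simp_all add: assms)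

lemma comm_power:
  fixes a :: "'a::ring_1"
  assumes "a * c = c * a" shows "(a ^ n) * c = c * (a ^ n)"
  using power_commuting_commutes[OF assms] by simp

lemma comm_sum:
  fixes a :: "'i \<Rightarrow> 'a::ring_1"
  assumes "\<And>i. i \<in> I \<Longrightarrow> a i * c = c * a i" shows "(\<Sum>i\<in>I. a i) * c = c * (\<Sum>i\<in>I. a i)"
  using assms by (simp add: sum_distrib_left sum_distrib_right)

lemma comm_minus_one:
  fixes a :: "'a::ring_1"
  assumes "a * c = c * a" shows "(a - 1) * c = c * (a - 1)"
  using assms by (simp add: algebra_simps)

lemma comm_power_mult:
  fixes a b :: "'a::ring_1"
  assumes "a * b = b * a" shows "(a * b) ^ n = a ^ n * b ^ n"
proof (induction n)
  case (Suc n)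
  have "(a * b) ^ Suc n = a * (b * a ^ n) * b ^ n" by (simp add: Suc mult.assoc)
  also have "b * a ^ n = a ^ n * b" using comm_power[OF assms] by simp
  finally show ?case by (simp add: mult.assoc)
qed simp

definition empty_chain :: "int poly \<Rightarrow> 'v chain" where
  "empty_chain c = (\<lambda>xs. if xs = [] then c else 0)"

section \<open>Commuting permutations of order p acting on chains\<close>

locale prime_action =
  fixes p k :: nat and X :: "'v set" and g :: "nat \<Rightarrow> 'v \<Rightarrow> 'v"
  assumes p: "prime p" and finX: "finite X"
    and g_bij: "i < k \<Longrightarrow> bij_betw (g i) X X"
    and g_order: "i < k \<Longrightarrow> (g i ^^ p) = id"
    and g_comm: "i < k \<Longrightarrow> j < k \<Longrightarrow> g i \<circ> g j = g j \<circ> g i"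
begin

lemma p_gt_1: "p > 1" using p prime_gt_1_nat by blast

definition G :: "nat \<Rightarrow> 'v chain endo" where "G i = pull (g i)"
definition cst :: "int poly \<Rightarrow> 'v chain endo" where "cst c = mulE (\<lambda>_. c)"
text \<open>As the powers of the variable are linearly independent modulo \<open>p\<close>, \<open>Y\<close> behaves like
  \<open>\<gamma> - 1\<close> for a generator \<open>\<gamma>\<close> of order \<open>p\<close> that has no fixed points as soon as the \<open>g i\<close> have no
  common fixed point: this reduces \<open>(Z/p)\<^sup>k\<close> to a cyclic group.\<close>

definition Y :: "'v chain endo" where "Y = (\<Sum>i<k. cst (monom 1 i) * (G i - 1))"

abbreviation "D \<equiv> bd X"

lemma cst_G: "cst c * G i = G i * cst c"
  unfolding cst_def G_def pull_mulE ..

lemma cst_cst: "cst c * cst d = cst d * cst c"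
  unfolding cst_def by (rule mulE_comm)

lemma cst_D: "cst c * D = D * cst c"
  unfolding cst_def by (rule bd_mulE_const[symmetric])

lemma G_D: "i < k \<Longrightarrow> G i * D = D * G i"
  unfolding G_def by (rule bd_pull[symmetric]) (rule g_bij)

lemma G_G: "i < k \<Longrightarrow> j < k \<Longrightarrow> G i * G j = G j * G i"
  unfolding G_def pull_mult using g_comm by simp

lemma Y_comm:
  assumes "\<And>c. cst c * A = A * cst c" "\<And>i. i < k \<Longrightarrow> G i * A = A * G i"
  shows "Y * A = A * Y"
  unfolding Y_def using assms by (intro comm_sum comm_mult comm_minus_one) auto

lemma Y_D: "Y * D = D * Y"
  by (intro Y_comm cst_D G_D)

lemma G_power: "i < k \<Longrightarrow> G i ^ p = 1"
  unfolding G_def pull_power using g_order pull_id by (simp add: id_def)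

text \<open>The summands commute, so Frobenius applies to the sum, and once more to
  \<open>G i - 1\<close>, whose \<open>p\<close>-th power is congruent to
  \<open>G i ^ p - 1 = 0\<close>.\<close>

lemma Y_nilpotent: "eqm p (Y ^ p) 0"
proof -
  have "eqm p (Y ^ p) (\<Sum>i<k. (cst (monom 1 i) * (G i - 1)) ^ p)"
    unfolding Y_def
  proof (intro frobenius_sum p finite_lessThan)
    fix i j assume "i \<in> {..<k}" "j \<in> {..<k}"
    then have *: "(G j - 1) * (G i - 1) = (G i - 1) * (G j - 1)"
      using G_G[of i j] by (simp add: algebra_simps)
    have c: "cst a * (G i - 1) = (G i - 1) * cst a" for a i
      using cst_G[of a i] by (simp add: algebra_simps)
    show "cst (monom 1 i) * (G i - 1) * (cst (monom 1 j) * (G j - 1))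
      = cst (monom 1 j) * (G j - 1) * (cst (monom 1 i) * (G i - 1))"
      by (intro comm_mult_mult cst_cst c c[symmetric] *[symmetric])
  qed
  also have "eqm p (\<Sum>i<k. (cst (monom 1 i) * (G i - 1)) ^ p) (\<Sum>i<k. 0)"
  proof (intro eqm_sum)
    fix i assume i: "i \<in> {..<k}"
    have "eqm p ((G i + - 1) ^ p) (G i ^ p + (- 1) ^ p)"
      by (rule frobenius_add) (auto simp: p)
    also have "eqm p \<dots> (1 + - 1)"
      using i by (intro eqm_add eqm_uminus_one_power p) (simp add: G_power)
    finally have "eqm p ((G i - 1) ^ p) 0" by simp
    then have "eqm p (cst (monom 1 i) ^ p * (G i - 1) ^ p) (cst (monom 1 i) ^ p * 0)"
      by (rule eqm_mult_left)
    moreover have c: "cst (monom 1 i) * (G i - 1) = (G i - 1) * cst (monom 1 i)"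
      using cst_G by (simp add: algebra_simps)
    ultimately show "eqm p ((cst (monom 1 i) * (G i - 1)) ^ p) 0"
      unfolding comm_power_mult[OF c] by simp
  qed
  finally show ?thesis by simp
qed

text \<open>The differentials of the periodic resolution for the cyclic group of order
  \<open>p\<close>, generator minus one and norm in turn: modulo \<open>p\<close> the norm element
  is the power \<open>p - 1\<close> of generator minus one.\<close>

definition alpha :: "nat \<Rightarrow> 'v chain endo" where
  "alpha i = (if odd i then Y else Y ^ (p - 1))"

lemma alpha_D: "app D (app (alpha i) f) = app (alpha i) (app D f)"
proof -
  have "alpha i * D = D * alpha i"
    unfolding alpha_def using Y_D comm_power[OF Y_D] by simp
  then show ?thesis unfolding app_endo_mult[symmetric] by simp
qed

lemma alpha_alpha: "eqm p (app (alpha (Suc i)) (app (alpha i) f)) 0"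
proof -
  have "Suc (p - 1) = p" using p_gt_1 by simp
  then have "alpha (Suc i) * alpha i = Y ^ p"
    using power_Suc[of Y "p - 1"] power_Suc2[of Y "p - 1"] by (cases "odd i") (simp_all add: alpha_def)
  then have "eqm p (alpha (Suc i) * alpha i) 0" using Y_nilpotent by simp
  from eqm_endo[OF this, of f] show ?thesis by simp
qed

text \<open>Every permutation fixes the empty simplex, so \<open>Y\<close> kills its chains;
  \<open>p - 1 > 0\<close> carries this over to the even differentials.\<close>

lemma alpha_degree_0:
  assumes f: "f \<in> chains L 0" shows "app (alpha i) f = 0"
proof -
  have z: "f xs = 0" if "xs \<noteq> []" for xs using chainsD(2)[OF f, of xs] that by auto
  have "app (G i) f = f" for i
  proof
    fix xs show "app (G i) f xs = f xs"
      using z[of xs] z[of "map (g i) xs"] by (cases xs) (auto simp: G_def app_pull)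
  qed
  then have Y0: "app Y f = 0" unfolding Y_def by (simp add: app_endo_sum)
  obtain m where "p - 1 = Suc m" using p_gt_1 by (metis not0_implies_Suc zero_less_diff less_irrefl)
  then have "app (Y ^ (p - 1)) f = app (Y ^ m) (app Y f)" by (simp only: power_Suc2 app_endo_mult)
  then show ?thesis unfolding alpha_def using Y0 by simp
qed

end

text \<open>\<open>F\<close> is an index of the faces modulo \<open>p\<close>, and
  \<open>l i\<close> is the translation by which the \<open>i\<close>-th generator changes it.
  Nested faces of equal rank share both, so multiplication by \<open>F\<close> or \<open>l i\<close>
  commutes with the boundary modulo lower ranks. The condition \<open>l_nz\<close> encodes that no
  face of positive rank has an index fixed by the whole group.\<close>

locale ranked_complex = prime_action p k X g
  for p k :: nat and X :: "'v set" and g :: "nat \<Rightarrow> 'v \<Rightarrow> 'v" +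
  fixes K :: "'v set set" and rank :: "'v set \<Rightarrow> nat" and F :: "'v set \<Rightarrow> int"
    and l :: "nat \<Rightarrow> 'v set \<Rightarrow> int"
  assumes K_X: "x \<in> K \<Longrightarrow> x \<subseteq> X"
    and K_down: "y \<in> K \<Longrightarrow> x \<subseteq> y \<Longrightarrow> x \<in> K"
    and g_K: "i < k \<Longrightarrow> x \<in> K \<Longrightarrow> g i ` x \<in> K"
    and rank_pos: "x \<in> K \<Longrightarrow> x \<noteq> {} \<Longrightarrow> rank x > 0"
    and rank_mono: "y \<in> K \<Longrightarrow> x \<subseteq> y \<Longrightarrow> rank x \<le> rank y"
    and rank_g: "i < k \<Longrightarrow> x \<in> K \<Longrightarrow> rank (g i ` x) = rank x"
    and F_const: "y \<in> K \<Longrightarrow> x \<subseteq> y \<Longrightarrow> rank x = rank y \<Longrightarrow> rank x > 0 \<Longrightarrow> F x = F y"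
    and l_const: "i < k \<Longrightarrow> y \<in> K \<Longrightarrow> x \<subseteq> y \<Longrightarrow> rank x = rank y \<Longrightarrow> rank x > 0 \<Longrightarrow> l i x = l i y"
    and F_g: "i < k \<Longrightarrow> x \<in> K \<Longrightarrow> rank x > 0 \<Longrightarrow> int p dvd F (g i ` x) - F x - l i x"
    and l_g: "i < k \<Longrightarrow> j < k \<Longrightarrow> x \<in> K \<Longrightarrow> rank x > 0 \<Longrightarrow> l i (g j ` x) = l i x"
    and l_nz: "x \<in> K \<Longrightarrow> rank x > 0 \<Longrightarrow> \<exists>i<k. \<not> int p dvd l i x"
begin

lemma g_K_iff:
  assumes "i < k" shows "g i ` x \<in> K \<longleftrightarrow> x \<in> K"
proof
  assume "g i ` x \<in> K"
  then have "(g i ^^ n) ` g i ` x \<in> K" for n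
  proof (induction n)
    case (Suc n)
    have "(g i ^^ Suc n) ` g i ` x = g i ` (g i ^^ n) ` g i ` x" by (simp add: image_comp o_assoc)
    then show ?case using g_K[OF assms Suc(1)[OF Suc(2)]] by simp
  qed simp
  from this[of "p - 1"] have "(g i ^^ Suc (p - 1)) ` x \<in> K"
    unfolding funpow_Suc_right image_comp[symmetric] .
  then show "x \<in> K" using g_order[OF assms] p_gt_1 by simp
qed (rule g_K[OF assms])

definition lev :: "nat \<Rightarrow> ('v set \<Rightarrow> int poly) \<Rightarrow> 'v chain endo" where
  "lev r \<phi> = mulE (\<lambda>xs. if set xs \<in> K \<and> rank (set xs) = r then \<phi> (set xs) else 0)"

abbreviation \<rho> where "\<rho> r \<equiv> lev r (\<lambda>_. 1)"
abbreviation "C r \<equiv> chains {x \<in> K. rank x \<le> r}"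

lemma cst_lev: "cst c * lev r \<phi> = lev r \<phi> * cst c"
  unfolding cst_def lev_def by (rule mulE_comm)

lemma lev_lev: "lev r \<phi> * lev r \<psi> = lev r (\<lambda>x. \<phi> x * \<psi> x)"
  unfolding lev_def mulE_mult by (rule arg_cong[of _ _ mulE]) (auto simp: fun_eq_iff)

lemma lev_comm: "lev r \<phi> * lev r \<psi> = lev r \<psi> * lev r \<phi>"
  unfolding lev_lev by (simp add: mult.commute)

lemma lev_cst: "cst c * lev r \<phi> = lev r (\<lambda>x. c * \<phi> x)"
  unfolding lev_def cst_def mulE_mult by (rule arg_cong[of _ _ mulE]) (auto simp: fun_eq_iff)

lemma lev_power: "n > 0 \<Longrightarrow> lev r \<phi> ^ n = lev r (\<lambda>x. \<phi> x ^ n)"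
  by (induction n rule: nat_induct_non_zero) (auto simp: lev_lev)

lemma lev_sum: "(\<Sum>i\<in>I. lev r (\<phi> i)) = lev r (\<lambda>x. \<Sum>i\<in>I. \<phi> i x)"
  unfolding lev_def mulE_sum
  by (rule arg_cong[of _ _ mulE]) (induction I rule: infinite_finite_induct; auto simp: fun_eq_iff)

lemma G_lev:
  assumes "i < k" "\<And>x. x \<in> K \<Longrightarrow> rank x = r \<Longrightarrow> \<phi> (g i ` x) = \<phi> x"
  shows "G i * lev r \<phi> = lev r \<phi> * G i"
  unfolding G_def lev_def pull_mulE
  using assms rank_g[OF assms(1)]
  by (intro arg_cong2[of _ _ _ _ "(*)"] arg_cong[of _ _ mulE] refl) (auto simp: fun_eq_iff g_K_iff)

definition M :: "nat \<Rightarrow> 'v chain endo" where "M r = lev r (\<lambda>x. [:F x:])"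
text \<open>The commutator \<open>v\<close> of \<open>Y\<close> and \<open>M\<close> has the scalar \<open>\<delta>\<close> as its \<open>p\<close>-th power, whence
  \<open>M v\<^sup>p\<^sup>-\<^sup>1 / \<delta>\<close> is conjugate to \<open>Y\<close> in the sense of the Weyl relation. The factor \<open>\<mu>\<close> clears the
  denominators, uniformly over all labels.\<close>

definition v :: "nat \<Rightarrow> 'v chain endo" where
  "v r = (\<Sum>i<k. lev r (\<lambda>x. monom (l i x) i) * G i)"
definition \<delta> :: "'v set \<Rightarrow> int poly" where "\<delta> x = (\<Sum>i<k. monom (l i x ^ p) (i * p))"

text \<open>Carrying \<open>G i\<close> across the multiplication by the index adds the translation
  \<open>l i\<close> modulo \<open>p\<close>, while the \<open>- 1\<close> in \<open>G i - 1\<close>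
  commutes with \<open>M r\<close>. Each summand of \<open>Y\<close> therefore contributes the
  corresponding summand of \<open>v r\<close>.\<close>

lemma commutator_Y_M:
  assumes r: "r > 0" shows "eqm p (Y * M r) (M r * Y + v r)"
proof -
  have "Y * M r - M r * Y = (\<Sum>i<k. cst (monom 1 i) * (G i - 1) * M r - M r * (cst (monom 1 i) * (G i - 1)))"
    unfolding Y_def sum_distrib_left sum_distrib_right sum_subtractf ..
  also have "\<dots> = (\<Sum>i<k. cst (monom 1 i) * (G i * M r - M r * G i))"
  proof (intro sum.cong refl)
    fix i
    have "M r * (cst (monom 1 i) * (G i - 1)) = cst (monom 1 i) * (M r * (G i - 1))"
      unfolding M_def mult.assoc[symmetric] cst_lev ..
    show "cst (monom 1 i) * (G i - 1) * M r - M r * (cst (monom 1 i) * (G i - 1))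
        = cst (monom 1 i) * (G i * M r - M r * G i)"
      unfolding \<open>M r * _ = _\<close> by (simp add: algebra_simps)
  qed
  also have "eqm p \<dots> (\<Sum>i<k. cst (monom 1 i) * (lev r (\<lambda>x. [:l i x:]) * G i))"
  proof (intro eqm_sum eqm_mult_left)
    fix i assume "i \<in> {..<k}"
    then have i: "i < k" by simp
    let ?L = "\<lambda>\<phi> xs. if set xs \<in> K \<and> rank (set xs) = r then \<phi> (set xs) else (0 :: int poly)"
    have "G i * M r = mulE (\<lambda>xs. ?L (\<lambda>x. [:F x:]) (map (g i) xs)) * G i"
      unfolding G_def M_def lev_def pull_mulE ..
    also have "eqm p \<dots> (mulE (?L (\<lambda>x. [:F x:]) + ?L (\<lambda>x. [:l i x:])) * G i)"
    proof (intro eqm_mult_right eqm_mulE, unfold eqm_fun, intro allI)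
      fix xs
      show "eqm p (?L (\<lambda>x. [:F x:]) (map (g i) xs)) ((?L (\<lambda>x. [:F x:]) + ?L (\<lambda>x. [:l i x:])) xs)"
      proof (cases "set xs \<in> K \<and> rank (set xs) = r")
        case True
        then obtain c where "F (g i ` set xs) - F (set xs) - l i (set xs) = int p * c"
          using F_g[OF i, of "set xs"] r by auto
        then have "F (g i ` set xs) = F (set xs) + l i (set xs) + int p * c" by simp
        then have "[:F (g i ` set xs):] = [:F (set xs):] + [:l i (set xs):] + of_nat p * [:c:]"
          by (simp add: of_nat_poly)
        then have "eqm p [:F (g i ` set xs):] ([:F (set xs):] + [:l i (set xs):])" by (rule eqmI)
        then show ?thesis using True i by (simp add: g_K_iff rank_g)
      next
        case False
        then have "\<not> (g i ` set xs \<in> K \<and> rank (g i ` set xs) = r)"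
          using i by (auto simp: g_K_iff rank_g)
        with False show ?thesis by auto
      qed
    qed
    also have "mulE (?L (\<lambda>x. [:F x:]) + ?L (\<lambda>x. [:l i x:])) * G i = M r * G i + lev r (\<lambda>x. [:l i x:]) * G i"
      unfolding mulE_add[symmetric] M_def lev_def distrib_right ..
    finally have "eqm p (G i * M r - M r * G i) (M r * G i + lev r (\<lambda>x. [:l i x:]) * G i - M r * G i)"
      by (intro eqm_diff eqm_refl)
    then show "eqm p (G i * M r - M r * G i) (lev r (\<lambda>x. [:l i x:]) * G i)" by simp
  qed
  also have "(\<Sum>i<k. cst (monom 1 i) * (lev r (\<lambda>x. [:l i x:]) * G i)) = v r"
    unfolding v_def mult.assoc[symmetric] lev_cst
    by (simp only: monom_one_mult_const)
  finally have "eqm p (M r * Y + (Y * M r - M r * Y)) (M r * Y + v r)"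
    by (intro eqm_add eqm_refl)
  then show ?thesis by simp
qed

lemma v_comm_Y:
  assumes r: "r > 0" shows "Y * v r = v r * Y"
proof (rule Y_comm)
  show "cst c * v r = v r * cst c" for c
    unfolding v_def by (rule comm_sum[symmetric], rule comm_mult) (simp_all add: cst_lev cst_G)
  show "G i * v r = v r * G i" if "i < k" for i
    unfolding v_def
  proof (rule comm_sum[symmetric], rule comm_mult)
    fix j assume "j \<in> {..<k}"
    then show "lev r (\<lambda>x. monom (l j x) j) * G i = G i * lev r (\<lambda>x. monom (l j x) j)" "G j * G i = G i * G j"
      using that r by (auto simp: l_g intro!: G_lev[symmetric] G_G)
  qed
qed

text \<open>Frobenius for commuting summands; the group elements disappear because
  \<open>G i ^ p = 1\<close>, so that only a scalar on each face remains.\<close>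

lemma v_power:
  assumes r: "r > 0" shows "eqm p (v r ^ p) (lev r \<delta>)"
proof -
  have gl: "G j * lev r (\<lambda>x. monom (l i x) i) = lev r (\<lambda>x. monom (l i x) i) * G j"
    if "i < k" "j < k" for i j
    using that r by (intro G_lev) (auto simp: l_g)
  have "eqm p (v r ^ p) (\<Sum>i<k. (lev r (\<lambda>x. monom (l i x) i) * G i) ^ p)"
    unfolding v_def
  proof (intro frobenius_sum p finite_lessThan)
    fix i j assume "i \<in> {..<k}" "j \<in> {..<k}"
    then show "lev r (\<lambda>x. monom (l i x) i) * G i * (lev r (\<lambda>x. monom (l j x) j) * G j)
        = lev r (\<lambda>x. monom (l j x) j) * G j * (lev r (\<lambda>x. monom (l i x) i) * G i)"
      by (intro comm_mult_mult lev_comm gl gl[symmetric] G_G) auto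
  qed
  also have "(\<Sum>i<k. (lev r (\<lambda>x. monom (l i x) i) * G i) ^ p) = (\<Sum>i<k. lev r (\<lambda>x. monom (l i x ^ p) (i * p)))"
  proof (intro sum.cong refl)
    fix i assume "i \<in> {..<k}"
    then have i: "i < k" by simp
    have "p > 0" using p_gt_1 by simp
    then show "(lev r (\<lambda>x. monom (l i x) i) * G i) ^ p = lev r (\<lambda>x. monom (l i x ^ p) (i * p))"
      unfolding comm_power_mult[OF gl[OF i i, symmetric]]
      by (simp add: G_power[OF i] lev_power monom_power)
  qed
  also have "\<dots> = lev r \<delta>" unfolding lev_sum \<delta>_def ..
  finally show ?thesis .
qed

text \<open>The summands sit at the distinct exponents \<open>i * p\<close>, so a single
  \<open>l i x\<close> prime to \<open>p\<close> is enough. With integer weights in place of powers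
  of the variable they could cancel.\<close>

lemma \<delta>_nonzero:
  assumes "x \<in> K" "rank x > 0" shows "\<not> eqm p (\<delta> x) 0"
proof -
  obtain i where i: "i < k" "\<not> int p dvd l i x" using l_nz[OF assms] by blast
  have "coeff (\<delta> x) (i * p) = (\<Sum>j<k. if j = i then l i x ^ p else 0)"
    unfolding \<delta>_def coeff_sum using p_gt_1 by (intro sum.cong refl) auto
  also have "\<dots> = l i x ^ p" using i by simp
  finally have "coeff (\<delta> x) (i * p) = l i x ^ p" .
  moreover have "\<not> int p dvd l i x ^ p"
  proof
    assume "int p dvd l i x ^ p"
    then have "int p dvd l i x"
      by (rule prime_elem_dvd_power[rotated]) (use p in simp)
    with i show False by blast
  qed
  ultimately show ?thesis by (metis eqm_poly_iff)
qed

definition \<Delta>_set :: "nat \<Rightarrow> int poly set" where "\<Delta>_set r = \<delta> ` {x \<in> K. rank x = r}"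
definition \<mu> :: "nat \<Rightarrow> 'v set \<Rightarrow> int poly" where "\<mu> r x = \<Prod>(\<Delta>_set r - {\<delta> x})"
definition \<Delta> :: "nat \<Rightarrow> int poly" where "\<Delta> r = \<Prod>(\<Delta>_set r)"

lemma finite_\<Delta>_set: "finite (\<Delta>_set r)"
proof -
  have "K \<subseteq> Pow X" using K_X by blast
  then have "finite K" using finX finite_subset by blast
  then show ?thesis unfolding \<Delta>_set_def by simp
qed

lemma \<mu>_\<delta>: "x \<in> K \<Longrightarrow> rank x = r \<Longrightarrow> \<mu> r x * \<delta> x = \<Delta> r"
  unfolding \<mu>_def \<Delta>_def using finite_\<Delta>_set[of r]
  by (subst (2) prod.remove[of _ "\<delta> x"]) (auto simp: \<Delta>_set_def mult.commute)

lemma \<Delta>_nonzero: "r > 0 \<Longrightarrow> \<not> eqm p (\<Delta> r) 0"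
  unfolding \<Delta>_def using \<delta>_nonzero
  by (intro eqm_poly_prod p finite_\<Delta>_set) (auto simp: \<Delta>_set_def)

definition x_op :: "nat \<Rightarrow> 'v chain endo" where "x_op r = lev r (\<mu> r) * M r * v r ^ (p - 1)"

lemma \<delta>_g: "i < k \<Longrightarrow> x \<in> K \<Longrightarrow> rank x > 0 \<Longrightarrow> \<delta> (g i ` x) = \<delta> x"
  unfolding \<delta>_def by (simp add: l_g)

text \<open>\<open>v r\<close> and the multiplier \<open>\<mu> r\<close> both commute with
  \<open>Y\<close>, so only the factor \<open>M r\<close> contributes to the commutator; it supplies
  the missing factor of \<open>v r ^ p\<close>, and \<open>\<mu> r\<close> makes the resulting
  scalar the same on all faces of the level.\<close>

lemma weyl_Y_x_op:
  assumes r: "r > 0"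
  shows "eqm p (Y * x_op r) (x_op r * Y + cst (\<Delta> r) * \<rho> r)"
proof -
  have "p > 0" using p_gt_1 by simp
  have Y\<mu>: "Y * lev r (\<mu> r) = lev r (\<mu> r) * Y"
    using r by (intro Y_comm cst_lev G_lev) (auto simp: \<mu>_def \<delta>_g)
  have Yv: "v r ^ n * Y = Y * v r ^ n" for n
    by (rule comm_power) (rule v_comm_Y[OF r, symmetric])
  have 1: "Y * x_op r = lev r (\<mu> r) * (Y * M r) * v r ^ (p - 1)"
    unfolding x_op_def by (simp only: mult.assoc[symmetric] Y\<mu>)
  have "lev r (\<mu> r) * (M r * Y) * v r ^ (p - 1) = lev r (\<mu> r) * M r * (Y * v r ^ (p - 1))"
    by (simp only: mult.assoc)
  also have "\<dots> = x_op r * Y"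
    unfolding x_op_def Yv[symmetric] by (simp only: mult.assoc)
  finally have 2: "lev r (\<mu> r) * (M r * Y + v r) * v r ^ (p - 1)
      = x_op r * Y + lev r (\<mu> r) * v r ^ Suc (p - 1)"
    by (simp only: distrib_left distrib_right power_Suc mult.assoc)
  have 3: "lev r (\<mu> r) * lev r \<delta> = cst (\<Delta> r) * \<rho> r"
    unfolding lev_lev lev_cst unfolding lev_def
    by (rule arg_cong[of _ _ mulE]) (auto simp: fun_eq_iff \<mu>_\<delta>)
  have "eqm p (Y * x_op r) (lev r (\<mu> r) * (M r * Y + v r) * v r ^ (p - 1))"
    unfolding 1 by (rule eqm_mult_right, rule eqm_mult_left, rule commutator_Y_M, rule r)
  then have "eqm p (Y * x_op r) (x_op r * Y + lev r (\<mu> r) * v r ^ p)"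
    unfolding 2 using \<open>p > 0\<close> by simp
  moreover have "eqm p (x_op r * Y + lev r (\<mu> r) * v r ^ p) (x_op r * Y + lev r (\<mu> r) * lev r \<delta>)"
    by (rule eqm_add, rule eqm_refl, rule eqm_mult_left, rule v_power, rule r)
  ultimately show ?thesis unfolding 3 by (rule eqm_trans)
qed

end

section \<open>Operators compatible with the boundary on one level\<close>

context ranked_complex
begin

text \<open>Operators that commute with the boundary up to chains of lower level.\<close>

definition good :: "nat \<Rightarrow> 'v chain endo set" where
  "good r = {A. A * \<rho> r = \<rho> r * A \<and> (\<forall>c. cst c * A = A * cst c) \<and>
     (\<forall>n. \<forall>f\<in>C r n. app A f \<in> C r n \<and> app (\<rho> r * D * A) f = app (A * \<rho> r * D) f)}"

lemma C_down: "y \<in> {x \<in> K. rank x \<le> r} \<Longrightarrow> x \<subseteq> y \<Longrightarrow> x \<in> {x \<in> K. rank x \<le> r}"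
  using K_down[of y x] rank_mono[of y x] by auto

lemma C_bd: assumes "f \<in> C r (Suc n)" shows "app D f \<in> C r n"
  by (rule chains_bd[OF assms]) (rule C_down)

lemma goodI:
  assumes "A * \<rho> r = \<rho> r * A" "\<And>c. cst c * A = A * cst c"
    "\<And>n f. f \<in> C r n \<Longrightarrow> app A f \<in> C r n"
    "\<And>n f. f \<in> C r n \<Longrightarrow> app (\<rho> r) (app D (app A f)) = app A (app (\<rho> r) (app D f))"
  shows "A \<in> good r"
  using assms unfolding good_def by simp

lemma goodD:
  assumes "A \<in> good r"
  shows "A * \<rho> r = \<rho> r * A" "cst c * A = A * cst c" "f \<in> C r n \<Longrightarrow> app A f \<in> C r n"
    "f \<in> C r n \<Longrightarrow> app (\<rho> r) (app D (app A f)) = app A (app (\<rho> r) (app D f))"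
  using assms unfolding good_def by auto

lemma good_add: assumes "A \<in> good r" "B \<in> good r" shows "A + B \<in> good r"
proof (rule goodI)
  show "(A + B) * \<rho> r = \<rho> r * (A + B)"
    unfolding distrib_left distrib_right goodD(1)[OF assms(1)] goodD(1)[OF assms(2)] ..
  show "cst c * (A + B) = (A + B) * cst c" for c
    unfolding distrib_left distrib_right goodD(2)[OF assms(1)] goodD(2)[OF assms(2)] ..
  fix f n assume f: "f \<in> C r n"
  show "app (A + B) f \<in> C r n"
    unfolding app_endo_add by (intro chains_add goodD(3)[OF assms(1) f] goodD(3)[OF assms(2) f])
  show "app (\<rho> r) (app D (app (A + B) f)) = app (A + B) (app (\<rho> r) (app D f))"
    unfolding app_endo_add app_add goodD(4)[OF assms(1) f] goodD(4)[OF assms(2) f] ..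
qed

lemma good_minus: assumes "A \<in> good r" shows "- A \<in> good r"
proof (rule goodI)
  show "- A * \<rho> r = \<rho> r * - A"
    unfolding mult_minus_left mult_minus_right goodD(1)[OF assms] ..
  show "cst c * - A = - A * cst c" for c
    unfolding mult_minus_left mult_minus_right goodD(2)[OF assms] ..
  fix f n assume f: "f \<in> C r n"
  show "app (- A) f \<in> C r n"
    unfolding app_endo_minus by (intro chains_minus goodD(3)[OF assms f])
  show "app (\<rho> r) (app D (app (- A) f)) = app (- A) (app (\<rho> r) (app D f))"
    unfolding app_endo_minus app_minus goodD(4)[OF assms f] ..
qed

lemma good_mult: assumes A: "A \<in> good r" and B: "B \<in> good r" shows "A * B \<in> good r"
proof (rule goodI)
  show "A * B * \<rho> r = \<rho> r * (A * B)"
    by (rule comm_mult) (rule goodD(1)[OF A], rule goodD(1)[OF B])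
  show "cst c * (A * B) = A * B * cst c" for c
    by (rule comm_mult[symmetric]) (rule goodD(2)[OF A, symmetric], rule goodD(2)[OF B, symmetric])
  show "app (A * B) f \<in> C r n" if "f \<in> C r n" for f n
    using goodD(3)[OF A goodD(3)[OF B that]] by simp
  show "app (\<rho> r) (app D (app (A * B) f)) = app (A * B) (app (\<rho> r) (app D f))" if "f \<in> C r n" for f n
    using goodD(4)[OF A goodD(3)[OF B that]] goodD(4)[OF B that] by simp
qed

lemma good_one: "1 \<in> good r" by (rule goodI) simp_all

lemma good_cst: "cst c \<in> good r"
proof (rule goodI)
  show "cst c * \<rho> r = \<rho> r * cst c" by (rule cst_lev)
  show "cst d * cst c = cst c * cst d" for d by (rule cst_cst)
  show "app (cst c) f \<in> C r n" if "f \<in> C r n" for f n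
    unfolding cst_def app_mulE using that by (rule chains_const_mult)
  show "app (\<rho> r) (app D (app (cst c) f)) = app (cst c) (app (\<rho> r) (app D f))" for f
    using arg_cong[OF comm_mult[OF cst_lev[of c r "\<lambda>_. 1", symmetric] cst_D[of c, symmetric]], of "\<lambda>A. app A f"]
    by simp
qed

lemma good_G: assumes "i < k" shows "G i \<in> good r"
proof (rule goodI)
  have 1: "G i * \<rho> r = \<rho> r * G i" by (rule G_lev[OF assms]) simp
  then show "G i * \<rho> r = \<rho> r * G i" .
  show "cst d * G i = G i * cst d" for d by (rule cst_G)
  show "app (G i) f \<in> C r n" if "f \<in> C r n" for f n
    unfolding G_def using that by (rule chains_pull) (use assms in \<open>auto simp: g_K_iff rank_g\<close>)
  show "app (\<rho> r) (app D (app (G i) f)) = app (G i) (app (\<rho> r) (app D f))" for f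
    using arg_cong[OF comm_mult[OF 1[symmetric] G_D[OF assms, symmetric]], of "\<lambda>A. app A f"]
    by simp
qed

lemma app_lev: "app (lev r \<phi>) f xs = (if set xs \<in> K \<and> rank (set xs) = r then \<phi> (set xs) * f xs else 0)"
  by (simp add: lev_def app_mulE)

text \<open>A face of rank \<open>r\<close> can occur in the boundary of a chain of rank at most
  \<open>r\<close> only through larger faces that have rank \<open>r\<close> as well, and there
  \<open>\<phi>\<close> takes the same value.\<close>

lemma good_lev:
  assumes \<phi>: "\<And>x y. y \<in> K \<Longrightarrow> x \<subseteq> y \<Longrightarrow> rank x = r \<Longrightarrow> rank y = r \<Longrightarrow> \<phi> x = \<phi> y"
  shows "lev r \<phi> \<in> good r"
proof (rule goodI)
  show "lev r \<phi> * \<rho> r = \<rho> r * lev r \<phi>" by (rule lev_comm)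
  show "cst d * lev r \<phi> = lev r \<phi> * cst d" for d by (rule cst_lev)
  show "app (lev r \<phi>) f \<in> C r n" if "f \<in> C r n" for f n
    unfolding lev_def app_mulE using that by (rule chains_set_mult)
  show "app (\<rho> r) (app D (app (lev r \<phi>) f)) = app (lev r \<phi>) (app (\<rho> r) (app D f))"
    if f: "f \<in> C r n" for f n
  proof (rule ext)
    fix ys
    show "app (\<rho> r) (app D (app (lev r \<phi>) f)) ys = app (lev r \<phi>) (app (\<rho> r) (app D f)) ys"
    proof (cases "set ys \<in> K \<and> rank (set ys) = r")
      case True
      have "app (lev r \<phi>) f (a # ys) = \<phi> (set ys) * f (a # ys)" for a
      proof (cases "f (a # ys) = 0")
        case False
        then have 1: "set (a # ys) \<in> K" "rank (set (a # ys)) \<le> r"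
          using chainsD(3)[OF f, of "a # ys"] by blast+
        moreover have "rank (set ys) \<le> rank (set (a # ys))" by (rule rank_mono[OF 1(1)]) auto
        ultimately have 2: "rank (set (a # ys)) = r" using True by simp
        have "\<phi> (set ys) = \<phi> (set (a # ys))" by (rule \<phi>) (use True 1 2 in auto)
        then show ?thesis unfolding app_lev using 1 2 by simp
      qed (simp add: app_lev)
      then show ?thesis using True by (simp add: app_lev app_bd sum_distrib_left)
    qed (auto simp: app_lev)
  qed
qed

lemma good_diff: assumes "A \<in> good r" "B \<in> good r" shows "A - B \<in> good r"
  using good_add[OF assms(1) good_minus[OF assms(2)]] by simp

lemma good_sum: "(\<And>i. i \<in> I \<Longrightarrow> A i \<in> good r) \<Longrightarrow> (\<Sum>i\<in>I. A i) \<in> good r"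
proof (induction I rule: infinite_finite_induct)
  case (insert i I)
  then show ?case using good_add by simp
qed (use good_diff[OF good_one good_one] in simp_all)

lemma good_power: "A \<in> good r \<Longrightarrow> A ^ n \<in> good r"
proof (induction n)
  case (Suc n)
  then show ?case using good_mult[of A r "A ^ n"] by simp
qed (simp add: good_one)

lemma good_Y: "Y \<in> good r"
  unfolding Y_def
proof (rule good_sum, rule good_mult, rule good_cst, rule good_diff)
  show "G i \<in> good r" if "i \<in> {..<k}" for i using that by (intro good_G) simp
qed (rule good_one)

lemma good_x_op:
  assumes r: "r > 0" shows "x_op r \<in> good r"
proof -
  have l: "l i x = l i y" if "i < k" "y \<in> K" "x \<subseteq> y" "rank x = r" "rank y = r" for i x y
    using l_const[OF that(1-3)] that r by simp
  then have d: "\<delta> x = \<delta> y" if "y \<in> K" "x \<subseteq> y" "rank x = r" "rank y = r" for x y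
  proof -
    have "l i x = l i y" if "i < k" for i using \<open>y \<in> K\<close> \<open>x \<subseteq> y\<close> \<open>rank x = r\<close> \<open>rank y = r\<close> by (intro l that)
    then show ?thesis unfolding \<delta>_def by (intro sum.cong refl) simp
  qed
  have 1: "lev r (\<mu> r) \<in> good r"
  proof (rule good_lev)
    fix x y assume "y \<in> K" "x \<subseteq> y" "rank x = r" "rank y = r"
    then have "\<delta> x = \<delta> y" by (intro d)
    then show "\<mu> r x = \<mu> r y" unfolding \<mu>_def by simp
  qed
  have 2: "M r \<in> good r"
    unfolding M_def
  proof (rule good_lev)
    fix x y assume "y \<in> K" "x \<subseteq> y" "rank x = r" "rank y = r"
    then have "F x = F y" using r by (intro F_const) auto
    then show "[:F x:] = [:F y:]" by simp
  qed
  have 3: "v r \<in> good r"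
    unfolding v_def
  proof (intro good_sum good_mult good_G)
    fix i assume "i \<in> {..<k}"
    then have i: "i < k" by simp
    show "lev r (\<lambda>x. monom (l i x) i) \<in> good r"
    proof (rule good_lev)
      fix x y assume "y \<in> K" "x \<subseteq> y" "rank x = r" "rank y = r"
      then have "l i x = l i y" by (intro l i)
      then show "monom (l i x) i = monom (l i y) i" by simp
    qed
  qed auto
  show ?thesis unfolding x_op_def by (intro good_mult good_power 1 2 3)
qed

lemma level_contraction:
  assumes r: "r > 0"
  obtains s t \<kappa> where "s \<in> good r" "t \<in> good r" "\<not> eqm p \<kappa> 0"
    "eqm p (cst \<kappa> * \<rho> r) ((Y * s + t * Y ^ (p - 1)) * \<rho> r)"
    "eqm p (cst \<kappa> * \<rho> r) ((Y ^ (p - 1) * t + s * Y) * \<rho> r)"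
proof -
  have rr: "\<rho> r * \<rho> r = \<rho> r" unfolding lev_lev by simp
  interpret W: weyl_relation p "good r" "\<rho> r" Y "x_op r" "cst (\<Delta> r)"
  proof unfold_locales
    have "eqm p (Y * x_op r * \<rho> r) ((x_op r * Y + cst (\<Delta> r) * \<rho> r) * \<rho> r)"
      by (rule eqm_mult_right) (rule weyl_Y_x_op[OF r])
    then show "eqm p (Y * x_op r * \<rho> r) (x_op r * Y * \<rho> r + cst (\<Delta> r) * \<rho> r)"
      unfolding distrib_right mult.assoc rr .
    show "a * \<rho> r = \<rho> r * a" if "a \<in> good r" for a using goodD(1)[OF that] .
    show "cst (\<Delta> r) * a = a * cst (\<Delta> r)" if "a \<in> good r" for a using goodD(2)[OF that] .
  qed (rule good_add good_mult good_minus good_one good_Y good_cst good_x_op[OF r] rr; assumption)+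
  \<comment> \<open>This is the square of \<open>unit_const (p - 1)\<close> for
    \<open>d = cst (\<Delta> r)\<close>. Neither \<open>(p - 1)!\<close> nor
    \<open>\<Delta> r\<close> is divisible by the prime element \<open>p\<close>, hence
    \<open>\<kappa>\<close> is not either.\<close>
  define \<kappa> where "\<kappa> = (of_nat (fact (p - 1)) * \<Delta> r ^ (p - 1)) * (of_nat (fact (p - 1)) * \<Delta> r ^ (p - 1))"
  have "\<not> p dvd fact (p - 1)" using p p_gt_1 by (simp add: prime_dvd_fact_iff)
  then have "\<not> eqm p (of_nat (fact (p - 1)) :: int poly) 0" using eqm_poly_of_nat[OF p] by blast
  moreover have "\<not> eqm p (\<Delta> r ^ (p - 1)) 0" using eqm_poly_power[OF p] \<Delta>_nonzero[OF r] by blast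
  ultimately have nz: "\<not> eqm p \<kappa> 0" unfolding \<kappa>_def by (simp only: eqm_poly_mult[OF p] simp_thms)
  have cp: "cst c ^ n = cst (c ^ n)" for c n
    unfolding cst_def mulE_power by (rule arg_cong[of _ _ mulE]) (induction n, auto simp: fun_eq_iff)
  have cm: "cst c * cst d = cst (c * d)" for c d
    unfolding cst_def mulE_mult by (rule arg_cong[of _ _ mulE]) (auto simp: fun_eq_iff)
  have cn: "of_nat n = cst (of_nat n)" for n
    unfolding cst_def mulE_of_nat by (rule arg_cong[of _ _ mulE]) (auto simp: fun_eq_iff)
  have uc: "W.unit_const (p - 1) * W.unit_const (p - 1) = cst \<kappa>"
    unfolding W.unit_const_def \<kappa>_def cp cn cm ..
  have "Suc (p - 1) = p" using p_gt_1 by simp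
  then have "eqm p (Y ^ Suc (p - 1) * \<rho> r) (0 * \<rho> r)"
    using eqm_mult_right[OF Y_nilpotent] by metis
  then have "eqm p (Y ^ Suc (p - 1) * \<rho> r) 0" by simp
  from W.periodic_contraction[OF this] obtain s t where "s \<in> good r" "t \<in> good r"
    "W.cg (cst \<kappa>) (Y * s + t * Y ^ (p - 1))" "W.cg (cst \<kappa>) (Y ^ (p - 1) * t + s * Y)"
    unfolding uc by blast
  then show ?thesis using that nz unfolding W.cg_def by blast
qed

end

section \<open>Pushing resolutions down the filtration\<close>

context ranked_complex
begin

lemma good_alpha: "alpha i \<in> good r"
  unfolding alpha_def by (simp add: good_Y good_power)

lemma C_remove_top:
  assumes r: "r > 0" and f: "f \<in> C r n" shows "f - app (\<rho> r) f \<in> C (r - 1) n"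
proof (rule chainsI)
  have "app (\<rho> r) f \<in> C r n"
    unfolding lev_def app_mulE using f by (rule chains_set_mult)
  with f have "f - app (\<rho> r) f \<in> C r n" by (rule chains_diff)
  then show "alternating (f - app (\<rho> r) f)" by (rule chainsD(1))
  fix xs assume nz: "(f - app (\<rho> r) f) xs \<noteq> 0"
  then have "f xs \<noteq> 0" "\<not> (set xs \<in> K \<and> rank (set xs) = r)" by (auto simp: app_lev split: if_splits)
  then show "length xs = n \<and> set xs \<in> {x \<in> K. rank x \<le> r - 1}"
    using chainsD(2,3)[OF f, of xs] r by auto
qed

text \<open>The second argument counts the relations between consecutive chains, so
  \<open>Suc n\<close> chains are involved. With as many relations as levels, the descent ends at
  level 0 with exactly the chain \<open>c 1\<close> left.\<close>

definition resolution :: "nat \<Rightarrow> nat \<Rightarrow> int poly \<Rightarrow> (nat \<Rightarrow> 'v chain) \<Rightarrow> bool" where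
  "resolution r n u c \<longleftrightarrow> (\<forall>i\<in>{1..Suc n}. c i \<in> C r i) \<and> eqm p (app D (c 1)) (empty_chain u) \<and>
     (\<forall>i\<in>{1..n}. eqm p (app D (c (Suc i))) (app (alpha i) (c i)))"

text \<open>A chain homotopy built from the contraction of the \<open>Y\<close>-complex on level \<open>r\<close> moves the
  resolution below level \<open>r\<close>, at the price of its last term.\<close>

lemma resolution_step:
  assumes r: "r > 0" and res: "resolution r (Suc n) u c" and u: "\<not> eqm p u 0"
  shows "\<exists>c' u'. \<not> eqm p u' 0 \<and> resolution (r - 1) n u' c'"
proof -
  obtain s t \<kappa> where s: "s \<in> good r" and t: "t \<in> good r" and \<kappa>: "\<not> eqm p \<kappa> 0"
    and st: "eqm p (cst \<kappa> * \<rho> r) ((Y * s + t * Y ^ (p - 1)) * \<rho> r)"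
      "eqm p (cst \<kappa> * \<rho> r) ((Y ^ (p - 1) * t + s * Y) * \<rho> r)"
    using level_contraction[OF r] by blast
  define \<sigma> where "\<sigma> i = (if odd i then s else t)" for i :: nat
  have \<sigma>: "\<sigma> i \<in> good r" for i using s t by (simp add: \<sigma>_def)
  have key: "eqm p (cst \<kappa> * \<rho> r) ((alpha i * \<sigma> i + \<sigma> (Suc i) * alpha (Suc i)) * \<rho> r)" for i
    using st by (cases "odd i") (simp_all only: \<sigma>_def alpha_def even_Suc if_True if_False not_not simp_thms)
  have c: "c i \<in> C r i" if "i \<in> {1..Suc (Suc n)}" for i
    using res that unfolding resolution_def by blast
  have c1: "eqm p (app D (c 1)) (empty_chain u)" using res unfolding resolution_def by blast
  have cc: "eqm p (app D (c (Suc i))) (app (alpha i) (c i))" if "i \<in> {1..Suc n}" for i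
    using res that unfolding resolution_def by blast
  \<comment> \<open>Since \<open>app D (c (Suc (Suc i)))\<close> is congruent to
    \<open>alpha (Suc i)\<close> applied to \<open>c (Suc i)\<close>, the last two terms amount on
    level \<open>r\<close> to the contraction \<open>key\<close>, which equals
    \<open>\<kappa>\<close>. So \<open>e i\<close>, which has degree \<open>Suc i\<close>, vanishes
    there modulo \<open>p\<close>.\<close>
  define e where "e i = app (cst \<kappa>) (c (Suc i)) - app (alpha i) (app (\<sigma> i) (c (Suc i)))
      - app D (app (\<sigma> (Suc i)) (c (Suc (Suc i))))" for i
  have eC: "e i \<in> C r (Suc i)" if i: "i \<le> n" for i
    unfolding e_def using i
    by (intro chains_diff goodD(3)[OF good_cst] goodD(3)[OF good_alpha] goodD(3)[OF \<sigma>] C_bd c) auto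
  have e0: "eqm p (app (\<rho> r) (e i)) 0" if i: "i \<le> n" for i
  proof -
    have a: "app A (app (\<rho> r) f) = app (\<rho> r) (app A f)" if "A \<in> good r" for A f
      unfolding app_endo_mult[symmetric] goodD(1)[OF that] ..
    have "app (\<rho> r) (app D (app (\<sigma> (Suc i)) (c (Suc (Suc i)))))
        = app (\<sigma> (Suc i)) (app (\<rho> r) (app D (c (Suc (Suc i)))))"
      by (rule goodD(4)[OF \<sigma>, of _ "Suc (Suc i)"]) (rule c, use i in simp)
    also have "eqm p \<dots> (app (\<sigma> (Suc i)) (app (\<rho> r) (app (alpha (Suc i)) (c (Suc i)))))"
      by (intro eqm_app cc) (use i in simp)
    finally have 1: "eqm p (app (\<rho> r) (app D (app (\<sigma> (Suc i)) (c (Suc (Suc i))))))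
        (app (\<sigma> (Suc i)) (app (\<rho> r) (app (alpha (Suc i)) (c (Suc i)))))" .
    have 2: "eqm p (app (cst \<kappa>) (app (\<rho> r) (c (Suc i))))
       (app (alpha i) (app (\<sigma> i) (app (\<rho> r) (c (Suc i)))) +
        app (\<sigma> (Suc i)) (app (alpha (Suc i)) (app (\<rho> r) (c (Suc i)))))"
      using eqm_endo[OF key[of i], of "c (Suc i)"] by simp
    have "eqm p (app (\<rho> r) (e i))
       ((app (alpha i) (app (\<sigma> i) (app (\<rho> r) (c (Suc i)))) +
        app (\<sigma> (Suc i)) (app (alpha (Suc i)) (app (\<rho> r) (c (Suc i)))))
        - app (alpha i) (app (\<sigma> i) (app (\<rho> r) (c (Suc i))))
        - app (\<sigma> (Suc i)) (app (alpha (Suc i)) (app (\<rho> r) (c (Suc i)))))"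
      unfolding e_def app_diff a[OF good_cst, symmetric] a[OF good_alpha, symmetric] a[OF \<sigma>, symmetric]
      by (intro eqm_diff eqm_refl 2 1[folded a[OF good_alpha]])
    then show ?thesis by simp
  qed
  \<comment> \<open>\<open>e\<close> vanishes on the top level only modulo \<open>p\<close>.
    Removing that remainder puts the chain strictly below level \<open>r\<close> without changing
    its class modulo \<open>p\<close>.\<close>
  define c' where "c' i = e (i - 1) - app (\<rho> r) (e (i - 1))" for i
  have c'C: "c' i \<in> C (r - 1) i" if "i \<in> {1..Suc n}" for i
  proof -
    have "i - 1 \<le> n" "Suc (i - 1) = i" using that by auto
    with C_remove_top[OF r eC[of "i - 1"]] show ?thesis unfolding c'_def by simp
  qed
  have c'e: "eqm p (c' (Suc i)) (e i)" if "i \<le> n" for i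
    using eqm_diff[OF eqm_refl[of p "e i"] e0[OF that]] unfolding c'_def by simp
  have De: "app D (e i) = app (cst \<kappa>) (app D (c (Suc i))) - app (alpha i) (app D (app (\<sigma> i) (c (Suc i))))"
    if "i \<le> n" for i
  proof -
    have "app (\<sigma> (Suc i)) (c (Suc (Suc i))) \<in> C r (Suc (Suc i))"
      by (rule goodD(3)[OF \<sigma>], rule c) (use that in simp)
    then have "app D (app D (app (\<sigma> (Suc i)) (c (Suc (Suc i))))) = 0"
      by (intro bd_bd chainsD(1))
    moreover have "app D (app (cst \<kappa>) f) = app (cst \<kappa>) (app D f)" for f
      unfolding app_endo_mult[symmetric] cst_D ..
    ultimately show ?thesis unfolding e_def app_diff alpha_D by simp
  qed
  have "eqm p (app D (c' 1)) (app D (e 0))" using c'e[of 0] by (intro eqm_app) simp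
  \<comment> \<open>At index 0 no earlier chain can compensate the term with \<open>alpha 0\<close>;
    it vanishes because it acts on a boundary of degree 0.\<close>
  also have "app D (e 0) = app (cst \<kappa>) (app D (c 1))"
  proof -
    have "app (\<sigma> 0) (c (Suc 0)) \<in> C r (Suc 0)" by (rule goodD(3)[OF \<sigma>], rule c) simp
    from alpha_degree_0[OF C_bd[OF this]] show ?thesis using De[of 0] by simp
  qed
  also have "eqm p \<dots> (app (cst \<kappa>) (empty_chain u))" by (rule eqm_app) (rule c1)
  also have "app (cst \<kappa>) (empty_chain u) = empty_chain (\<kappa> * u)"
    unfolding cst_def app_mulE empty_chain_def by (auto simp: fun_eq_iff)
  finally have c'1: "eqm p (app D (c' 1)) (empty_chain (\<kappa> * u))" .
  have c'c': "eqm p (app D (c' (Suc i))) (app (alpha i) (c' i))" if i: "i \<in> {1..n}" for i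
  proof -
    obtain j where j: "i = Suc j" using i by (cases i) auto
    have "eqm p (app D (c' (Suc i))) (app D (e i))" using i by (intro eqm_app c'e) simp
    also have "app D (e i) = app (cst \<kappa>) (app D (c (Suc i))) - app (alpha i) (app D (app (\<sigma> i) (c (Suc i))))"
      using i by (intro De) simp
    also have "eqm p \<dots> (app (cst \<kappa>) (app (alpha i) (c i)) - app (alpha i) (app D (app (\<sigma> i) (c (Suc i)))))"
      by (intro eqm_diff eqm_app cc eqm_refl) (use i in simp)
    finally have 1: "eqm p (app D (c' (Suc i)))
       (app (cst \<kappa>) (app (alpha i) (c i)) - app (alpha i) (app D (app (\<sigma> i) (c (Suc i)))))" .
    have "eqm p (app (alpha i) (c' i)) (app (alpha i) (e j))"
      unfolding j using i j by (intro eqm_app c'e) simp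
    also have "app (alpha i) (e j) = app (alpha i) (app (cst \<kappa>) (c i))
        - app (alpha (Suc j)) (app (alpha j) (app (\<sigma> j) (c i))) - app (alpha i) (app D (app (\<sigma> i) (c (Suc i))))"
      unfolding e_def j app_diff ..
    also have "eqm p \<dots> (app (alpha i) (app (cst \<kappa>) (c i)) - 0 - app (alpha i) (app D (app (\<sigma> i) (c (Suc i)))))"
      by (intro eqm_diff eqm_refl alpha_alpha)
    also have "app (alpha i) (app (cst \<kappa>) (c i)) = app (cst \<kappa>) (app (alpha i) (c i))"
      unfolding app_endo_mult[symmetric] goodD(2)[OF good_alpha] ..
    finally have 2: "eqm p (app (alpha i) (c' i))
       (app (cst \<kappa>) (app (alpha i) (c i)) - app (alpha i) (app D (app (\<sigma> i) (c (Suc i)))))"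
      by (simp only: diff_0_right)
    show ?thesis by (rule eqm_trans[OF 1 eqm_sym[OF 2]])
  qed
  have "\<not> eqm p (\<kappa> * u) 0" using \<kappa> u eqm_poly_mult[OF p] by blast
  then show ?thesis unfolding resolution_def using c'C c'1 c'c' by blast
qed

lemma no_resolution:
  assumes "\<not> eqm p u 0" shows "\<not> resolution r r u c"
  using assms
proof (induction r arbitrary: u c)
  case 0
  show ?case
  proof
    assume "resolution 0 0 u c"
    then have c: "c 1 \<in> C 0 1" and e: "eqm p (app D (c 1)) (empty_chain u)"
      unfolding resolution_def by auto
    have "c 1 xs = 0" for xs
    proof (rule ccontr)
      assume "c 1 xs \<noteq> 0"
      then have "length xs = 1" "set xs \<in> K" "rank (set xs) = 0"
        using chainsD(2,3)[OF c, of xs] by auto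
      moreover have "set xs \<noteq> {}" using \<open>length xs = 1\<close> by auto
      ultimately show False using rank_pos[of "set xs"] by simp
    qed
    then have "app D (c 1) [] = 0" by (simp add: app_bd)
    moreover have "eqm p (app D (c 1) []) (empty_chain u ([] :: 'v list))"
      using e unfolding eqm_fun by (rule spec[of _ "[]"])
    ultimately have "eqm p 0 u" by (simp add: empty_chain_def)
    then show False using 0 eqm_sym by blast
  qed
next
  case (Suc r)
  show ?case
  proof
    assume "resolution (Suc r) (Suc r) u c"
    from resolution_step[OF _ this Suc.prems] obtain c' u' where "\<not> eqm p u' 0" "resolution r r u' c'"
      by auto
    then show False using Suc.IH by blast
  qed
qed

end

section \<open>Acyclic complexes\<close>

text \<open>As \<open>n\<close> counts vertices, this is the vanishing of reduced homology with
  coefficients in \<open>Z[t]\<close> in dimensions at most \<open>N - 2\<close>.\<close>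

definition acyclic_below :: "'v set \<Rightarrow> 'v set set \<Rightarrow> nat \<Rightarrow> bool" where
  "acyclic_below X K N \<longleftrightarrow>
     (\<forall>n<N. \<forall>f\<in>chains K n. app (bd X) f = 0 \<longrightarrow> (\<exists>h\<in>chains K (Suc n). app (bd X) h = f))"

text \<open>The join with the vertex \<open>a\<close>: the sum over the positions of
  \<open>a\<close> in the list, with alternating signs, of the value of \<open>f\<close> on the list
  without that occurrence.\<close>

fun cone :: "'v \<Rightarrow> 'v chain \<Rightarrow> 'v chain" where
  "cone a f [] = 0"
| "cone a f (x # xs) = (if x = a then f xs else 0) - cone a (\<lambda>ys. f (x # ys)) xs"

lemma cone_zero: "cone a (\<lambda>_. 0) xs = 0"
  by (induction xs) auto

lemma cone_minus: "cone a (\<lambda>ys. - f ys) xs = - cone a f xs"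
  by (induction xs arbitrary: f) auto

lemma cone_sum: "(\<Sum>b\<in>X. cone a (h b) xs) = cone a (\<lambda>ys. \<Sum>b\<in>X. h b ys) xs"
proof (induction xs arbitrary: h)
  case (Cons x xs)
  have "(\<Sum>b\<in>X. cone a (h b) (x # xs))
      = (\<Sum>b\<in>X. if x = a then h b xs else 0) - (\<Sum>b\<in>X. cone a (\<lambda>ys. h b (x # ys)) xs)"
    by (simp add: sum_subtractf)
  also have "(\<Sum>b\<in>X. if x = a then h b xs else 0) = (if x = a then \<Sum>b\<in>X. h b xs else 0)"
    by simp
  finally show ?case by (simp add: Cons.IH)
qed simp

lemma bd_cone:
  assumes "finite X" "a \<in> X"
  shows "app (bd X) (cone a f) ys = f ys - cone a (app (bd X) f) ys"
proof -
  have "app (bd X) f = (\<lambda>zs. \<Sum>x\<in>X. f (x # zs))" by (rule ext) (rule app_bd)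
  then have "(\<Sum>x\<in>X. cone a (\<lambda>zs. f (x # zs)) ys) = cone a (app (bd X) f) ys"
    by (simp add: cone_sum)
  then show ?thesis using assms by (simp add: app_bd sum_subtractf)
qed

lemma alternating_cone:
  assumes "alternating f" shows "alternating (cone a f)"
proof (rule alternatingI)
  fix us x y vs
  show "cone a f (us @ x # y # vs) = - cone a f (us @ y # x # vs)"
    using assms
  proof (induction us arbitrary: f)
    case Nil
    have "(\<lambda>zs. f (x # y # zs)) = (\<lambda>zs. - f (y # x # zs))"
      by (rule ext) (rule alternating_swap[OF Nil])
    then have "cone a (\<lambda>zs. f (x # y # zs)) vs = - cone a (\<lambda>zs. f (y # x # zs)) vs"
      by (simp only: cone_minus)
    then show ?case by simp
  next
    case (Cons u us)
    have "f (us @ x # y # vs) = - f (us @ y # x # vs)" by (rule alternatingD[OF Cons.prems])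
    then show ?case using Cons.IH[OF alternating_Cons[OF Cons.prems, of u]] by simp
  qed
qed

lemma cone_support:
  "cone a f xs \<noteq> 0 \<Longrightarrow> \<exists>zs. f zs \<noteq> 0 \<and> length xs = Suc (length zs) \<and> set xs = insert a (set zs)"
proof (induction xs arbitrary: f)
  case (Cons x xs)
  then consider "x = a" "f xs \<noteq> 0" | "cone a (\<lambda>ys. f (x # ys)) xs \<noteq> 0"
    by (cases "cone a (\<lambda>ys. f (x # ys)) xs = 0") (auto split: if_splits)
  then show ?case
  proof cases
    case 1
    then show ?thesis by (intro exI[of _ xs]) auto
  next
    case 2
    from Cons.IH[OF this] obtain zs where "f (x # zs) \<noteq> 0" "length xs = Suc (length zs)"
      "set xs = insert a (set zs)" by auto
    then show ?thesis by (intro exI[of _ "x # zs"]) auto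
  qed
qed simp

lemma chains_cone:
  assumes "f \<in> chains L n" "\<And>x. x \<in> L \<Longrightarrow> insert a x \<in> K"
  shows "cone a f \<in> chains K (Suc n)"
proof (rule chainsI)
  show "alternating (cone a f)" by (rule alternating_cone) (rule chainsD(1)[OF assms(1)])
  fix xs assume "cone a f xs \<noteq> 0"
  from cone_support[OF this] obtain zs where "f zs \<noteq> 0" "length xs = Suc (length zs)"
    "set xs = insert a (set zs)" by auto
  then show "length xs = Suc n \<and> set xs \<in> K"
    using chainsD(2,3)[OF assms(1), of zs] assms(2)[of "set zs"] by auto
qed

lemma cone_apex:
  assumes "\<And>ys. f (a # ys) = 0" shows "cone a f (a # ys) = f ys"
  by (simp add: assms cone_zero)

lemma acyclic_below_cone:
  assumes "finite X" "a \<in> X" "\<And>x. x \<in> K \<Longrightarrow> insert a x \<in> K"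
  shows "acyclic_below X K N"
  unfolding acyclic_below_def
proof (intro allI impI ballI)
  fix n f assume f: "f \<in> chains K n" "app (bd X) f = 0"
  have "app (bd X) (cone a f) = f"
    by (rule ext) (simp add: bd_cone[OF assms(1,2)] f(2) zero_fun_def cone_zero)
  moreover have "cone a f \<in> chains K (Suc n)" using f(1) assms(3) by (rule chains_cone)
  ultimately show "\<exists>h\<in>chains K (Suc n). app (bd X) h = f" by blast
qed

text \<open>Mayer-Vietoris for the deletion of \<open>a\<close> and the cone over its link, carried
  out on chains. The part of a cycle at \<open>a\<close> is a cycle of the link in one degree less;
  it is filled there and coned off, after which the rest of the cycle avoids \<open>a\<close> and is
  filled in the deletion.\<close>

lemma acyclic_below_add_vertex:
  assumes fin: "finite X" and a: "a \<in> X" and K: "\<And>x y. y \<in> K \<Longrightarrow> x \<subseteq> y \<Longrightarrow> x \<in> K"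
    and del: "acyclic_below X {x \<in> K. a \<notin> x} N"
    and link: "acyclic_below X {x. a \<notin> x \<and> insert a x \<in> K} (N - 1)"
  shows "acyclic_below X K N"
  unfolding acyclic_below_def
proof (intro allI impI ballI)
  fix n f assume n: "n < N" and f: "f \<in> chains K n" and bdf: "app (bd X) f = 0"
  let ?L = "{x. a \<notin> x \<and> insert a x \<in> K}" and ?D = "{x \<in> K. a \<notin> x}"
  have alt: "alternating f" using f by (rule chainsD)
  define fa where "fa ys = f (a # ys)" for ys
  have "\<exists>g\<in>chains ?L n. app (bd X) g = fa"
  proof (cases n)
    case 0
    then have "fa = 0" using chainsD(2)[OF f] unfolding fa_def by fastforce
    then show ?thesis by (intro bexI[of _ 0]) (simp_all add: chains_zero)
  next
    case (Suc m)
    have "fa \<in> chains ?L m"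
    proof (rule chainsI)
      show "alternating fa" unfolding fa_def by (rule alternating_Cons[OF alt])
      fix xs assume nz: "fa xs \<noteq> 0"
      then have "distinct (a # xs)" using alternating_repeat[OF alt] unfolding fa_def by blast
      then show "length xs = m \<and> set xs \<in> ?L"
        using chainsD(2,3)[OF f, of "a # xs"] nz Suc unfolding fa_def by auto
    qed
    moreover have "app (bd X) fa = 0"
    proof
      fix ys
      have "app (bd X) fa ys = (\<Sum>b\<in>X. - f (b # a # ys))"
        unfolding app_bd fa_def by (intro sum.cong refl alternating_swap[OF alt])
      also have "\<dots> = - app (bd X) f (a # ys)" by (simp add: app_bd sum_negf)
      finally show "app (bd X) fa ys = 0 ys" by (simp add: bdf)
    qed
    moreover have "m < N - 1" using n Suc by simp
    ultimately show ?thesis using link Suc unfolding acyclic_below_def by blast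
  qed
  then obtain g where g: "g \<in> chains ?L n" "app (bd X) g = fa" by blast
  have ga: "g (a # ys) = 0" for ys
    using chainsD(3)[OF g(1), of "a # ys"] by auto
  define c where "c = cone a g"
  have c: "c \<in> chains K (Suc n)" unfolding c_def using g(1) by (rule chains_cone) simp
  have bdc: "app (bd X) c ys = g ys - cone a fa ys" for ys
    unfolding c_def bd_cone[OF fin a] g(2) ..
  \<comment> \<open>On lists with head \<open>a\<close>, the boundary of the cone has the value of
    \<open>- fa\<close> on the tail; adding it cancels precisely the part of \<open>f\<close> that
    contains \<open>a\<close>.\<close>
  define h where "h = f + app (bd X) c"
  have hK: "h \<in> chains K n"
    unfolding h_def by (intro chains_add f chains_bd c) (rule K)
  have fa_a: "fa (a # ys) = 0" for ys
    unfolding fa_def using alternating_repeat[OF alt, of "a # a # ys"] by simp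
  have h_a: "h (a # ys) = 0" for ys
    unfolding h_def using bdc[of "a # ys"] ga[of ys] cone_apex[of fa a ys] fa_a
    by (simp add: fa_def)
  have hD: "h \<in> chains ?D n"
  proof (rule chainsI)
    show alth: "alternating h" using hK by (rule chainsD)
    fix xs assume nz: "h xs \<noteq> 0"
    have "h (us @ a # vs) = 0" for us vs
    proof (induction us arbitrary: vs rule: rev_induct)
      case (snoc u us)
      have "h (us @ u # a # vs) = - h (us @ a # u # vs)" by (rule alternatingD[OF alth])
      then show ?case using snoc[of "u # vs"] by simp
    qed (simp add: h_a)
    then have "a \<notin> set xs" using nz by (metis split_list)
    then show "length xs = n \<and> set xs \<in> ?D" using chainsD(2,3)[OF hK nz] by simp
  qed
  have "app (bd X) h = 0"
    unfolding h_def app_add bdf using bd_bd[OF chainsD(1)[OF c]] by simp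
  with hD n del obtain h' where h': "h' \<in> chains ?D (Suc n)" "app (bd X) h' = h"
    unfolding acyclic_below_def by blast
  have "h' - c \<in> chains K (Suc n)"
    using h'(1) chains_mono[of ?D K] c by (intro chains_diff) auto
  moreover have "app (bd X) (h' - c) = f" unfolding app_diff h' h_def by simp
  ultimately show "\<exists>h\<in>chains K (Suc n). app (bd X) h = f" by blast
qed

section \<open>Colouring complexes under a degree bound\<close>

definition colourings :: "'a set set \<Rightarrow> 'a set \<Rightarrow> ('a \<Rightarrow> 'c set) \<Rightarrow> ('a \<times> 'c) set set" where
  "colourings E V L = {x. x \<subseteq> Sigma V L \<and> (\<forall>u c d. (u, c) \<in> x \<longrightarrow> (u, d) \<in> x \<longrightarrow> c = d) \<and>
     (\<forall>u w c. (u, c) \<in> x \<longrightarrow> (w, c) \<in> x \<longrightarrow> {u, w} \<notin> E)}"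

lemma colourings_down: "y \<in> colourings E V L \<Longrightarrow> x \<subseteq> y \<Longrightarrow> x \<in> colourings E V L"
  unfolding colourings_def by blast

lemma colourings_cong:
  assumes "\<And>w. w \<in> V \<Longrightarrow> L w = L' w" shows "colourings E V L = colourings E V L'"
proof -
  have "Sigma V L = Sigma V L'" using assms by auto
  then show ?thesis unfolding colourings_def by simp
qed

lemma colourings_delete:
  "{x \<in> colourings E V L. (u, c) \<notin> x} = colourings E V (L(u := L u - {c}))"
  unfolding colourings_def by (auto split: if_splits)

lemma colouringsD:
  assumes "x \<in> colourings E V L"
  shows "(u, c) \<in> x \<Longrightarrow> u \<in> V" "(u, c) \<in> x \<Longrightarrow> c \<in> L u"
    "(u, c) \<in> x \<Longrightarrow> (u, d) \<in> x \<Longrightarrow> c = d"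
    "(u, c) \<in> x \<Longrightarrow> (w, c) \<in> x \<Longrightarrow> {u, w} \<notin> E"
  using assms unfolding colourings_def by auto

lemma colouringsI:
  assumes "\<And>u c. (u, c) \<in> x \<Longrightarrow> u \<in> V \<and> c \<in> L u"
    "\<And>u c d. (u, c) \<in> x \<Longrightarrow> (u, d) \<in> x \<Longrightarrow> c = d"
    "\<And>u w c. (u, c) \<in> x \<Longrightarrow> (w, c) \<in> x \<Longrightarrow> {u, w} \<notin> E"
  shows "x \<in> colourings E V L"
proof -
  have "x \<subseteq> Sigma V L" using assms(1) by auto
  moreover have "\<forall>u c d. (u, c) \<in> x \<longrightarrow> (u, d) \<in> x \<longrightarrow> c = d"
    by (intro allI impI) (rule assms(2))
  moreover have "\<forall>u w c. (u, c) \<in> x \<longrightarrow> (w, c) \<in> x \<longrightarrow> {u, w} \<notin> E"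
    by (intro allI impI) (rule assms(3))
  ultimately show ?thesis unfolding colourings_def by simp
qed

text \<open>Assigning \<open>c\<close> to \<open>u\<close> removes \<open>u\<close> and forbids
  \<open>c\<close> at its neighbours. Lists of admissible colours, rather than one common colour
  set, keep both deletions and links within the same family of complexes, as the induction
  requires.\<close>

lemma colourings_link:
  assumes u: "u \<in> V" "c \<in> L u" "{u} \<notin> E"
  shows "{x. (u, c) \<notin> x \<and> insert (u, c) x \<in> colourings E V L}
    = colourings E (V - {u}) (\<lambda>w. if {u, w} \<in> E then L w - {c} else L w)" (is "?l = ?r")
proof (rule set_eqI, rule iffI)
  fix x assume "x \<in> ?l"
  then have uc: "(u, c) \<notin> x" and col: "insert (u, c) x \<in> colourings E V L" by auto
  show "x \<in> ?r"
  proof (rule colouringsI)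
    fix w d assume wd: "(w, d) \<in> x"
    have "w \<noteq> u"
    proof
      assume "w = u"
      then have "d = c" using colouringsD(3)[OF col, of u d c] wd by simp
      then show False using wd uc \<open>w = u\<close> by simp
    qed
    moreover have "d \<noteq> c" if "{u, w} \<in> E"
      using colouringsD(4)[OF col, of u c w] wd that by auto
    moreover have "w \<in> V" "d \<in> L w" using colouringsD(1,2)[OF col, of w d] wd by simp_all
    ultimately show "w \<in> V - {u} \<and> d \<in> (if {u, w} \<in> E then L w - {c} else L w)" by simp
  next
    fix w d e assume "(w, d) \<in> x" "(w, e) \<in> x"
    then show "d = e" using colouringsD(3)[OF col, of w d e] by simp
  next
    fix w z d assume "(w, d) \<in> x" "(z, d) \<in> x"
    then show "{w, z} \<notin> E" using colouringsD(4)[OF col, of w d z] by simp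
  qed
next
  fix x assume r: "x \<in> ?r"
  have sub: "w \<in> V \<and> w \<noteq> u \<and> d \<in> L w \<and> ({u, w} \<in> E \<longrightarrow> d \<noteq> c)" if "(w, d) \<in> x" for w d
    using colouringsD(1,2)[OF r that] by (simp split: if_splits)
  have "insert (u, c) x \<in> colourings E V L"
  proof (rule colouringsI)
    show "w \<in> V \<and> d \<in> L w" if "(w, d) \<in> insert (u, c) x" for w d
      using that sub[of w d] u by blast
    show "d = e" if "(w, d) \<in> insert (u, c) x" "(w, e) \<in> insert (u, c) x" for w d e
      using that sub[of w d] sub[of w e] colouringsD(3)[OF r, of w d e] by blast
    show "{w, z} \<notin> E" if wz: "(w, d) \<in> insert (u, c) x" "(z, d) \<in> insert (u, c) x" for w z d
    proof (cases "(w, d) \<in> x \<and> (z, d) \<in> x")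
      case True
      then show ?thesis using colouringsD(4)[OF r, of w d z] by simp
    next
      case False
      then consider "w = u" "d = c" "z = u" | "w = u" "d = c" "(z, d) \<in> x" | "z = u" "d = c" "(w, d) \<in> x"
        using wz by blast
      then show ?thesis
        using sub[of z d] sub[of w d] u(3) by cases (auto simp: insert_commute)
    qed
  qed
  moreover have "(u, c) \<notin> x" using sub[of u c] by auto
  ultimately show "x \<in> ?l" by simp
qed

lemma acyclic_below_add_colour:
  assumes "finite X" "Sigma V L \<subseteq> X" "u \<in> V" "c \<in> L u" "{u} \<notin> E"
    and "acyclic_below X (colourings E V (L(u := L u - {c}))) N"
    and "acyclic_below X (colourings E (V - {u}) (\<lambda>w. if {u, w} \<in> E then L w - {c} else L w)) (N - 1)"
  shows "acyclic_below X (colourings E V L) N"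
proof (rule acyclic_below_add_vertex[where a = "(u, c)"])
  show "(u, c) \<in> X" using assms(2-4) by blast
  show "x \<in> colourings E V L" if "y \<in> colourings E V L" "x \<subseteq> y" for x y
    using that by (rule colourings_down)
  show "acyclic_below X {x \<in> colourings E V L. (u, c) \<notin> x} N"
    unfolding colourings_delete by (rule assms)
  show "acyclic_below X {x. (u, c) \<notin> x \<and> insert (u, c) x \<in> colourings E V L} (N - 1)"
    unfolding colourings_link[of u V c L E, OF assms(3-5)] by (rule assms)
qed (rule assms)

definition nbrs :: "'a set set \<Rightarrow> 'a set \<Rightarrow> 'a \<Rightarrow> 'a set" where
  "nbrs E V u = {w \<in> V. {u, w} \<in> E}"

definition second_nbrs :: "'a set set \<Rightarrow> 'a set \<Rightarrow> 'a \<Rightarrow> 'a set" where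
  "second_nbrs E V u = {w \<in> V. w \<noteq> u \<and> {u, w} \<notin> E \<and> (\<exists>z\<in>V. {u, z} \<in> E \<and> {z, w} \<in> E)}"

definition enough_colours :: "'a set set \<Rightarrow> 'a set \<Rightarrow> ('a \<Rightarrow> 'c set) \<Rightarrow> bool" where
  "enough_colours E V L \<longleftrightarrow>
     (\<forall>u\<in>V. finite (L u) \<and> 2 * card (nbrs E V u) + card (second_nbrs E V u) < card (L u))"

text \<open>Without \<open>u\<close>, the bound demanded of a neighbour drops by two and that of a
  second neighbour by one, which pays for the colours they may lose. Removing \<open>u\<close>
  creates no second neighbours: adjacency among the other vertices is unchanged and connections
  through \<open>u\<close> only disappear.\<close>

lemma enough_colours_link:
  assumes fin: "finite V" and u: "u \<in> V" and L: "enough_colours E V L"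
    and L': "\<And>w. w \<in> V - {u} \<Longrightarrow> finite (L' w) \<and> card (L w) \<le> card (L' w) +
        (if {u, w} \<in> E then 2 else if w \<in> second_nbrs E V u then 1 else 0)"
  shows "enough_colours E (V - {u}) L'"
  unfolding enough_colours_def
proof (intro ballI conjI)
  fix w assume w: "w \<in> V - {u}"
  show "finite (L' w)" using L'[OF w] by simp
  have n1: "nbrs E (V - {u}) w = nbrs E V w - {u}" unfolding nbrs_def by auto
  have n2: "second_nbrs E (V - {u}) w \<subseteq> second_nbrs E V w - {u}" unfolding second_nbrs_def by auto
  have f1: "finite (nbrs E V w)" and f2: "finite (second_nbrs E V w)"
    using fin unfolding nbrs_def second_nbrs_def by auto
  have c2: "card (second_nbrs E (V - {u}) w) \<le> card (second_nbrs E V w - {u})"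
    using n2 f2 by (intro card_mono) auto
  have big: "2 * card (nbrs E V w) + card (second_nbrs E V w) < card (L w)"
    using L w unfolding enough_colours_def by blast
  show "2 * card (nbrs E (V - {u}) w) + card (second_nbrs E (V - {u}) w) < card (L' w)"
  proof (cases "{u, w} \<in> E")
    case True
    then have "u \<in> nbrs E V w" using u unfolding nbrs_def by (simp add: insert_commute)
    then have "card (nbrs E V w) = Suc (card (nbrs E V w - {u}))"
      using f1 by (metis card.remove)
    moreover have "card (second_nbrs E V w - {u}) \<le> card (second_nbrs E V w)"
      by (rule card_Diff1_le)
    ultimately show ?thesis using big c2 L'[OF w] True unfolding n1 by simp
  next
    case False
    have 1: "card (nbrs E V w - {u}) \<le> card (nbrs E V w)" by (rule card_Diff1_le)
    show ?thesis
    proof (cases "w \<in> second_nbrs E V u")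
      case True
      then have "u \<in> second_nbrs E V w"
        using u False unfolding second_nbrs_def by (auto simp: insert_commute)
      then have "card (second_nbrs E V w) = Suc (card (second_nbrs E V w - {u}))"
        using f2 by (metis card.remove)
      then show ?thesis using big c2 1 L'[OF w] False True unfolding n1 by simp
    next
      case nsec: False
      have "card (second_nbrs E V w - {u}) \<le> card (second_nbrs E V w)" by (rule card_Diff1_le)
      then show ?thesis using big c2 1 L'[OF w] False nsec unfolding n1 by simp
    qed
  qed
qed

text \<open>Fix a vertex \<open>v\<close> with a colour \<open>c0\<close>. If \<open>v\<close> has no other colour and its neighbours avoid
  \<open>c0\<close>, the complex is a cone. Then add the other colours of \<open>v\<close>, and finally \<open>c0\<close> at the neighbours
  of \<open>v\<close>. Every link is a colouring complex with one vertex less in which neighbours of the removed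
  vertex lose at most two colours and second neighbours at most one, so the degree bound persists.\<close>

lemma acyclic_below_colourings:
  assumes "finite X" "\<And>u. {u} \<notin> E"
  shows "finite V \<Longrightarrow> Sigma V L \<subseteq> X \<Longrightarrow> enough_colours E V L \<Longrightarrow> acyclic_below X (colourings E V L) (card V)"
proof (induction "card V" arbitrary: V L rule: less_induct)
  case less
  note fin = less.prems(1) and LX = less.prems(2) and L = less.prems(3)
  show ?case
  proof (cases "V = {}")
    case True
    then show ?thesis by (simp add: acyclic_below_def)
  next
    case False
    then obtain v where v: "v \<in> V" by blast
    have IH: "acyclic_below X (colourings E (V - {u}) L') (card V - 1)"
      if "u \<in> V" "\<And>w. L' w \<subseteq> L w" "enough_colours E (V - {u}) L'" for u L'
    proof -
      have "card (V - {u}) = card V - 1" using that(1) by (simp add: card_Diff_singleton_if)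
      moreover have "card (V - {u}) < card V" using that(1) fin by (intro psubset_card_mono) auto
      moreover have "Sigma (V - {u}) L' \<subseteq> X"
        by (rule order_trans[OF Sigma_mono[OF Diff_subset that(2)] LX])
      ultimately show ?thesis using less.hyps[of "V - {u}" L'] fin that(3) by simp
    qed
    have finL: "finite (L w)" if "w \<in> V" for w using L that unfolding enough_colours_def by blast
    have "card (L v) > 0" using L v unfolding enough_colours_def by force
    then have "L v \<noteq> {}" by auto
    then obtain c0 where c0: "c0 \<in> L v" by blast
    define L0 where "L0 w = (if {v, w} \<in> E then L w - {c0} else L w)" for w
    have L0_sub: "L0 w \<subseteq> L w" for w unfolding L0_def by auto
    have L0_v: "L0 v = L v" using assms(2)[of v] unfolding L0_def by simp
    have stage1: "acyclic_below X (colourings E V (L0(v := S))) (card V)"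
      if "finite S'" "S = insert c0 S'" "S' \<subseteq> L v - {c0}" for S S'
      using that
    proof (induction S' arbitrary: S rule: finite_induct)
      case empty
      show ?case
      proof (rule acyclic_below_cone[OF assms(1), where a = "(v, c0)"])
        show "(v, c0) \<in> X" using LX v c0 by blast
        fix x assume x: "x \<in> colourings E V (L0(v := S))"
        have only: "c = c0" if "(v, c) \<in> x" for c
          using colouringsD(2)[OF x that] empty by simp
        have noc: "{v, w} \<notin> E" if "(w, c0) \<in> x" for w
        proof
          assume e: "{v, w} \<in> E"
          then have "w \<noteq> v" using assms(2)[of v] by auto
          then show False using colouringsD(2)[OF x that] e unfolding L0_def by simp
        qed
        show "insert (v, c0) x \<in> colourings E V (L0(v := S))"
        proof (rule colouringsI)
          fix u c assume "(u, c) \<in> insert (v, c0) x"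
          then show "u \<in> V \<and> c \<in> (L0(v := S)) u"
            using colouringsD(1,2)[OF x, of u c] v empty by auto
        next
          fix u c d assume "(u, c) \<in> insert (v, c0) x" "(u, d) \<in> insert (v, c0) x"
          then show "c = d" using colouringsD(3)[OF x, of u c d] only by auto
        next
          fix u w c assume "(u, c) \<in> insert (v, c0) x" "(w, c) \<in> insert (v, c0) x"
          then show "{u, w} \<notin> E"
            using colouringsD(4)[OF x, of u c w] noc[of u] noc[of w] assms(2)[of v]
            by (auto simp: insert_commute)
        qed
      qed
    next
      case (insert c S')
      have c: "c \<in> L v" "c \<noteq> c0" using insert.prems by auto
      let ?M = "L0(v := S)"
      have del: "?M(v := ?M v - {c}) = L0(v := insert c0 S')"
      proof -
        have "S - {c} = insert c0 S'" using insert.prems insert.hyps c by auto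
        then show ?thesis by simp
      qed
      show ?case
      proof (rule acyclic_below_add_colour[where u = v and c = c])
        show "Sigma V ?M \<subseteq> X"
        proof -
          have "?M w \<subseteq> L w" for w
            using L0_sub[of w] insert.prems c0 by (cases "w = v") auto
          then show ?thesis using LX by (meson Sigma_mono order_trans subset_refl)
        qed
        show "c \<in> ?M v" using insert.prems by simp
        show "acyclic_below X (colourings E V (?M(v := ?M v - {c}))) (card V)"
          unfolding del using insert.prems by (intro insert.IH) auto
        show "acyclic_below X (colourings E (V - {v}) (\<lambda>w. if {v, w} \<in> E then ?M w - {c} else ?M w)) (card V - 1)"
          (is "acyclic_below X (colourings E (V - {v}) ?L') _")
        proof -
          \<comment> \<open>On \<open>V - {v}\<close> the lists differ from \<open>L\<close> only at
            neighbours of \<open>v\<close>, which lack \<open>c0\<close> from the start and lose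
            \<open>c\<close> in the link. These are the two colours that they can afford.\<close>
          let ?L'' = "\<lambda>w. if {v, w} \<in> E then L w - {c0} - {c} else L w"
          have "colourings E (V - {v}) ?L' = colourings E (V - {v}) ?L''"
            by (rule colourings_cong) (auto simp: L0_def)
          moreover have "acyclic_below X (colourings E (V - {v}) ?L'') (card V - 1)"
          proof (rule IH[OF v])
            show "enough_colours E (V - {v}) ?L''"
            proof (rule enough_colours_link[OF fin v L], intro conjI)
              fix w assume w: "w \<in> V - {v}"
              then have fw: "finite (L w)" using finL by simp
              then show "finite (?L'' w)" by simp
              have "card (L w) - 1 \<le> card (L w - {c0})" "card (L w - {c0}) - 1 \<le> card (L w - {c0} - {c})"
                using fw by (simp_all add: card_Diff_singleton_if)
              then show "card (L w) \<le> card (?L'' w) + (if {v, w} \<in> E then 2 else if w \<in> second_nbrs E V v then 1 else 0)"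
                by (cases "{v, w} \<in> E") (auto simp del: card_Diff_insert)
            qed
          qed auto
          ultimately show ?thesis by simp
        qed
      qed (use assms v in auto)
    qed
    \<comment> \<open>\<open>T\<close> consists of the neighbours of \<open>v\<close> to which
      \<open>c0\<close> has already been given back.\<close>
    define LT where "LT T w = (if {v, w} \<in> E \<and> w \<notin> T then L w - {c0} else L w)" for T w
    have LT_sub: "LT T w \<subseteq> L w" for T w unfolding LT_def by auto
    have stage2: "acyclic_below X (colourings E V (LT T)) (card V)" if "finite T" "T \<subseteq> nbrs E V v" for T
      using that
    proof (induction T rule: finite_induct)
      case empty
      have "LT {} = L0(v := insert c0 (L v - {c0}))"
        using c0 L0_v by (auto simp: LT_def L0_def fun_eq_iff)
      have "acyclic_below X (colourings E V (L0(v := insert c0 (L v - {c0})))) (card V)"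
        using finL[OF v] by (intro stage1[OF _ refl subset_refl]) simp
      with \<open>LT {} = _\<close> show ?case by (simp only:)
    next
      case (insert u T)
      have u: "u \<in> V" "{v, u} \<in> E" "{u, v} \<in> E" using insert.prems by (auto simp: nbrs_def insert_commute)
      have "u \<noteq> v" using u assms(2)[of v] by auto
      have IHT: "acyclic_below X (colourings E V (LT T)) (card V)"
        by (rule insert.IH) (use insert.prems in simp)
      show ?case
      proof (cases "c0 \<in> L u")
        case False
        then have "LT (insert u T) w = LT T w" for w by (cases "w = u") (simp_all add: LT_def)
        then have "LT (insert u T) = LT T" by (rule ext)
        then show ?thesis using IHT by simp
      next
        case True
        let ?M = "LT (insert u T)"
        show ?thesis
        proof (rule acyclic_below_add_colour[where u = u and c = c0])
          show "Sigma V ?M \<subseteq> X"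
            by (rule order_trans[OF Sigma_mono[OF subset_refl LT_sub] LX])
          show "c0 \<in> ?M u" using True by (simp add: LT_def)
          have "(?M(u := ?M u - {c0})) w = LT T w" for w
            using u insert.hyps by (cases "w = u") (simp_all add: LT_def)
          then have "?M(u := ?M u - {c0}) = LT T" by (rule ext)
          then show "acyclic_below X (colourings E V (?M(u := ?M u - {c0}))) (card V)"
            using IHT by simp
          show "acyclic_below X (colourings E (V - {u}) (\<lambda>w. if {u, w} \<in> E then ?M w - {c0} else ?M w)) (card V - 1)"
          proof (rule IH[OF u(1)])
            show "(if {u, w} \<in> E then ?M w - {c0} else ?M w) \<subseteq> L w" for w
              using LT_sub[of "insert u T" w] by (cases "{u, w} \<in> E") auto
            show "enough_colours E (V - {u}) (\<lambda>w. if {u, w} \<in> E then ?M w - {c0} else ?M w)"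
            proof (rule enough_colours_link[OF fin u(1) L], intro conjI)
              fix w assume w: "w \<in> V - {u}"
              then have fw: "finite (L w)" using finL by simp
              have M: "?M w = L w \<or> ?M w = L w - {c0}" by (simp add: LT_def)
              then have "finite (?M w)" using fw by (metis finite_Diff)
              then show "finite (if {u, w} \<in> E then ?M w - {c0} else ?M w)" by simp
              have 1: "card (L w) \<le> card (L w - {c0}) + 1"
                using fw by (simp add: card_Diff_singleton_if) arith
              show "card (L w) \<le> card (if {u, w} \<in> E then ?M w - {c0} else ?M w)
                  + (if {u, w} \<in> E then 2 else if w \<in> second_nbrs E V u then 1 else 0)"
              proof (cases "{u, w} \<in> E")
                case True
                have "?M w - {c0} = L w - {c0}" using M by auto
                then show ?thesis using 1 True by simp
              next
                case nadj: False
                show ?thesis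
                proof (cases "?M w = L w")
                  case True
                  then show ?thesis using nadj by simp
                next
                  case False
                  then have vw: "{v, w} \<in> E" unfolding LT_def by presburger
                  \<comment> \<open>\<open>u\<close> and \<open>w\<close> have the common neighbour
                    \<open>v\<close>, so the missing colour \<open>c0\<close> at \<open>w\<close> is
                    charged to \<open>w\<close> being a second neighbour of
                    \<open>u\<close>.\<close>
                  have "w \<in> second_nbrs E V u"
                    unfolding second_nbrs_def using w nadj bexI[of "\<lambda>z. {u, z} \<in> E \<and> {z, w} \<in> E" v V] v u(3) vw
                    by blast
                  moreover have "?M w = L w - {c0}" using M False by blast
                  ultimately show ?thesis using nadj 1 by simp
                qed
              qed
            qed
          qed
        qed (use assms u in simp_all)
      qed
    qed
    have "colourings E V (LT (nbrs E V v)) = colourings E V L"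
      by (rule colourings_cong) (auto simp: LT_def nbrs_def)
    moreover have "finite (nbrs E V v)" using fin unfolding nbrs_def by simp
    ultimately show ?thesis using stage2[of "nbrs E V v"] by simp
  qed
qed

section \<open>Joins of skeleta of simplices\<close>

definition bounded_sets :: "'b set \<Rightarrow> ('b \<Rightarrow> nat) \<Rightarrow> ('b \<Rightarrow> 'c set) \<Rightarrow> ('b \<times> 'c) set set" where
  "bounded_sets B r L = {x. x \<subseteq> Sigma B L \<and> (\<forall>b\<in>B. card {c. (b, c) \<in> x} \<le> r b)}"

lemma bounded_sets_fibre:
  assumes "x \<subseteq> Sigma B L" shows "{c. (b, c) \<in> x} \<subseteq> L b"
  using assms by auto

lemma bounded_sets_down:
  assumes "\<And>b. b \<in> B \<Longrightarrow> finite (L b)" "y \<in> bounded_sets B r L" "x \<subseteq> y"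
  shows "x \<in> bounded_sets B r L"
proof -
  have y: "y \<subseteq> Sigma B L" "\<And>b. b \<in> B \<Longrightarrow> card {c. (b, c) \<in> y} \<le> r b"
    using assms(2) unfolding bounded_sets_def by auto
  have "card {c. (b, c) \<in> x} \<le> r b" if b: "b \<in> B" for b
  proof -
    have "finite {c. (b, c) \<in> y}" using assms(1)[OF b] bounded_sets_fibre[OF y(1)] finite_subset by blast
    then have "card {c. (b, c) \<in> x} \<le> card {c. (b, c) \<in> y}"
      using assms(3) by (intro card_mono) auto
    then show ?thesis using y(2)[OF b] by simp
  qed
  then show ?thesis using y(1) assms(3) unfolding bounded_sets_def by auto
qed

text \<open>Each block \<open>b\<close> contributes the skeleton of faces with at most
  \<open>r b\<close> vertices of the simplex on \<open>L b\<close>. Taking the link of a pair at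
  \<open>b\<close> lowers \<open>r b\<close> by one. Deleting the pair gives a complex of the same
  kind, unless only one colour was to spare: then the skeleton has become the full simplex and the
  join is a cone.\<close>

lemma acyclic_below_bounded_sets:
  assumes X: "finite X" and B: "finite B"
  shows "Sigma B L \<subseteq> X \<Longrightarrow> (\<And>b. b \<in> B \<Longrightarrow> finite (L b) \<and> r b < card (L b)) \<Longrightarrow>
    acyclic_below X (bounded_sets B r L) (\<Sum>b\<in>B. r b)"
proof (induction "\<Sum>b\<in>B. card (L b)" arbitrary: r L rule: less_induct)
  case less
  note LX = less.prems(1) and L = less.prems(2)
  show ?case
  proof (cases "\<forall>b\<in>B. r b = 0")
    case True
    then show ?thesis by (simp add: acyclic_below_def)
  next
    case False
    then obtain b where b: "b \<in> B" "r b > 0" by auto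
    have finLb: "finite (L b)" and rb: "r b < card (L b)" using L[OF b(1)] by auto
    then have "L b \<noteq> {}" by auto
    then obtain c where c: "c \<in> L b" by blast
    define L' where "L' = L(b := L b - {c})"
    have cL': "card (L' b) = card (L b) - 1" using c by (simp add: L'_def)
    have sm: "(\<Sum>a\<in>B. card (L' a)) < (\<Sum>a\<in>B. card (L a))"
    proof (rule sum_strict_mono_ex1[OF B])
      show "\<forall>a\<in>B. card (L' a) \<le> card (L a)"
        using finLb by (auto simp: L'_def intro: card_mono)
      show "\<exists>a\<in>B. card (L' a) < card (L a)" using b cL' rb by (intro bexI[of _ b]) auto
    qed
    have L'X: "Sigma B L' \<subseteq> X" using LX unfolding L'_def by (auto split: if_splits)
    have fibre: "finite {d. (a, d) \<in> x}" if "x \<subseteq> Sigma B L" "a \<in> B" for x a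
      using bounded_sets_fibre[OF that(1), of a] L[OF that(2)] finite_subset by blast
    show ?thesis
    proof (rule acyclic_below_add_vertex[OF X, where a = "(b, c)"])
      show "(b, c) \<in> X" using LX b c by blast
      show "x \<in> bounded_sets B r L" if "y \<in> bounded_sets B r L" "x \<subseteq> y" for x y
        using bounded_sets_down[of B L y r x] L that by blast
      have del: "{x \<in> bounded_sets B r L. (b, c) \<notin> x} = bounded_sets B r L'"
        unfolding bounded_sets_def L'_def by (auto split: if_splits)
      show "acyclic_below X {x \<in> bounded_sets B r L. (b, c) \<notin> x} (\<Sum>b\<in>B. r b)"
        unfolding del
      proof (cases "r b < card (L' b)")
        case True
        then show "acyclic_below X (bounded_sets B r L') (\<Sum>b\<in>B. r b)"
          using L by (intro less.hyps sm L'X) (auto simp: L'_def)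
      next
        case False
        then have full: "card (L' b) \<le> r b" by simp
        have "L' b \<noteq> {}" using cL' rb b(2) by (metis card.empty diff_is_0_eq less_le_not_le Suc_leI One_nat_def le_trans)
        then obtain d where d: "d \<in> L' b" by blast
        show "acyclic_below X (bounded_sets B r L') (\<Sum>b\<in>B. r b)"
        proof (rule acyclic_below_cone[OF X, where a = "(b, d)"])
          show "(b, d) \<in> X" using L'X b d by blast
          fix x assume x: "x \<in> bounded_sets B r L'"
          have sub: "insert (b, d) x \<subseteq> Sigma B L'" using x b d unfolding bounded_sets_def by auto
          have "card {e. (a, e) \<in> insert (b, d) x} \<le> r a" if a: "a \<in> B" for a
          proof (cases "a = b")
            case True
            have "finite (L' b)" using finLb by (simp add: L'_def)
            then have "card {e. (b, e) \<in> insert (b, d) x} \<le> card (L' b)"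
              using bounded_sets_fibre[OF sub, of b] by (intro card_mono)
            then show ?thesis using full True by simp
          next
            case False
            then have "{e. (a, e) \<in> insert (b, d) x} = {e. (a, e) \<in> x}" by auto
            then show ?thesis using x a unfolding bounded_sets_def by auto
          qed
          then show "insert (b, d) x \<in> bounded_sets B r L'" using sub unfolding bounded_sets_def by auto
        qed
      qed
      have link: "{x. (b, c) \<notin> x \<and> insert (b, c) x \<in> bounded_sets B r L} = bounded_sets B (r(b := r b - 1)) L'"
      proof (rule set_eqI)
        fix x
        show "x \<in> {x. (b, c) \<notin> x \<and> insert (b, c) x \<in> bounded_sets B r L} \<longleftrightarrow> x \<in> bounded_sets B (r(b := r b - 1)) L'"
        proof (cases "(b, c) \<notin> x \<and> x \<subseteq> Sigma B L")
          case False
          then show ?thesis unfolding bounded_sets_def L'_def by (auto split: if_splits)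
        next
          case True
          then have s: "insert (b, c) x \<subseteq> Sigma B L" "x \<subseteq> Sigma B L'" using b c
            unfolding L'_def by (auto split: if_splits)
          have "{e. (b, e) \<in> insert (b, c) x} = insert c {e. (b, e) \<in> x}" by auto
          then have 1: "card {e. (b, e) \<in> insert (b, c) x} = Suc (card {e. (b, e) \<in> x})"
            using True fibre[of x b] b by simp
          have 2: "{e. (a, e) \<in> insert (b, c) x} = {e. (a, e) \<in> x}" if "a \<noteq> b" for a
            using that by auto
          have "(\<forall>a\<in>B. card {e. (a, e) \<in> insert (b, c) x} \<le> r a)
              \<longleftrightarrow> (\<forall>a\<in>B. card {e. (a, e) \<in> x} \<le> (r(b := r b - 1)) a)"
          proof (rule ball_cong[OF refl])
            fix a
            show "card {e. (a, e) \<in> insert (b, c) x} \<le> r a \<longleftrightarrow> card {e. (a, e) \<in> x} \<le> (r(b := r b - 1)) a"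
              using 1 2[of a] b(2) by (cases "a = b") auto
          qed
          then show ?thesis using s True unfolding bounded_sets_def by auto
        qed
      qed
      have sum: "(\<Sum>a\<in>B. (r(b := r b - 1)) a) = (\<Sum>a\<in>B. r a) - 1"
        using b B by (simp add: sum.remove[of B b])
      show "acyclic_below X {x. (b, c) \<notin> x \<and> insert (b, c) x \<in> bounded_sets B r L} ((\<Sum>b\<in>B. r b) - 1)"
        unfolding link sum[symmetric]
      proof (rule less.hyps[OF sm L'X])
        fix a assume a: "a \<in> B"
        show "finite (L' a) \<and> (r(b := r b - 1)) a < card (L' a)"
          using L[OF a] rb b(2) cL' by (cases "a = b") (auto simp: L'_def)
      qed
    qed
  qed
qed

section \<open>Equivariant resolutions\<close>

text \<open>A cycle modulo \<open>p\<close> is corrected to a cycle. Its boundary is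
  \<open>p\<close> times some \<open>e\<close>, which is again a cycle as there is no torsion; if
  \<open>e'\<close> fills \<open>e\<close>, then \<open>f - p e'\<close> has boundary 0 and can be
  filled.\<close>

lemma acyclic_below_mod:
  assumes K: "\<And>x y. y \<in> K \<Longrightarrow> x \<subseteq> y \<Longrightarrow> x \<in> K" and ac: "acyclic_below X K N" and n: "n < N"
    and f: "f \<in> chains K n" and bf: "eqm p (app (bd X) f) 0" and p: "p > 0"
  shows "\<exists>h\<in>chains K (Suc n). eqm p (app (bd X) h) f"
proof (cases n)
  case 0
  then have "app (bd X) f = 0" using chains_bd_0 f by blast
  then obtain h where "h \<in> chains K (Suc n)" "app (bd X) h = f"
    using ac n f unfolding acyclic_below_def by blast
  then show ?thesis by (intro bexI[of _ h]) simp_all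
next
  case (Suc m)
  obtain e where "app (bd X) f = 0 + of_nat p * e" using bf by (rule eqmE)
  then have e: "app (bd X) f = of_nat p * e" by (simp only: add_0)
  have bff: "app (bd X) f \<in> chains K m" using chains_bd[of f K m X] f K Suc by blast
  have ep: "app (bd X) f xs = of_nat p * e xs" for xs using e by (simp add: fun_eq_iff)
  have "e \<in> chains K m"
  proof (rule chainsI)
    show "alternating e"
    proof (rule alternatingI)
      fix us a b vs
      have "of_nat p * e (us @ a # b # vs) = - (of_nat p * e (us @ b # a # vs))"
        unfolding ep[symmetric] by (rule alternatingD[OF chainsD(1)[OF bff]])
      then have "of_nat p * (e (us @ a # b # vs) + e (us @ b # a # vs)) = 0"
        by (simp add: distrib_left)
      then have "e (us @ a # b # vs) + e (us @ b # a # vs) = 0" using p by simp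
      then show "e (us @ a # b # vs) = - e (us @ b # a # vs)" by (simp add: eq_neg_iff_add_eq_0)
    qed
    fix xs assume "e xs \<noteq> 0"
    then have "app (bd X) f xs \<noteq> 0" unfolding ep using p by simp
    then show "length xs = m \<and> set xs \<in> K" using chainsD(2,3)[OF bff, of xs] by blast
  qed
  moreover have "app (bd X) e = 0"
  proof
    fix ys
    have "of_nat p * app (bd X) e = 0"
      unfolding app_nat_mult[symmetric] e[symmetric] by (rule bd_bd) (rule chainsD(1)[OF f])
    from fun_cong[OF this, of ys] show "app (bd X) e ys = 0 ys" using p by auto
  qed
  ultimately obtain e' where e': "e' \<in> chains K (Suc m)" "app (bd X) e' = e"
    using ac n Suc unfolding acyclic_below_def by (metis Suc_lessD)
  have pe: "of_nat p * e' \<in> chains K n"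
    using chains_const_mult[OF e'(1), of "of_nat p"] Suc by (simp add: of_nat_fun)
  have "app (bd X) (f - of_nat p * e') = 0"
    unfolding app_diff app_nat_mult e'(2) e by simp
  then obtain h where h: "h \<in> chains K (Suc n)" "app (bd X) h = f - of_nat p * e'"
    using ac n chains_diff[OF f pe] unfolding acyclic_below_def by blast
  have "app (bd X) h = f + of_nat p * (- e')"
    unfolding h(2) by simp
  then show ?thesis using h(1) by (intro bexI[of _ h] eqmI[of _ _ _ "- e'"])
qed

context prime_action
begin

lemma chains_alpha:
  assumes inv: "\<And>i x. i < k \<Longrightarrow> g i ` x \<in> K \<Longrightarrow> x \<in> K" and f: "f \<in> chains K n"
  shows "app (alpha i) f \<in> chains K n"
proof -
  have Y: "app Y f \<in> chains K n" if f: "f \<in> chains K n" for f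
  proof -
    have t: "app (cst (monom 1 i) * (G i - 1)) f \<in> chains K n" if "i < k" for i
      unfolding app_endo_mult app_endo_diff app_endo_one cst_def app_mulE G_def
      by (intro chains_const_mult chains_diff chains_pull f) (rule inv[OF that])
    have "(\<Sum>i\<in>I. app (cst (monom 1 i) * (G i - 1)) f) \<in> chains K n" if "I \<subseteq> {..<k}" for I
      using finite_subset[OF that finite_lessThan] that
    proof (induction I rule: finite_induct)
      case (insert i I)
      have "app (cst (monom 1 i) * (G i - 1)) f + (\<Sum>i\<in>I. app (cst (monom 1 i) * (G i - 1)) f) \<in> chains K n"
        using insert.prems by (intro chains_add insert.IH t) simp_all
      then show ?case unfolding sum.insert[OF insert.hyps(1,2)] .
    qed (simp only: sum.empty chains_zero)
    from this[of "{..<k}"] show ?thesis unfolding Y_def app_endo_sum by (simp only: subset_refl)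
  qed
  have "app (Y ^ m) f \<in> chains K n" for m
  proof (induction m)
    case (Suc m)
    show ?case unfolding power_Suc app_endo_mult by (rule Y) (rule Suc)
  qed (simp add: f)
  then show ?thesis using Y[OF f] unfolding alpha_def by simp
qed

text \<open>The relations of \<open>resolution\<close> without the filtration. Here \<open>n\<close>
  counts the chains themselves, so that the inductive construction can start from none.\<close>

definition resolves :: "'v set set \<Rightarrow> nat \<Rightarrow> int poly \<Rightarrow> (nat \<Rightarrow> 'v chain) \<Rightarrow> bool" where
  "resolves K n u c \<longleftrightarrow> (\<forall>i\<in>{1..n}. c i \<in> chains K i) \<and>
     (n \<ge> 1 \<longrightarrow> eqm p (app D (c 1)) (empty_chain u)) \<and>
     (\<forall>i\<in>{1..<n}. eqm p (app D (c (Suc i))) (app (alpha i) (c i)))"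

text \<open>The image of the last chain under its differential is a cycle modulo \<open>p\<close>,
  because two successive differentials compose to 0 modulo \<open>p\<close>; acyclicity fills it and
  yields the next chain. For the first chain the boundary lies in degree 0, where the differential
  vanishes.\<close>

lemma resolves_exists:
  assumes K: "\<And>x y. y \<in> K \<Longrightarrow> x \<subseteq> y \<Longrightarrow> x \<in> K" and e: "{} \<in> K"
    and inv: "\<And>i x. i < k \<Longrightarrow> g i ` x \<in> K \<Longrightarrow> x \<in> K" and ac: "acyclic_below X K N"
  shows "n \<le> N \<Longrightarrow> \<exists>c. resolves K n 1 c"
proof (induction n)
  case 0
  show ?case by (auto simp: resolves_def)
next
  case (Suc n)
  have p0: "p > 0" using p_gt_1 by simp
  obtain c where r: "resolves K n 1 c" using Suc by auto
  have c: "\<And>i. i \<in> {1..n} \<Longrightarrow> c i \<in> chains K i" "n \<ge> 1 \<Longrightarrow> eqm p (app D (c 1)) (empty_chain 1)"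
    "\<And>i. i \<in> {1..<n} \<Longrightarrow> eqm p (app D (c (Suc i))) (app (alpha i) (c i))"
    using r unfolding resolves_def by blast+
  define f where "f = (if n = 0 then empty_chain 1 else app (alpha n) (c n))"
  have f: "f \<in> chains K n"
  proof (cases "n = 0")
    case True
    have "empty_chain 1 \<in> chains K 0"
    proof (rule chainsI)
      show "alternating (empty_chain 1 :: 'v chain)" by (rule alternatingI) (simp add: empty_chain_def)
    qed (use e in \<open>auto simp: empty_chain_def split: if_splits\<close>)
    then show ?thesis using True unfolding f_def by simp
  next
    case False
    then show ?thesis unfolding f_def using c(1)[of n] by (simp add: chains_alpha[OF inv])
  qed
  have bf: "eqm p (app D f) 0"
  proof (cases "n \<le> 1")
    case True
    show ?thesis
    proof (cases "n = 0")
      case True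
      then show ?thesis using chains_bd_0[of f K] f by simp
    next
      case False
      with True have n: "n = 1" by simp
      have "app D (c 1) \<in> chains K 0" using c(1)[of 1] n K by (intro chains_bd) auto
      then have "app (alpha 1) (app D (c 1)) = 0" by (rule alpha_degree_0)
      moreover have "f = app (alpha 1) (c 1)" using n by (simp add: f_def)
      ultimately have "app D f = 0" by (simp only: alpha_D)
      then show ?thesis by simp
    qed
  next
    case False
    then obtain m where m: "n = Suc m" "m \<ge> 1" by (cases n) auto
    have "eqm p (app (alpha n) (app D (c n))) (app (alpha n) (app (alpha m) (c m)))"
      unfolding m(1) by (intro eqm_app c(3)) (use m in simp)
    moreover have "eqm p (app (alpha n) (app (alpha m) (c m))) 0"
      unfolding m(1) by (rule alpha_alpha)
    ultimately have "eqm p (app (alpha n) (app D (c n))) 0" by (rule eqm_trans)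
    moreover have "f = app (alpha n) (c n)" using False by (simp add: f_def)
    ultimately show ?thesis by (simp only: alpha_D)
  qed
  have "n < N" using Suc.prems by simp
  from acyclic_below_mod[of K, OF _ ac this f bf p0] K
  obtain h where h: "h \<in> chains K (Suc n)" "eqm p (app D h) f" by blast
  have "resolves K (Suc n) 1 (c(Suc n := h))"
    unfolding resolves_def
  proof (intro conjI ballI impI)
    fix i assume "i \<in> {1..Suc n}"
    then show "(c(Suc n := h)) i \<in> chains K i" using c(1)[of i] h(1) by (cases "i = Suc n") auto
  next
    show "eqm p (app D ((c(Suc n := h)) 1)) (empty_chain 1)"
      using c(2) h(2) unfolding f_def by (cases "n = 0") auto
  next
    fix i assume i: "i \<in> {1..<Suc n}"
    then show "eqm p (app D ((c(Suc n := h)) (Suc i))) (app (alpha i) ((c(Suc n := h)) i))"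
      using c(3)[of i] h(2) unfolding f_def by (cases "i = n") auto
  qed
  then show ?case by blast
qed

end

text \<open>\<open>T\<close> is an equivariant chain map that is linear over scalars, and
  \<open>u\<close> is its degree on the empty simplex, which becomes the constant of the new
  resolution.\<close>

lemma resolves_transfer:
  fixes T :: "'w chain \<Rightarrow> 'v chain"
  assumes A: "prime_action p k X0 g0" and A': "prime_action p k X g"
    and add: "\<And>f h. T (f + h) = T f + T h"
    and cst: "\<And>c f. T ((\<lambda>_. c) * f) = (\<lambda>_. c) * T f"
    and ch: "\<And>n f. f \<in> chains K0 n \<Longrightarrow> T f \<in> chains K n"
    and bd: "\<And>n f. f \<in> chains K0 n \<Longrightarrow> T (app (bd X0) f) = app (bd X) (T f)"
    and pull: "\<And>i f. i < k \<Longrightarrow> T (app (pull (g0 i)) f) = app (pull (g i)) (T f)"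
    and emp: "T (empty_chain 1) = empty_chain u"
    and res: "prime_action.resolves p k X0 g0 K0 n 1 c"
  shows "prime_action.resolves p k X g K n u (\<lambda>i. T (c i))"
proof -
  interpret A: prime_action p k X0 g0 by (rule A)
  interpret B: prime_action p k X g by (rule A')
  have T0: "T 0 = 0" using cst[of 0 0] by (simp add: fun_eq_iff)
  have minus: "T (- f) = - T f" for f
  proof -
    have "- f = (\<lambda>_. - 1) * f" "- T f = (\<lambda>_. - 1) * T f" by (simp_all add: fun_eq_iff)
    then show ?thesis using cst[of "- 1" f] by simp
  qed
  have diff: "T (f - h) = T f - T h" for f h
    using add[of f "- h"] minus[of h] by simp
  have sum: "T (\<Sum>i\<in>I. f i) = (\<Sum>i\<in>I. T (f i))" if "finite I" for f :: "nat \<Rightarrow> 'w chain" and I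
    using that
  proof (induction I rule: finite_induct)
    case (insert i I)
    show ?case unfolding sum.insert[OF insert(1,2)] add insert(3) ..
  qed (simp only: sum.empty T0)
  have TY: "T (app A.Y f) = app B.Y (T f)" for f
    unfolding A.Y_def B.Y_def app_endo_sum sum[OF finite_lessThan]
    by (intro sum.cong refl)
      (simp only: app_endo_mult app_endo_diff app_endo_one A.cst_def B.cst_def app_mulE A.G_def B.G_def
        cst diff pull lessThan_iff)
  have TYm: "T (app (A.Y ^ m) f) = app (B.Y ^ m) (T f)" for m f
    by (induction m) (simp_all add: TY)
  have Ta: "T (app (A.alpha i) f) = app (B.alpha i) (T f)" for i f
    unfolding A.alpha_def B.alpha_def using TY TYm by simp
  have Te: "eqm p (T f) (T h)" if t: "eqm p f h" for f h
  proof -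
    obtain e where "f = h + of_nat p * e" using t by (rule eqmE)
    then have "T f = T h + (\<lambda>_. of_nat p) * T e" by (simp add: add cst of_nat_fun)
    then show ?thesis by (intro eqmI[of _ _ _ "T e"]) (simp add: of_nat_fun)
  qed
  have c: "c i \<in> chains K0 i" if "i \<in> {1..n}" for i
    using res that unfolding A.resolves_def by blast
  show ?thesis
    unfolding B.resolves_def
  proof (intro conjI ballI impI)
    show "T (c i) \<in> chains K i" if "i \<in> {1..n}" for i by (rule ch) (rule c[OF that])
    assume "1 \<le> n"
    then have "eqm p (app A.D (c 1)) (empty_chain 1)" using res unfolding A.resolves_def by blast
    from Te[OF this] show "eqm p (app B.D (T (c 1))) (empty_chain u)"
      using bd[OF c[of 1]] \<open>1 \<le> n\<close> emp by simp
  next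
    fix i assume i: "i \<in> {1..<n}"
    then have "eqm p (app A.D (c (Suc i))) (app (A.alpha i) (c i))" using res unfolding A.resolves_def by blast
    from Te[OF this] show "eqm p (app B.D (T (c (Suc i)))) (app (B.alpha i) (T (c i)))"
      using bd[OF c[of "Suc i"]] i Ta by simp
  qed
qed

section \<open>Colourings of disjoint cliques\<close>

text \<open>The transfer from bounded sets of pairs (block, colour) to proper colourings of disjoint
  cliques sums over all ways to distribute the colours of a block to its vertices. A block of size
  \<open>r\<close> carrying \<open>s\<close> colours leaves \<open>r - s\<close> choices for the next vertex, which the weight
  \<open>(r - s)!\<close> normalises.\<close>

locale clique_blocks =
  fixes V :: "'a set" and B :: "'a set set" and blk :: "'a \<Rightarrow> 'a set" and E :: "'a set set" and Col :: "'c set"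
  assumes finV: "finite V" and finCol: "finite Col"
    and blk: "v \<in> V \<Longrightarrow> blk v \<in> B" "v \<in> V \<Longrightarrow> v \<in> blk v"
    and blk_unique: "b \<in> B \<Longrightarrow> v \<in> b \<Longrightarrow> v \<in> V \<and> blk v = b"
    and E: "E = (\<Union>b\<in>B. {e. e \<subseteq> b \<and> card e = 2})"
begin

definition \<pi> :: "'a \<times> 'c \<Rightarrow> 'a set \<times> 'c" where "\<pi> x = (blk (fst x), snd x)"
definition K :: "('a \<times> 'c) set set" where "K = colourings E V (\<lambda>_. Col)"
definition K0 :: "('a set \<times> 'c) set set" where "K0 = bounded_sets B card (\<lambda>_. Col)"
definition used :: "('a \<times> 'c) set \<Rightarrow> 'a set \<Rightarrow> nat" where "used x b = card {c. (b, c) \<in> \<pi> ` x}"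
definition weight :: "('a \<times> 'c) set \<Rightarrow> int poly" where
  "weight x = of_nat (\<Prod>b\<in>B. fact (card b - used x b))"
definition T :: "('a set \<times> 'c) chain \<Rightarrow> ('a \<times> 'c) chain" where
  "T f xs = (if set xs \<in> K then weight (set xs) * f (map \<pi> xs) else 0)"

lemma edge_iff: "u \<noteq> w \<Longrightarrow> {u, w} \<in> E \<longleftrightarrow> u \<in> V \<and> w \<in> V \<and> blk u = blk w"
proof
  assume "u \<noteq> w" "{u, w} \<in> E"
  then obtain b where "b \<in> B" "u \<in> b" "w \<in> b" unfolding E by auto
  then show "u \<in> V \<and> w \<in> V \<and> blk u = blk w" using blk_unique[of b u] blk_unique[of b w] by simp
next
  assume *: "u \<noteq> w" "u \<in> V \<and> w \<in> V \<and> blk u = blk w"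
  then have "{u, w} \<subseteq> blk u" "blk u \<in> B" using blk[of u] blk(2)[of w] by auto
  moreover have "card {u, w} = 2" using *(1) by simp
  ultimately show "{u, w} \<in> E" unfolding E by blast
qed

lemma no_loops: "{u} \<notin> E"
  unfolding E by simp

lemma finB: "finite B" and fin_block: "b \<in> B \<Longrightarrow> finite b"
proof -
  have "B \<subseteq> Pow V" using blk_unique by blast
  then show "finite B" using finV finite_subset by blast
  show "finite b" if "b \<in> B" for b
    using blk_unique[OF that] finV by (meson finite_subset subsetI)
qed

lemma disj:
  assumes "b \<in> B" "b' \<in> B" "b \<noteq> b'" shows "b \<inter> b' = {}"
  using blk_unique[OF assms(1)] blk_unique[OF assms(2)] assms(3) by blast

lemma K_iff: "x \<in> K \<longleftrightarrow> x \<subseteq> V \<times> Col \<and> (\<forall>u c d. (u, c) \<in> x \<longrightarrow> (u, d) \<in> x \<longrightarrow> c = d) \<and>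
   (\<forall>u w c. (u, c) \<in> x \<longrightarrow> (w, c) \<in> x \<longrightarrow> blk u = blk w \<longrightarrow> u = w)"
  (is "_ \<longleftrightarrow> ?A \<and> ?B \<and> ?C")
proof
  assume x: "x \<in> K"
  note d = colouringsD[OF x[unfolded K_def]]
  have ?A using d(1,2) by auto
  moreover have ?B using d(3) by blast
  moreover have ?C
  proof (intro allI impI)
    fix u w c assume "(u, c) \<in> x" "(w, c) \<in> x" "blk u = blk w"
    then show "u = w" using d(1)[of u c] d(1)[of w c] d(4)[of u c w] edge_iff[of u w] by blast
  qed
  ultimately show "?A \<and> ?B \<and> ?C" by blast
next
  assume *: "?A \<and> ?B \<and> ?C"
  show "x \<in> K"
    unfolding K_def
  proof (rule colouringsI)
    show "u \<in> V \<and> c \<in> Col" if "(u, c) \<in> x" for u c using * that by auto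
    show "c = d" if "(u, c) \<in> x" "(u, d) \<in> x" for u c d using * that by blast
    show "{u, w} \<notin> E" if "(u, c) \<in> x" "(w, c) \<in> x" for u w c
    proof (cases "u = w")
      case True
      then show ?thesis using no_loops by simp
    next
      case False
      then have "blk u \<noteq> blk w" using * that by blast
      then show ?thesis using edge_iff[OF False] by blast
    qed
  qed
qed

lemma K_down: "y \<in> K \<Longrightarrow> x \<subseteq> y \<Longrightarrow> x \<in> K"
  unfolding K_def by (rule colourings_down)

text \<open>A block is a clique, so in a proper colouring its coloured vertices and their colours
  correspond one to one.\<close>

lemma used_eq_coloured:
  assumes "x \<in> K" "b \<in> B" shows "used x b = card {v \<in> b. v \<in> fst ` x}"
proof -
  have x: "x \<subseteq> V \<times> Col" "\<And>u c d. (u, c) \<in> x \<Longrightarrow> (u, d) \<in> x \<Longrightarrow> c = d"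
   "\<And>u w c. (u, c) \<in> x \<Longrightarrow> (w, c) \<in> x \<Longrightarrow> blk u = blk w \<Longrightarrow> u = w"
    using assms(1) unfolding K_iff by blast+
  let ?y = "{z \<in> x. blk (fst z) = b}"
  have 1: "{c. (b, c) \<in> \<pi> ` x} = snd ` ?y" unfolding \<pi>_def by (auto simp: image_iff)
  have 2: "{v \<in> b. v \<in> fst ` x} = fst ` ?y"
  proof (rule set_eqI)
    fix v
    have "v \<in> fst ` x \<longleftrightarrow> (\<exists>d. (v, d) \<in> x)" "v \<in> fst ` ?y \<longleftrightarrow> blk v = b \<and> (\<exists>d. (v, d) \<in> x)"
      by force+
    then show "v \<in> {v \<in> b. v \<in> fst ` x} \<longleftrightarrow> v \<in> fst ` ?y"
      using blk_unique[OF assms(2), of v] blk(2)[of v] x(1) by auto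
  qed
  have "inj_on snd ?y" using x(3) by (auto simp: inj_on_def)
  moreover have "inj_on fst ?y" using x(2) by (auto simp: inj_on_def)
  ultimately show ?thesis unfolding used_def 1 2 by (simp add: card_image)
qed

lemma T_chain:
  assumes f: "f \<in> chains K0 n" shows "T f \<in> chains K n"
proof (rule chainsI)
  show "alternating (T f)"
  proof (rule alternatingI)
    fix us a b vs
    show "T f (us @ a # b # vs) = - T f (us @ b # a # vs)"
      using alternatingD[OF chainsD(1)[OF f], of "map \<pi> us" "\<pi> a" "\<pi> b" "map \<pi> vs"]
      by (simp add: T_def insert_commute)
  qed
  fix xs assume "T f xs \<noteq> 0"
  then have "set xs \<in> K" "f (map \<pi> xs) \<noteq> 0" by (auto simp: T_def split: if_splits)
  then show "length xs = n \<and> set xs \<in> K" using chainsD(2)[OF f, of "map \<pi> xs"] by simp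
qed

lemma T_bd:
  assumes f: "f \<in> chains K0 n"
  shows "T (app (bd (B \<times> Col)) f) = app (bd (V \<times> Col)) (T f)"
proof (rule ext)
  fix ys
  show "T (app (bd (B \<times> Col)) f) ys = app (bd (V \<times> Col)) (T f) ys"
  proof (cases "set ys \<in> K")
    case False
    then have "set (a # ys) \<notin> K" for a using K_down[of "set (a # ys)" "set ys"] by auto
    then have "app (bd (V \<times> Col)) (T f) ys = 0" unfolding app_bd T_def by (intro sum.neutral) simp
    then show ?thesis using False by (simp add: T_def)
  next
    case ysK: True
    let ?y = "set ys" and ?m = "map \<pi> ys"
    have y: "?y \<subseteq> V \<times> Col" "\<And>u c d. (u, c) \<in> ?y \<Longrightarrow> (u, d) \<in> ?y \<Longrightarrow> c = d"
      "\<And>u w c. (u, c) \<in> ?y \<Longrightarrow> (w, c) \<in> ?y \<Longrightarrow> blk u = blk w \<Longrightarrow> u = w"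
      using ysK unfolding K_iff by blast+
    have key: "(\<Sum>v\<in>b. T f ((v, c) # ys)) = weight ?y * f ((b, c) # ?m)" if b: "b \<in> B" and c: "c \<in> Col" for b c
    proof (cases "f ((b, c) # ?m) = 0")
      case True
      have "T f ((v, c) # ys) = 0" if "v \<in> b" for v
        using blk_unique[OF b that] True by (simp add: T_def \<pi>_def)
      then show ?thesis using True by simp
    next
      case False
      \<comment> \<open>An alternating chain vanishes on lists with repetitions, so a nonzero
        coefficient shows that the block does not carry \<open>c\<close> yet.\<close>
      have new: "(b, c) \<notin> \<pi> ` ?y"
        using False alternating_repeat[OF chainsD(1)[OF f], of "(b, c) # ?m"] by auto
      have K0: "insert (b, c) (\<pi> ` ?y) \<in> K0" using chainsD(3)[OF f False] by simp
      have "{d. (b, d) \<in> insert (b, c) (\<pi> ` ?y)} = insert c {d. (b, d) \<in> \<pi> ` ?y}" by auto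
      moreover have finu: "finite {d. (b', d) \<in> \<pi> ` ?y}" for b'
      proof -
        have "{d. (b', d) \<in> \<pi> ` ?y} \<subseteq> snd ` \<pi> ` ?y"
        proof
          fix d assume "d \<in> {d. (b', d) \<in> \<pi> ` ?y}"
          then have "(b', d) \<in> \<pi> ` ?y" by simp
          from imageI[OF this, of snd] show "d \<in> snd ` \<pi> ` ?y" by simp
        qed
        then show ?thesis by (rule finite_subset) simp
      qed
      ultimately have "card {d. (b, d) \<in> insert (b, c) (\<pi> ` ?y)} = Suc (used ?y b)"
        unfolding used_def using new by simp
      then have lt: "used ?y b < card b" using K0 b unfolding K0_def bounded_sets_def by auto
      let ?F = "{v \<in> b. v \<notin> fst ` ?y}"
      have T0: "T f ((v, c) # ys) = 0" if "v \<in> b" "v \<in> fst ` ?y" for v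
      proof -
        have "insert (v, c) ?y \<notin> K"
        proof
          assume K: "insert (v, c) ?y \<in> K"
          obtain d where d: "(v, d) \<in> ?y" using \<open>v \<in> fst ` ?y\<close> by auto
          have "c = d" using K d unfolding K_iff by blast
          then have "(b, c) \<in> \<pi> ` ?y"
            using d blk_unique[OF b \<open>v \<in> b\<close>] by (force simp: \<pi>_def)
          then show False using new by simp
        qed
        then show ?thesis by (simp add: T_def)
      qed
      define w where "w = (\<Prod>b'\<in>B - {b}. fact (card b' - used ?y b') :: nat)"
      have wy: "weight ?y = of_nat (fact (card b - used ?y b) * w)"
        unfolding weight_def w_def using finB b by (simp add: prod.remove)
      have T1: "T f ((v, c) # ys) = of_nat (fact (card b - Suc (used ?y b)) * w) * f ((b, c) # ?m)"
        if v: "v \<in> b" "v \<notin> fst ` ?y" for v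
      proof -
        have bv: "v \<in> V" "blk v = b" using blk_unique[OF b v(1)] by auto
        have nov: "(v, d) \<notin> ?y" for d using v(2) by force
        have noc: "(u, c) \<notin> ?y" if "blk u = b" for u using new that by (force simp: \<pi>_def)
        have "insert (v, c) ?y \<in> K"
          unfolding K_iff
        proof (intro conjI allI impI)
          show "insert (v, c) ?y \<subseteq> V \<times> Col" using y(1) bv c by simp
          show "d = e" if "(u, d) \<in> insert (v, c) ?y" "(u, e) \<in> insert (v, c) ?y" for u d e
            using that nov[of d] nov[of e] y(2)[of u d e] by auto
          show "u = z" if "(u, d) \<in> insert (v, c) ?y" "(z, d) \<in> insert (v, c) ?y" "blk u = blk z" for u z d
            using that noc[of u] noc[of z] y(3)[of u d z] bv by auto
        qed
        moreover have "weight (insert (v, c) ?y) = of_nat (fact (card b - Suc (used ?y b)) * w)"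
        proof -
          have "used (insert (v, c) ?y) b = Suc (used ?y b)"
          proof -
            have "{d. (b, d) \<in> \<pi> ` insert (v, c) ?y} = insert c {d. (b, d) \<in> \<pi> ` ?y}"
              using bv by (auto simp: \<pi>_def)
            then show ?thesis unfolding used_def using new finu[of b] by simp
          qed
          moreover have "used (insert (v, c) ?y) b' = used ?y b'" if "b' \<noteq> b" for b'
          proof -
            have "{d. (b', d) \<in> \<pi> ` insert (v, c) ?y} = {d. (b', d) \<in> \<pi> ` ?y}"
              using bv that by (auto simp: \<pi>_def)
            then show ?thesis unfolding used_def by simp
          qed
          ultimately show ?thesis
            unfolding weight_def w_def using finB b by (simp add: prod.remove)
        qed
        ultimately show ?thesis by (simp add: T_def \<pi>_def bv)
      qed
      have cF: "card ?F = card b - used ?y b"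
      proof -
        have "?F = b - {v \<in> b. v \<in> fst ` ?y}" by auto
        then show ?thesis
          using used_eq_coloured[OF ysK b] fin_block[OF b] by (simp add: card_Diff_subset)
      qed
      have "(\<Sum>v\<in>b. T f ((v, c) # ys)) = (\<Sum>v\<in>?F. T f ((v, c) # ys))"
        using fin_block[OF b] T0 by (intro sum.mono_neutral_right) auto
      also have "\<dots> = (\<Sum>v\<in>?F. of_nat (fact (card b - Suc (used ?y b)) * w) * f ((b, c) # ?m))"
        by (intro sum.cong refl T1) auto
      also have "\<dots> = of_nat ((card b - used ?y b) * fact (card b - Suc (used ?y b)) * w) * f ((b, c) # ?m)"
        by (simp add: cF mult.assoc)
      also have "(card b - used ?y b) * fact (card b - Suc (used ?y b)) = fact (card b - used ?y b)"
        using lt by (simp add: fact_reduce)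
      finally show ?thesis by (simp only: wy)
    qed
    have VB: "V = \<Union>B" using blk blk_unique by blast
    have split_sum: "(\<Sum>v\<in>V. h v) = (\<Sum>b\<in>B. \<Sum>v\<in>b. h v)" for h :: "'a \<Rightarrow> int poly"
      unfolding VB using fin_block disj by (subst sum.Union_disjoint) simp_all
    have "app (bd (V \<times> Col)) (T f) ys = (\<Sum>v\<in>V. \<Sum>c\<in>Col. T f ((v, c) # ys))"
      unfolding app_bd by (simp add: sum.cartesian_product case_prod_unfold)
    also have "\<dots> = (\<Sum>b\<in>B. \<Sum>v\<in>b. \<Sum>c\<in>Col. T f ((v, c) # ys))"
      by (rule split_sum)
    also have "\<dots> = (\<Sum>b\<in>B. \<Sum>c\<in>Col. \<Sum>v\<in>b. T f ((v, c) # ys))"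
      by (intro sum.cong refl sum.swap)
    also have "\<dots> = (\<Sum>b\<in>B. \<Sum>c\<in>Col. weight ?y * f ((b, c) # ?m))"
      by (intro sum.cong refl key)
    also have "\<dots> = weight ?y * app (bd (B \<times> Col)) f ?m"
      unfolding app_bd by (simp add: sum.cartesian_product case_prod_unfold sum_distrib_left)
    finally show ?thesis using ysK by (simp add: T_def)
  qed
qed

lemma T_linear: "T (f + h) = T f + T h" "T ((\<lambda>_. c) * f) = (\<lambda>_. c) * T f"
  by (auto simp: T_def fun_eq_iff distrib_left)

lemma T_empty: "T (empty_chain 1) = empty_chain (of_nat (\<Prod>b\<in>B. fact (card b)))"
proof -
  have "{} \<in> K" unfolding K_iff by simp
  then show ?thesis by (auto simp: T_def fun_eq_iff empty_chain_def weight_def used_def)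
qed

lemma T_pull:
  assumes \<gamma>: "bij_betw \<gamma> Col Col" "inj \<gamma>"
  shows "T (app (pull (apsnd \<gamma>)) f) = app (pull (apsnd \<gamma>)) (T f)"
proof (rule ext)
  fix xs
  have m: "map \<pi> (map (apsnd \<gamma>) xs) = map (apsnd \<gamma>) (map \<pi> xs)"
    by (simp add: \<pi>_def)
  have inC: "\<gamma> c \<in> Col \<longleftrightarrow> c \<in> Col" for c
    using \<gamma> unfolding bij_betw_def by (metis imageI inj_image_mem_iff)
  have mem: "(u, d) \<in> apsnd \<gamma> ` x \<longleftrightarrow> (\<exists>c. d = \<gamma> c \<and> (u, c) \<in> x)" for u d x
    by force
  have K: "apsnd \<gamma> ` x \<in> K \<longleftrightarrow> x \<in> K" for x :: "('a \<times> 'c) set"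
  proof -
    have 1: "apsnd \<gamma> ` x \<subseteq> V \<times> Col \<longleftrightarrow> x \<subseteq> V \<times> Col"
      using inC by (fastforce simp: image_subset_iff)
    have 2: "(\<forall>u c d. (u, c) \<in> apsnd \<gamma> ` x \<longrightarrow> (u, d) \<in> apsnd \<gamma> ` x \<longrightarrow> c = d) \<longleftrightarrow>
        (\<forall>u c d. (u, c) \<in> x \<longrightarrow> (u, d) \<in> x \<longrightarrow> c = d)"
      unfolding mem using injD[OF \<gamma>(2)] by blast
    have 3: "(\<forall>u w c. (u, c) \<in> apsnd \<gamma> ` x \<longrightarrow> (w, c) \<in> apsnd \<gamma> ` x \<longrightarrow> blk u = blk w \<longrightarrow> u = w) \<longleftrightarrow>
        (\<forall>u w c. (u, c) \<in> x \<longrightarrow> (w, c) \<in> x \<longrightarrow> blk u = blk w \<longrightarrow> u = w)"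
      unfolding mem using injD[OF \<gamma>(2)] by blast
    show ?thesis unfolding K_iff 1 2 3 ..
  qed
  have "used (apsnd \<gamma> ` x) b = used x b" for x b
  proof -
    have "{c. (b, c) \<in> \<pi> ` apsnd \<gamma> ` x} = \<gamma> ` {c. (b, c) \<in> \<pi> ` x}"
      by (force simp: \<pi>_def)
    then show ?thesis unfolding used_def using \<gamma>(2) by (simp add: card_image inj_on_def inj_def)
  qed
  then have "weight (apsnd \<gamma> ` x) = weight x" for x unfolding weight_def by simp
  then show "T (app (pull (apsnd \<gamma>)) f) xs = app (pull (apsnd \<gamma>)) (T f) xs"
    unfolding app_pull T_def m set_map K by simp
qed

lemma acyclic_K0:
  assumes "\<And>b. b \<in> B \<Longrightarrow> card b < card Col" shows "acyclic_below (B \<times> Col) K0 (card V)"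
proof -
  have VB: "V = \<Union>B" using blk blk_unique by blast
  have "card V = (\<Sum>b\<in>B. card b)"
    unfolding VB using fin_block disj
    by (intro card_Union_disjoint) (simp_all add: pairwise_def disjnt_def)
  moreover have "acyclic_below (B \<times> Col) (bounded_sets B card (\<lambda>_. Col)) (\<Sum>b\<in>B. card b)"
    using finB finCol assms by (intro acyclic_below_bounded_sets) auto
  ultimately show ?thesis unfolding K0_def by simp
qed

end

section \<open>Orbits of commuting permutations of prime order\<close>

lemma funpow_p_eq:
  assumes "(f ^^ p) = id" "m mod p = n mod p" shows "(f ^^ m) x = (f ^^ n) x"
  using funpow_mod_eq[of p f x m] funpow_mod_eq[of p f x n] assms by simp

lemma inj_of_order:
  assumes "(f ^^ p) = id" "p > 0" shows "inj f"
proof (rule injI)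
  fix x y assume "f x = f y"
  then have "(f ^^ (p - 1)) (f x) = (f ^^ (p - 1)) (f y)" by simp
  then have "(f ^^ Suc (p - 1)) x = (f ^^ Suc (p - 1)) y" by (simp only: funpow_Suc_right o_apply)
  then show "x = y" using assms by simp
qed

lemma fixed_of_coprime_power:
  assumes p: "prime p" and f: "(f ^^ p) = id" and d: "(f ^^ d) z = z" "\<not> p dvd d"
  shows "f z = z"
proof -
  have "coprime d p" using prime_imp_coprime[OF p d(2)] coprime_commute by blast
  then obtain s where s: "[d * s = 1] (mod p)" using cong_solve_coprime_nat[of d p] by auto
  have "(f ^^ (d * s)) z = z" using d(1) by (induction s) (simp_all add: funpow_add)
  moreover have "(f ^^ (d * s)) z = (f ^^ 1) z"
    by (rule funpow_p_eq[OF f]) (use s in \<open>simp add: cong_def\<close>)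
  ultimately show ?thesis by simp
qed

text \<open>\<open>F\<close> counts the applications of \<open>f\<close> that lead from a chosen
  representative of the orbit. The count is unique modulo \<open>p\<close>, because an orbit of a
  map of prime order that is not a single point has exactly \<open>p\<close> elements.\<close>

lemma free_cyclic_index:
  fixes f :: "'y \<Rightarrow> 'y"
  assumes p: "prime p" and f: "(f ^^ p) = id"
  shows "\<exists>F :: 'y \<Rightarrow> int. \<forall>y. f y \<noteq> y \<longrightarrow> int p dvd F (f y) - F y - 1"
proof -
  have p0: "p > 0" using p prime_gt_0_nat by blast
  define orb where "orb y = {(f ^^ j) y | j. True}" for y
  define rep where "rep y = (SOME z. z \<in> orb y)" for y
  define F where "F y = int (SOME j. y = (f ^^ j) (rep y))" for y
  have self: "y \<in> orb y" for y unfolding orb_def by (auto intro: exI[of _ 0])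
  have rep: "rep y \<in> orb y" for y unfolding rep_def using self by (rule someI)
  have orbf: "orb (f y) = orb y" for y
  proof
    show "orb (f y) \<subseteq> orb y"
    proof
      fix z assume "z \<in> orb (f y)"
      then obtain j where "z = (f ^^ j) (f y)" unfolding orb_def by blast
      then have "z = (f ^^ Suc j) y" by (simp add: funpow_swap1)
      then show "z \<in> orb y" unfolding orb_def by blast
    qed
    show "orb y \<subseteq> orb (f y)"
    proof
      fix z assume "z \<in> orb y"
      then obtain j where "z = (f ^^ j) y" unfolding orb_def by blast
      also have "\<dots> = (f ^^ Suc (j + (p - 1))) y"
        using p0 by (intro funpow_p_eq[OF f]) simp
      also have "\<dots> = (f ^^ (j + (p - 1))) (f y)" by (simp only: funpow_Suc_right o_apply)
      finally show "z \<in> orb (f y)" unfolding orb_def by blast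
    qed
  qed
  have ex: "\<exists>j. y = (f ^^ j) (rep y)" for y
  proof -
    obtain j where j: "rep y = (f ^^ j) y" using rep[of y] unfolding orb_def by blast
    have "(f ^^ (j * (p - 1))) (rep y) = (f ^^ (j * (p - 1) + j)) y"
      unfolding j by (simp add: funpow_add)
    also have "j * (p - 1) + j = j * p" using p0 by (cases p) auto
    also have "(f ^^ (j * p)) y = (f ^^ 0) y" by (rule funpow_p_eq[OF f]) simp
    finally have "y = (f ^^ (j * (p - 1))) (rep y)" by simp
    then show ?thesis by blast
  qed
  have F: "y = (f ^^ nat (F y)) (rep y)" for y
    unfolding F_def using someI_ex[OF ex[of y]] by simp
  have "int p dvd F (f y) - F y - 1" if ne: "f y \<noteq> y" for y
  proof -
    have same: "rep (f y) = rep y" unfolding rep_def orbf ..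
    define a b z where "a = nat (F (f y))" and "b = Suc (nat (F y))" and "z = rep y"
    have "f y = (f ^^ a) z" using F[of "f y"] same unfolding a_def z_def by simp
    moreover have "f y = (f ^^ b) z" using arg_cong[OF F[of y], of f] unfolding b_def z_def by simp
    ultimately have ab: "(f ^^ a) z = (f ^^ b) z" by simp
    have fz: "f z \<noteq> z"
    proof
      assume "f z = z"
      then have "(f ^^ n) z = z" for n by (induction n) auto
      then show False using F[of y] ne \<open>f z = z\<close> unfolding z_def by simp
    qed
    have key: "p dvd n - m" if "m \<le> n" "(f ^^ m) z = (f ^^ n) z" for m n
    proof (rule ccontr)
      assume nd: "\<not> p dvd n - m"
      have "(f ^^ m) z = (f ^^ m) ((f ^^ (n - m)) z)"
        using that by (simp add: funpow_add[symmetric, THEN fun_cong, unfolded o_apply])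
      then have "z = (f ^^ (n - m)) z" using inj_fn[OF inj_of_order[OF f p0], of m] by (simp add: inj_eq)
      then show False using fixed_of_coprime_power[OF p f _ nd, of z] fz by simp
    qed
    have "int p dvd int a - int b"
    proof (cases "a \<le> b")
      case True
      then have "int p dvd int (b - a)" using key[OF True ab] by (simp only: int_dvd_int_iff)
      then show ?thesis using True by (simp add: of_nat_diff dvd_diff_commute)
    next
      case False
      then have "int p dvd int (a - b)" using key[of b a] ab by (simp only: int_dvd_int_iff)
      moreover have "int (a - b) = int a - int b" using False by simp
      ultimately show ?thesis by (simp only:)
    qed
    moreover have "int a = F (f y)" "int b = F y + 1" unfolding a_def b_def F_def by auto
    ultimately show ?thesis by (simp add: algebra_simps)
  qed
  then show ?thesis by blast
qed

text \<open>Every orbit of \<open>(Z/p)\<^sup>k\<close> other than a fixed point maps equivariantly onto \<open>Z/p\<close> with some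
  nontrivial action by translations; \<open>l i\<close> is the translation by which the \<open>i\<close>-th generator acts. In
  the induction step, the last permutation either moves an orbit of the others, and then counts its
  position among the translates, or preserves it, and then acts on it like a product of the others.\<close>

lemma equivariant_index:
  fixes act :: "nat \<Rightarrow> 'y \<Rightarrow> 'y"
  assumes p: "prime p"
  shows "(\<And>i. i < k \<Longrightarrow> (act i ^^ p) = id) \<Longrightarrow>
    (\<And>i j. i < k \<Longrightarrow> j < k \<Longrightarrow> act i \<circ> act j = act j \<circ> act i) \<Longrightarrow>
    \<exists>(F :: 'y \<Rightarrow> int) (l :: nat \<Rightarrow> 'y \<Rightarrow> int). \<forall>y. (\<exists>i<k. act i y \<noteq> y) \<longrightarrow>
      (\<forall>i<k. int p dvd F (act i y) - F y - l i y) \<and>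
      (\<forall>i<k. \<forall>j<k. l i (act j y) = l i y) \<and> (\<exists>i<k. \<not> int p dvd l i y)"
proof (induction k)
  case 0
  then show ?case by simp
next
  case (Suc k)
  have p1: "p > 1" using p prime_gt_1_nat by blast
  have ord: "(act i ^^ p) = id" if "i \<le> k" for i
    by (rule Suc.prems(1)) (use that in simp)
  have com: "act i (act j y) = act j (act i y)" if "i \<le> k" "j \<le> k" for i j y
    using fun_cong[OF Suc.prems(2)[of i j], of y] that by simp
  have inj: "inj (act i)" if "i \<le> k" for i using inj_of_order[OF ord[OF that]] p1 by simp
  obtain F0 :: "'y \<Rightarrow> int" and l0 :: "nat \<Rightarrow> 'y \<Rightarrow> int" where IH: "\<And>y. (\<exists>i<k. act i y \<noteq> y) \<Longrightarrow>
      (\<forall>i<k. int p dvd F0 (act i y) - F0 y - l0 i y) \<and>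
      (\<forall>i<k. \<forall>j<k. l0 i (act j y) = l0 i y) \<and> (\<exists>i<k. \<not> int p dvd l0 i y)"
  proof -
    have "\<exists>(F :: 'y \<Rightarrow> int) (l :: nat \<Rightarrow> 'y \<Rightarrow> int). \<forall>y. (\<exists>i<k. act i y \<noteq> y) \<longrightarrow>
      (\<forall>i<k. int p dvd F (act i y) - F y - l i y) \<and>
      (\<forall>i<k. \<forall>j<k. l i (act j y) = l i y) \<and> (\<exists>i<k. \<not> int p dvd l i y)"
      using Suc.prems by (intro Suc.IH) simp_all
    then show ?thesis using that by blast
  qed
  \<comment> \<open>Forward steps are enough to generate the orbits, since the inverse of each
    permutation is its power \<open>p - 1\<close>.\<close>
  define R where "R = {(u, act i u) | u i. i < k}"
  define orb where "orb y = R\<^sup>* `` {y}" for y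
  have undo: "(act i u, u) \<in> R\<^sup>*" if "i < k" for i u
  proof -
    have "(v, (act i ^^ n) v) \<in> R\<^sup>*" for n v
    proof (induction n)
      case (Suc n)
      have "((act i ^^ n) v, act i ((act i ^^ n) v)) \<in> R" unfolding R_def using that by blast
      with Suc show ?case by (simp add: rtrancl_into_rtrancl)
    qed simp
    from this[of "act i u" "p - 1"] have "(act i u, (act i ^^ Suc (p - 1)) u) \<in> R\<^sup>*"
      by (simp only: funpow_Suc_right o_apply)
    then show ?thesis using ord[of i] that p1 by simp
  qed
  have orb_act: "orb (act i y) = orb y" if "i < k" for i y
  proof -
    have "(y, act i y) \<in> R" unfolding R_def using that by blast
    then show ?thesis
      unfolding orb_def using undo[OF that, of y] by (auto intro: rtrancl_trans converse_rtrancl_into_rtrancl)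
  qed
  have step: "(act k u, act k v) \<in> R" if "(u, v) \<in> R" for u v
    using that com[of k] unfolding R_def by auto
  have steps: "(act k u, act k v) \<in> R\<^sup>*" if "(u, v) \<in> R\<^sup>*" for u v
    using that by (induction rule: rtrancl_induct) (auto intro: rtrancl_into_rtrancl step)
  have stepsn: "((act k ^^ n) u, (act k ^^ n) v) \<in> R\<^sup>*" if "(u, v) \<in> R\<^sup>*" for u v n
    using that by (induction n) (auto intro: steps)
  have orb_k: "orb (act k y) = act k ` orb y" for y
  proof
    show "act k ` orb y \<subseteq> orb (act k y)" unfolding orb_def using steps by auto
    show "orb (act k y) \<subseteq> act k ` orb y"
    proof
      fix z assume "z \<in> orb (act k y)"
      then have "(act k y, z) \<in> R\<^sup>*" unfolding orb_def by simp
      from stepsn[OF this, of "p - 1"] have "((act k ^^ Suc (p - 1)) y, (act k ^^ (p - 1)) z) \<in> R\<^sup>*"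
        by (simp only: funpow_Suc_right o_apply)
      then have "(act k ^^ (p - 1)) z \<in> orb y" using ord[of k] p1 unfolding orb_def by simp
      moreover have "act k ((act k ^^ (p - 1)) z) = (act k ^^ Suc (p - 1)) z" by simp
      then have "act k ((act k ^^ (p - 1)) z) = z" using ord[of k] p1 by simp
      ultimately show "z \<in> act k ` orb y" by (metis imageI)
    qed
  qed
  have imp: "((`) (act k) ^^ n) A = (act k ^^ n) ` A" for n A
    by (induction n) (auto simp: image_image)
  then have "((`) (act k) ^^ p) = id" using ord[of k] by (auto simp: fun_eq_iff)
  from free_cyclic_index[OF p this] obtain F1 :: "'y set \<Rightarrow> int"
    where F1: "\<And>A. act k ` A \<noteq> A \<Longrightarrow> int p dvd F1 (act k ` A) - F1 A - 1" by blast
  define moved where "moved y \<longleftrightarrow> act k ` orb y \<noteq> orb y" for y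
  have moved_act: "moved (act i y) \<longleftrightarrow> moved y" if "i \<le> k" for i y
  proof (cases "i = k")
    case True
    show ?thesis unfolding True moved_def orb_k using inj[of k] by (simp add: inj_image_eq_iff)
  next
    case False
    then show ?thesis unfolding moved_def using orb_act[of i y] that by simp
  qed
  define F where "F y = (if moved y then F1 (orb y) else F0 y)" for y
  \<comment> \<open>On a preserved orbit the translation of the last permutation is read off from
    \<open>F0\<close>. The reduction modulo \<open>p\<close> makes it constant along the orbit as an
    integer, not only up to congruence.\<close>
  define l where "l i y = (if moved y then (if i = k then 1 else 0)
     else if i = k then (F0 (act k y) - F0 y) mod int p else l0 i y)" for i y
  have "(\<forall>i<Suc k. int p dvd F (act i y) - F y - l i y) \<and>
      (\<forall>i<Suc k. \<forall>j<Suc k. l i (act j y) = l i y) \<and> (\<exists>i<Suc k. \<not> int p dvd l i y)"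
    if ex: "\<exists>i<Suc k. act i y \<noteq> y" for y
  proof (cases "moved y")
    case True
    have "int p dvd F (act i y) - F y - l i y" if "i < Suc k" for i
    proof (cases "i = k")
      case ik: True
      show ?thesis
        using \<open>moved y\<close> moved_act[of k y] F1[of "orb y"] unfolding ik F_def l_def orb_k moved_def by simp
    next
      case False
      then show ?thesis using \<open>moved y\<close> moved_act[of i y] orb_act[of i y] that unfolding F_def l_def by simp
    qed
    moreover have "l i (act j y) = l i y" if "i < Suc k" "j < Suc k" for i j
      using True moved_act[of j y] that unfolding l_def by simp
    moreover have "\<not> int p dvd l k y" using True p1 unfolding l_def by simp
    ultimately show ?thesis by blast
  next
    case False
    then have ky: "act k y \<in> orb y" unfolding moved_def orb_k[symmetric] orb_def by auto
    have ex': "\<exists>i<k. act i y \<noteq> y"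
    proof (rule ccontr)
      assume none: "\<not> (\<exists>i<k. act i y \<noteq> y)"
      have "z = y" if "(y, z) \<in> R\<^sup>*" for z
        using that by (induction rule: rtrancl_induct) (use none in \<open>auto simp: R_def\<close>)
      then have "act k y = y" using ky unfolding orb_def by blast
      with none ex show False using less_SucE by blast
    qed
    define S where "S z \<longleftrightarrow> (\<exists>i<k. act i z \<noteq> z)" for z
    have S_act: "S (act j z)" if "S z" "j \<le> k" for j z
    proof -
      obtain i where i: "i < k" "act i z \<noteq> z" using \<open>S z\<close> unfolding S_def by blast
      then have "act j (act i z) \<noteq> act j z" using inj[OF that(2)] by (simp add: inj_eq)
      then have "act i (act j z) \<noteq> act j z" using com[of i j z] i(1) that(2) by simp
      then show ?thesis unfolding S_def using i(1) by blast
    qed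
    have S_orb: "S z" if "(y, z) \<in> R\<^sup>*" for z
      using that
    proof (induction rule: rtrancl_induct)
      case base
      then show ?case unfolding S_def using ex' .
    next
      case (step u v)
      then show ?case using S_act unfolding R_def by auto
    qed
    have dvd0: "int p dvd F0 (act i z) - F0 z - l0 i z" if "S z" "i < k" for z i
      using IH[of z] that unfolding S_def by blast
    have l0_orb: "l0 i z = l0 i y" if "(y, z) \<in> R\<^sup>*" "i < k" for z i
      using that
    proof (induction rule: rtrancl_induct)
      case (step u v)
      then obtain j where j: "j < k" "v = act j u" unfolding R_def by auto
      have "S u" using S_orb step.hyps(1) .
      then have "l0 i (act j u) = l0 i u" using IH[of u] j(1) step.prems unfolding S_def by blast
      then show ?case using step j by simp
    qed simp
    define h where "h z = (F0 (act k z) - F0 z) mod int p" for z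
    have ky': "(y, act k y) \<in> R\<^sup>*" using ky unfolding orb_def by simp
    \<comment> \<open>\<open>act j\<close> and \<open>act k\<close> commute and \<open>l0 j\<close>
      is constant along the orbit, so \<open>F0\<close> changes by the same amount modulo
      \<open>p\<close> on opposite sides of the square they form.\<close>
    have h_step: "h (act j z) = h z" if z: "(y, z) \<in> R\<^sup>*" and j: "j < k" for j z
    proof -
      have Sz: "S z" using S_orb z .
      have kz: "(y, act k z) \<in> R\<^sup>*" using rtrancl_trans[OF ky' steps[OF z]] .
      have "int p dvd F0 (act j (act k z)) - F0 (act k z) - l0 j (act k z)"
        by (rule dvd0[OF S_orb[OF kz] j])
      moreover have "int p dvd F0 (act j z) - F0 z - l0 j z" by (rule dvd0[OF Sz j])
      moreover have "l0 j (act k z) = l0 j z" using l0_orb[OF kz j] l0_orb[OF z j] by simp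
      ultimately have "int p dvd (F0 (act j (act k z)) - F0 (act k z) - l0 j z) - (F0 (act j z) - F0 z - l0 j z)"
        by (metis dvd_diff)
      then have "int p dvd (F0 (act k (act j z)) - F0 (act j z)) - (F0 (act k z) - F0 z)"
        using com[of j k z] j by (simp add: algebra_simps)
      then show ?thesis unfolding h_def by (simp add: mod_eq_dvd_iff)
    qed
    have h_orb: "h z = h y" if "(y, z) \<in> R\<^sup>*" for z
      using that
    proof (induction rule: rtrancl_induct)
      case (step u v)
      then obtain j where "j < k" "v = act j u" unfolding R_def by auto
      then show ?case using h_step[OF step.hyps(1)] step.IH by simp
    qed simp
    have jorb: "(y, act j y) \<in> R\<^sup>*" if "j < Suc k" for j
    proof (cases "j = k")
      case False
      then have "(y, act j y) \<in> R" unfolding R_def using that by auto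
      then show ?thesis by blast
    qed (simp add: ky')
    have nm: "\<not> moved (act j y)" if "j < Suc k" for j using moved_act[of j y] False that by simp
    have lval: "l i z = (if i = k then h z else l0 i z)" if "\<not> moved z" for i z
      unfolding l_def h_def using that by simp
    have "int p dvd F (act i y) - F y - l i y" if "i < Suc k" for i
    proof (cases "i = k")
      case True
      have "int p dvd (F0 (act k y) - F0 y) - (F0 (act k y) - F0 y) mod int p"
        by (rule dvd_minus_mod)
      then show ?thesis
        using True False nm[of k] unfolding F_def l_def by simp
    next
      case ik: False
      then show ?thesis
        using False nm[OF that] dvd0[OF S_orb[OF rtrancl.rtrancl_refl], of i] that unfolding F_def lval[OF False] by simp
    qed
    moreover have "l i (act j y) = l i y" if "i < Suc k" "j < Suc k" for i j
      unfolding lval[OF False] lval[OF nm[OF that(2)]] h_orb[OF jorb[OF that(2)]]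
      using l0_orb[OF jorb[OF that(2)], of i] that(1) by simp
    moreover have "\<exists>i<Suc k. \<not> int p dvd l i y"
    proof -
      obtain i where "i < k" "\<not> int p dvd l0 i y" using IH[OF ex'] by blast
      then show ?thesis unfolding lval[OF False] by (intro exI[of _ i]) simp
    qed
    ultimately show ?thesis by blast
  qed
  then show ?case by (intro exI[of _ F] exI[of _ l]) blast
qed

text \<open>The \<open>p\<^sup>k\<close> colours are the vectors of \<open>(Z/p)\<^sup>k\<close>, on which the group acts by translations.\<close>

definition colour_set :: "nat \<Rightarrow> nat \<Rightarrow> (nat \<Rightarrow> nat) set" where
  "colour_set p k = PiE {..<k} (\<lambda>_. {..<p})"

text \<open>The identity outside \<open>colour_set\<close> makes every shift a permutation of the
  whole type whose \<open>p\<close>-th power is \<open>id\<close>.\<close>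

definition shift :: "nat \<Rightarrow> nat \<Rightarrow> nat \<Rightarrow> (nat \<Rightarrow> nat) \<Rightarrow> (nat \<Rightarrow> nat)" where
  "shift p k i c = (if c \<in> colour_set p k then c(i := (c i + 1) mod p) else c)"

lemma card_colour_set: "card (colour_set p k) = p ^ k" and finite_colour_set: "finite (colour_set p k)"
  unfolding colour_set_def by (auto simp: card_PiE finite_PiE)

lemma update_colour: "p > 0 \<Longrightarrow> i < k \<Longrightarrow> c \<in> colour_set p k \<Longrightarrow> c(i := a mod p) \<in> colour_set p k"
  unfolding colour_set_def by (auto simp: PiE_iff extensional_def)

lemma shift_power:
  assumes "p > 0" "i < k"
  shows "(shift p k i ^^ n) c = (if c \<in> colour_set p k then c(i := (c i + n) mod p) else c)"
proof (induction n)
  case 0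
  have "c i < p" if "c \<in> colour_set p k" using that assms(2) unfolding colour_set_def by (auto simp: PiE_iff)
  then show ?case by simp
next
  case (Suc n)
  show ?case
  proof (cases "c \<in> colour_set p k")
    case True
    define e where "e = c(i := (c i + n) mod p)"
    have e: "e \<in> colour_set p k" unfolding e_def by (rule update_colour[OF assms True])
    have "(shift p k i ^^ n) c = e"
      unfolding e_def using Suc True by (simp only: if_True)
    then have "(shift p k i ^^ Suc n) c = shift p k i e" by simp
    also have "\<dots> = e(i := (e i + 1) mod p)" using e by (simp add: shift_def)
    also have "\<dots> = c(i := (c i + Suc n) mod p)" by (simp add: e_def mod_Suc_eq)
    finally show ?thesis using True by simp
  next
    case False
    then show ?thesis using Suc by (simp add: shift_def)
  qed
qed

lemma shift_order: "p > 0 \<Longrightarrow> i < k \<Longrightarrow> (shift p k i ^^ p) = id"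
proof (rule ext)
  fix c assume "p > 0" "i < k"
  from shift_power[OF this, of p c] shift_power[OF this, of 0 c]
  show "(shift p k i ^^ p) c = id c" by (cases "c \<in> colour_set p k") simp_all
qed

lemma shift_comm:
  assumes "p > 0" "i < k" "j < k" shows "shift p k i \<circ> shift p k j = shift p k j \<circ> shift p k i"
proof
  fix c
  show "(shift p k i \<circ> shift p k j) c = (shift p k j \<circ> shift p k i) c"
    using update_colour[OF assms(1,2), of c] update_colour[OF assms(1,3), of c]
    by (cases "i = j") (auto simp: shift_def fun_upd_twist)
qed

lemma shift_mem_iff: "p > 0 \<Longrightarrow> i < k \<Longrightarrow> shift p k i c \<in> colour_set p k \<longleftrightarrow> c \<in> colour_set p k"
  using update_colour by (auto simp: shift_def)

lemma inj_shift: "p > 0 \<Longrightarrow> i < k \<Longrightarrow> inj (shift p k i)"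
  using inj_of_order[OF shift_order] by blast

lemma bij_shift:
  assumes "p > 0" "i < k" shows "bij_betw (shift p k i) (colour_set p k) (colour_set p k)"
proof -
  have "inj_on (shift p k i) (colour_set p k)"
    using inj_shift[OF assms] inj_on_subset by blast
  moreover have "shift p k i ` colour_set p k \<subseteq> colour_set p k"
    using shift_mem_iff[OF assms] by blast
  ultimately show ?thesis
    unfolding bij_betw_def using endo_inj_surj[OF finite_colour_set] by blast
qed

text \<open>From any member, every colour is reached by adjusting one coordinate after another.
  Consequently a nonempty proper set of colours, such as a label, is moved by some shift.\<close>

lemma shift_transitive:
  assumes p: "p > 0" and A: "A \<subseteq> colour_set p k" "A \<noteq> {}" and inv: "\<And>i. i < k \<Longrightarrow> shift p k i ` A = A"
  shows "A = colour_set p k"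
proof
  show "colour_set p k \<subseteq> A"
  proof
    fix d assume d: "d \<in> colour_set p k"
    obtain c where c: "c \<in> A" using A(2) by blast
    have "(\<lambda>i. if i < j then d i else c i) \<in> A" if "j \<le> k" for j
      using that
    proof (induction j)
      case 0
      then show ?case using c by simp
    next
      case (Suc j)
      define e where "e = (\<lambda>i. if i < j then d i else c i)"
      have e: "e \<in> A" unfolding e_def using Suc by simp
      have j: "j < k" using Suc.prems by simp
      have pow: "(shift p k j ^^ n) e \<in> A" for n
        by (induction n) (use e inv[OF j] in auto)
      have "e j < p" "d j < p"
        using e A(1) d j unfolding colour_set_def by (auto simp: PiE_iff)
      \<comment> \<open>The number of shifts that lead from \<open>e j\<close> to
        \<open>d j\<close>, passing through \<open>p\<close> so that the subtraction does not
        truncate.\<close>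
      then have "(e j + (p - e j + d j)) mod p = d j" by simp
      then have "(shift p k j ^^ (p - e j + d j)) e = e(j := d j)"
        using e A(1) shift_power[OF p j] by auto
      moreover have "e(j := d j) = (\<lambda>i. if i < Suc j then d i else c i)"
        by (auto simp: e_def fun_eq_iff less_Suc_eq)
      ultimately show ?case using pow by metis
    qed
    from this[of k] have "(\<lambda>i. if i < k then d i else c i) \<in> A" by simp
    moreover have "(\<lambda>i. if i < k then d i else c i) = d"
      using d c A(1) unfolding colour_set_def by (auto simp: fun_eq_iff PiE_iff extensional_def)
    ultimately show "d \<in> A" by simp
  qed
qed (rule A(1))

lemma prime_action_shift:
  assumes "prime p" "finite V"
  shows "prime_action p k (V \<times> colour_set p k) (\<lambda>i. apsnd (shift p k i))"
proof
  have p: "p > 0" using assms(1) prime_gt_0_nat by blast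
  show "finite (V \<times> colour_set p k)" using assms(2) finite_colour_set by blast
  show "bij_betw (apsnd (shift p k i)) (V \<times> colour_set p k) (V \<times> colour_set p k)" if "i < k" for i
    using bij_betw_map_prod[OF bij_betw_id bij_shift[OF p that], of V] by (simp add: apsnd_def)
  have pw: "(apsnd f ^^ n) = apsnd (f ^^ n)" for f :: "(nat \<Rightarrow> nat) \<Rightarrow> (nat \<Rightarrow> nat)" and n
    by (induction n) (auto simp: fun_eq_iff)
  show "(apsnd (shift p k i) ^^ p) = id" if "i < k" for i
    unfolding pw shift_order[OF p that] by (auto simp: fun_eq_iff)
  show "apsnd (shift p k i) \<circ> apsnd (shift p k j) = apsnd (shift p k j) \<circ> apsnd (shift p k i)"
    if "i < k" "j < k" for i j
    using shift_comm[OF p that] by (auto simp: fun_eq_iff)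
qed (rule assms)

section \<open>Labels of partial colourings\<close>

text \<open>The vertices at which a new run of equally coloured vertices starts, where uncoloured vertices
  are skipped and \<open>l\<close> is the colour of the preceding run. Since neighbours in the list never start two
  runs of the same colour, restricting a colouring to these vertices makes it proper along the path.\<close>

fun run_starts :: "('a \<Rightarrow> 'c option) \<Rightarrow> 'c option \<Rightarrow> 'a list \<Rightarrow> 'a list" where
  "run_starts f l [] = []"
| "run_starts f l (v # vs) =
     (if f v = None \<or> f v = l then run_starts f l vs else v # run_starts f (f v) vs)"

fun first_colour :: "('a \<Rightarrow> 'c option) \<Rightarrow> 'a list \<Rightarrow> 'c option" where
  "first_colour f [] = None"
| "first_colour f (v # vs) = (if f v = None then first_colour f vs else f v)"

lemma set_run_starts: "v \<in> set (run_starts f l vs) \<Longrightarrow> v \<in> set vs \<and> f v \<noteq> None"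
  by (induction vs arbitrary: l) (auto split: if_splits)

lemma distinct_run_starts: "distinct vs \<Longrightarrow> distinct (run_starts f l vs)"
  by (induction vs arbitrary: l) (auto dest: set_run_starts)

text \<open>Colouring further vertices does not decrease the number of runs. A newly coloured vertex
  changes the preceding colour for the rest of the list, which may cost one run there, but it then
  starts a run itself; the second inequality is this loss of at most one.\<close>

lemma run_starts_le:
  assumes "\<And>v. v \<in> set vs \<Longrightarrow> f v \<noteq> None \<Longrightarrow> h v = f v"
  shows "length (run_starts f l vs) \<le> length (run_starts h l vs)
    \<and> length (run_starts f l vs) \<le> Suc (length (run_starts h l' vs))"
  using assms
proof (induction vs arbitrary: l l')
  case (Cons v vs)
  have IH: "length (run_starts f l vs) \<le> length (run_starts h l vs)"
    "length (run_starts f l vs) \<le> Suc (length (run_starts h l' vs))" for l l'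
    using Cons.IH[of l l'] Cons.prems by auto
  show ?case
  proof (cases "f v = None")
    case True
    then show ?thesis
      using IH(1)[of l] IH(2)[of l l'] IH(2)[of l "h v"] by (auto simp: le_SucI)
  next
    case False
    then have "h v = f v" using Cons.prems by simp
    then show ?thesis
      using False IH(1)[of l] IH(2)[of l l'] IH(1)[of "f v"] IH(2)[of "f v" l'] IH(2)[of "f v" "f v"]
      by (auto simp: le_SucI)
  qed
qed simp

lemma run_starts_irrelevant:
  "first_colour f vs \<noteq> Some d \<Longrightarrow> run_starts f (Some d) vs = run_starts f None vs"
  by (induction vs) (auto split: if_splits)

text \<open>If the extension had another first colour, that colour would form a run in front of all
  previous ones, and the number of runs would grow.\<close>

lemma run_starts_first:
  assumes "\<And>v. v \<in> set vs \<Longrightarrow> f v \<noteq> None \<Longrightarrow> h v = f v"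
    and "length (run_starts f None vs) = length (run_starts h None vs)" "first_colour f vs \<noteq> None"
  shows "first_colour h vs = first_colour f vs"
  using assms
proof (induction vs)
  case (Cons v vs)
  show ?case
  proof (cases "f v")
    case (Some c)
    then show ?thesis using Cons.prems(1)[of v] by simp
  next
    case f: None
    show ?thesis
    proof (cases "h v")
      case None
      then show ?thesis using f Cons by simp
    next
      case (Some d)
      have "first_colour f vs = Some d"
      proof (rule ccontr)
        assume "first_colour f vs \<noteq> Some d"
        then have "run_starts f None vs = run_starts f (Some d) vs"
          by (rule run_starts_irrelevant[symmetric])
        moreover have "length (run_starts f (Some d) vs) \<le> length (run_starts h (Some d) vs)"
          using run_starts_le[of vs f h "Some d"] Cons.prems(1) by auto
        ultimately show False using Cons.prems(2) f Some by simp
      qed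
      then show ?thesis using f Some by simp
    qed
  qed
qed simp

lemma run_starts_Nil: "run_starts f None vs = [] \<Longrightarrow> v \<in> set vs \<Longrightarrow> f v = None"
  by (induction vs) (auto split: if_splits)

lemma first_colour_None: "first_colour f vs = None \<Longrightarrow> v \<in> set vs \<Longrightarrow> f v = None"
  by (induction vs) (auto split: if_splits)

lemma first_colour_Some: "first_colour f vs = Some c \<Longrightarrow> \<exists>v\<in>set vs. f v = Some c"
  by (induction vs) (auto split: if_splits)

lemma run_starts_map:
  assumes "inj \<gamma>"
  shows "run_starts (\<lambda>v. map_option \<gamma> (f v)) (map_option \<gamma> l) vs = run_starts f l vs"
proof (induction vs arbitrary: l)
  case (Cons v vs)
  have "map_option \<gamma> (f v) = map_option \<gamma> l \<longleftrightarrow> f v = l"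
    using inj_eq[OF option.inj_map[OF assms]] .
  then show ?case using Cons[of l] Cons[of "f v"] by simp
qed simp

lemma first_colour_map: "first_colour (\<lambda>v. map_option \<gamma> (f v)) vs = map_option \<gamma> (first_colour f vs)"
  by (induction vs) auto

lemma run_starts_adjacent:
  assumes "distinct (us @ u # w # ws)" "u \<in> set (run_starts f l (us @ u # w # ws))"
    "w \<in> set (run_starts f l (us @ u # w # ws))"
  shows "f u \<noteq> f w"
  using assms
proof (induction us arbitrary: l)
  case Nil
  have nin: "u \<notin> set (run_starts f l' (w # ws))" "w \<notin> set (run_starts f l' ws)" for l'
    using set_run_starts[of u f l' "w # ws"] set_run_starts[of w f l' ws] Nil.prems(1) by auto
  have "\<not> (f u = None \<or> f u = l)"
  proof
    assume "f u = None \<or> f u = l"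
    then have "run_starts f l (u # w # ws) = run_starts f l (w # ws)"
      by (simp only: run_starts.simps if_True)
    with Nil.prems(2) nin(1)[of l] show False by (simp only: append_Nil)
  qed
  then have "w \<in> set (run_starts f (f u) (w # ws))"
    using Nil.prems(1,3) by auto
  then show ?case using nin(2) by (auto split: if_splits)
next
  case (Cons a us)
  have "u \<noteq> a" "w \<noteq> a" using Cons.prems(1) by auto
  then show ?case
    using Cons.IH[of l] Cons.IH[of "f a"] Cons.prems by (auto split: if_splits)
qed

definition colour_of :: "('a \<times> 'c) set \<Rightarrow> 'a \<Rightarrow> 'c option" where
  "colour_of x v = (if \<exists>c. (v, c) \<in> x then Some (SOME c. (v, c) \<in> x) else None)"

lemma colour_of_eq_Some:
  assumes "\<And>c d. (v, c) \<in> x \<Longrightarrow> (v, d) \<in> x \<Longrightarrow> c = d"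
  shows "colour_of x v = Some c \<longleftrightarrow> (v, c) \<in> x"
proof
  assume "colour_of x v = Some c"
  then have "\<exists>c. (v, c) \<in> x" "c = (SOME c. (v, c) \<in> x)"
    unfolding colour_of_def by (auto split: if_splits)
  then show "(v, c) \<in> x" using someI_ex by simp
next
  assume c: "(v, c) \<in> x"
  then have "(v, SOME c. (v, c) \<in> x) \<in> x" by (rule someI)
  then have "(SOME c. (v, c) \<in> x) = c" using assms c by blast
  then show "colour_of x v = Some c" using c unfolding colour_of_def by auto
qed

lemma colour_of_eq_None: "colour_of x v = None \<longleftrightarrow> (\<forall>c. (v, c) \<notin> x)"
  unfolding colour_of_def by simp

lemma colourings_recolour:
  assumes x: "x \<in> colourings E V (\<lambda>_. Col)" and \<gamma>: "inj \<gamma>" "\<And>c. c \<in> Col \<Longrightarrow> \<gamma> c \<in> Col"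
  shows "apsnd \<gamma> ` x \<in> colourings E V (\<lambda>_. Col)"
proof (rule colouringsI)
  have mem: "(u, d) \<in> apsnd \<gamma> ` x \<longleftrightarrow> (\<exists>c. d = \<gamma> c \<and> (u, c) \<in> x)" for u d
    by force
  show "u \<in> V \<and> c \<in> Col" if "(u, c) \<in> apsnd \<gamma> ` x" for u c
    using that colouringsD(1,2)[OF x] \<gamma>(2) unfolding mem by blast
  show "c = d" if "(u, c) \<in> apsnd \<gamma> ` x" "(u, d) \<in> apsnd \<gamma> ` x" for u c d
    using that colouringsD(3)[OF x] unfolding mem by blast
  show "{u, w} \<notin> E" if "(u, c) \<in> apsnd \<gamma> ` x" "(w, c) \<in> apsnd \<gamma> ` x" for u w c
    using that colouringsD(4)[OF x] injD[OF \<gamma>(1)] unfolding mem by blast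
qed

text \<open>The set \<open>Q j\<close> is \<open>P j\<close> without the remainder of \<open>card (P j) + 1\<close> modulo \<open>p\<^sup>k\<close> many
  vertices. It is too small for every colour to occur more than \<open>a j\<close> times, so the set of colours
  that do is not the set of all colours and hence moved by some shift.\<close>

locale balanced_targets =
  fixes V :: "'a set" and E :: "'a set set" and m :: nat and P Q :: "nat \<Rightarrow> 'a set"
    and vs :: "'a list" and p k :: nat and a :: "nat \<Rightarrow> nat"
  assumes prime: "prime p" and q2: "p ^ k \<ge> 2" and finV: "finite V"
    and vs: "distinct vs" "set vs = V"
    and part: "vertex_partition V m P"
    and Q: "j \<in> {1..m} \<Longrightarrow> Q j \<subseteq> P j" "j \<in> {1..m} \<Longrightarrow> card (Q j) + 1 = p ^ k * (a j + 1)"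
    and size: "card V \<ge> (p ^ k - 1) * m + 1"
begin

abbreviation "Col \<equiv> colour_set p k"
abbreviation "K \<equiv> colourings E V (\<lambda>_. Col)"
definition excess :: "nat \<Rightarrow> ('a \<times> (nat \<Rightarrow> nat)) set \<Rightarrow> (nat \<Rightarrow> nat) set" where
  "excess j x = {c \<in> Col. a j < card {v \<in> Q j. (v, c) \<in> x}}"
definition exceeds :: "('a \<times> (nat \<Rightarrow> nat)) set \<Rightarrow> bool" where
  "exceeds x \<longleftrightarrow> (\<exists>j\<in>{1..m}. excess j x \<noteq> {})"
definition runs :: "('a \<times> (nat \<Rightarrow> nat)) set \<Rightarrow> nat" where
  "runs x = length (run_starts (colour_of x) None vs)"
definition max_runs :: nat where "max_runs = card V - 1 - (p ^ k - 1) * m"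
definition level :: "('a \<times> (nat \<Rightarrow> nat)) set \<Rightarrow> nat" where
  "level x = (if exceeds x then max_runs + (\<Sum>j\<in>{1..m}. card (excess j x)) else runs x)"
text \<open>The choice among the nonempty excess sets has to commute with the shifts, and these do
  not affect the index \<open>j\<close>. Without excess the label has at most one element.\<close>

definition label :: "('a \<times> (nat \<Rightarrow> nat)) set \<Rightarrow> (nat \<Rightarrow> nat) set" where
  "label x = (if exceeds x then excess (LEAST j. j \<in> {1..m} \<and> excess j x \<noteq> {}) x
     else {c. first_colour (colour_of x) vs = Some c})"

lemma p_pos: "p > 0" using prime prime_gt_0_nat by blast

lemma P_V: "j \<in> {1..m} \<Longrightarrow> P j \<subseteq> V"
  using part unfolding vertex_partition_def by blast

lemma finQ: "j \<in> {1..m} \<Longrightarrow> finite (Q j)"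
  using Q(1) P_V finV by (meson finite_subset)

lemma finite_excess: "finite (excess j x)"
  unfolding excess_def using finite_colour_set by simp

lemma excess_mono: "j \<in> {1..m} \<Longrightarrow> x \<subseteq> y \<Longrightarrow> excess j x \<subseteq> excess j y"
proof
  fix c assume j: "j \<in> {1..m}" and xy: "x \<subseteq> y" and c: "c \<in> excess j x"
  have "card {v \<in> Q j. (v, c) \<in> x} \<le> card {v \<in> Q j. (v, c) \<in> y}"
    using xy finQ[OF j] by (intro card_mono) auto
  then show "c \<in> excess j y" using c unfolding excess_def by simp
qed

lemma excess_proper:
  assumes x: "x \<in> K" and j: "j \<in> {1..m}" shows "excess j x \<subset> Col"
proof -
  have "excess j x \<noteq> Col"
  proof
    assume eq: "excess j x = Col"
    have "p ^ k * (a j + 1) = (\<Sum>c\<in>Col. a j + 1)" by (simp add: card_colour_set)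
    also have "\<dots> \<le> (\<Sum>c\<in>Col. card {v \<in> Q j. (v, c) \<in> x})"
    proof (rule sum_mono)
      fix c assume "c \<in> Col"
      then have "c \<in> excess j x" using eq by blast
      then show "a j + 1 \<le> card {v \<in> Q j. (v, c) \<in> x}" unfolding excess_def by simp
    qed
    also have "\<dots> = card (\<Union>c\<in>Col. {v \<in> Q j. (v, c) \<in> x})"
      using finQ[OF j] finite_colour_set colouringsD(3)[OF x]
      by (intro card_UN_disjoint[symmetric]) auto
    also have "\<dots> \<le> card (Q j)" using finQ[OF j] by (intro card_mono) auto
    finally show False using Q(2)[OF j] by simp
  qed
  then show ?thesis unfolding excess_def by auto
qed

lemma colour_of_K: "x \<in> K \<Longrightarrow> colour_of x v = Some c \<longleftrightarrow> (v, c) \<in> x"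
  by (rule colour_of_eq_Some) (rule colouringsD(3))

lemma colour_of_mono:
  assumes "y \<in> K" "x \<subseteq> y" "colour_of x v \<noteq> None" shows "colour_of y v = colour_of x v"
proof -
  have "x \<in> K" using assms(1,2) by (rule colourings_down)
  obtain c where c: "colour_of x v = Some c" using assms(3) by blast
  then have "(v, c) \<in> y" using colour_of_K[OF \<open>x \<in> K\<close>] assms(2) by blast
  then show ?thesis using colour_of_K[OF assms(1)] c by simp
qed

lemma runs_mono: "y \<in> K \<Longrightarrow> x \<subseteq> y \<Longrightarrow> runs x \<le> runs y"
  unfolding runs_def using run_starts_le[of vs "colour_of x" "colour_of y" None] colour_of_mono by blast

lemma exceeds_mono: "x \<subseteq> y \<Longrightarrow> exceeds x \<Longrightarrow> exceeds y"
  unfolding exceeds_def using excess_mono[of _ x y] by blast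

context
  assumes bound: "\<And>x. x \<in> K \<Longrightarrow> \<not> exceeds x \<Longrightarrow> runs x \<le> max_runs"
begin

text \<open>\<open>bound\<close> keeps the colourings without excess at or below level
  \<open>max_runs\<close>, so the level cannot drop when an extension first overuses a
  colour.\<close>

lemma level_mono:
  assumes y: "y \<in> K" and xy: "x \<subseteq> y" shows "level x \<le> level y"
proof -
  have x: "x \<in> K" using y xy by (rule colourings_down)
  show ?thesis
  proof (cases "exceeds x")
    case True
    have "(\<Sum>j\<in>{1..m}. card (excess j x)) \<le> (\<Sum>j\<in>{1..m}. card (excess j y))"
      by (intro sum_mono card_mono finite_excess excess_mono xy)
    then show ?thesis using True exceeds_mono[OF xy] unfolding level_def by simp
  next
    case False
    then show ?thesis
      using runs_mono[OF y xy] bound[OF x False] unfolding level_def by auto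
  qed
qed

text \<open>With excess, every single excess set grows with the face, so equality of the sums of
  their sizes makes all of them equal. Without excess, equally many runs force the same first
  colour. Excess cannot first appear between the two faces, as it would lift the level above
  \<open>max_runs\<close>.\<close>

lemma label_const:
  assumes y: "y \<in> K" and xy: "x \<subseteq> y" and lev: "level x = level y" and pos: "level x > 0"
  shows "label x = label y"
proof -
  have x: "x \<in> K" using y xy by (rule colourings_down)
  show ?thesis
  proof (cases "exceeds y")
    case False
    then have nx: "\<not> exceeds x" using exceeds_mono[OF xy] by blast
    have "runs x = runs y" "runs x > 0" using lev pos nx False unfolding level_def by auto
    moreover have "first_colour (colour_of x) vs \<noteq> None"
    proof
      assume n: "first_colour (colour_of x) vs = None"
      have "run_starts (colour_of x) None vs = []"
      proof (rule ccontr)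
        assume "run_starts (colour_of x) None vs \<noteq> []"
        then obtain v where "v \<in> set (run_starts (colour_of x) None vs)" by (meson last_in_set)
        then show False using set_run_starts first_colour_None[OF n] by metis
      qed
      with \<open>runs x > 0\<close> show False unfolding runs_def by simp
    qed
    ultimately have "first_colour (colour_of y) vs = first_colour (colour_of x) vs"
      unfolding runs_def using colour_of_mono[OF y xy] by (intro run_starts_first) auto
    then show ?thesis using nx False unfolding label_def by simp
  next
    case ey: True
    have ex: "exceeds x"
    proof (rule ccontr)
      assume "\<not> exceeds x"
      then have "level x \<le> max_runs" using bound[OF x] unfolding level_def by simp
      moreover obtain j where j: "j \<in> {1..m}" "excess j y \<noteq> {}" using ey unfolding exceeds_def by blast
      then have "card (excess j y) > 0" using finite_excess by (simp add: card_gt_0_iff)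
      then have "(\<Sum>j\<in>{1..m}. card (excess j y)) > 0"
        using j(1) by (metis (no_types, lifting) finite_atLeastAtMost not_gr_zero sum_eq_0_iff)
      ultimately show False using lev ey unfolding level_def by simp
    qed
    have sub: "excess j x \<subseteq> excess j y" if "j \<in> {1..m}" for j using excess_mono[OF that xy] .
    have "(\<Sum>j\<in>{1..m}. card (excess j x)) = (\<Sum>j\<in>{1..m}. card (excess j y))"
      using lev ex ey unfolding level_def by simp
    then have "card (excess j x) = card (excess j y)" if "j \<in> {1..m}" for j
      using sum_mono_inv[of "\<lambda>j. card (excess j x)" "{1..m}" "\<lambda>j. card (excess j y)" j]
        card_mono[OF finite_excess sub] that by auto
    then have eq: "excess j x = excess j y" if "j \<in> {1..m}" for j
      using card_subset_eq[OF finite_excess sub[OF that]] that by blast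
    then have "(LEAST j. j \<in> {1..m} \<and> excess j x \<noteq> {}) = (LEAST j. j \<in> {1..m} \<and> excess j y \<noteq> {})"
      by (intro arg_cong[of _ _ Least]) (auto simp: fun_eq_iff)
    moreover have "(LEAST j. j \<in> {1..m} \<and> excess j y \<noteq> {}) \<in> {1..m}"
      using ey LeastI_ex[of "\<lambda>j. j \<in> {1..m} \<and> excess j y \<noteq> {}"] unfolding exceeds_def by blast
    ultimately show ?thesis using eq ex ey unfolding label_def by simp
  qed
qed

lemma level_pos:
  assumes x: "x \<in> K" "x \<noteq> {}" shows "level x > 0"
proof (cases "exceeds x")
  case True
  then obtain j where j: "j \<in> {1..m}" "excess j x \<noteq> {}" unfolding exceeds_def by blast
  then have "card (excess j x) > 0" using finite_excess by (simp add: card_gt_0_iff)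
  then have "(\<Sum>j\<in>{1..m}. card (excess j x)) > 0"
    using j(1) by (metis (no_types, lifting) finite_atLeastAtMost not_gr_zero sum_eq_0_iff)
  then show ?thesis using True unfolding level_def by simp
next
  case False
  obtain v c where vc: "(v, c) \<in> x" using x(2) by auto
  then have "v \<in> set vs" "colour_of x v \<noteq> None"
    using colouringsD(1)[OF x(1)] vs colour_of_K[OF x(1)] by auto
  then have "run_starts (colour_of x) None vs \<noteq> []" using run_starts_Nil by metis
  then show ?thesis using False unfolding level_def runs_def by simp
qed

lemma level_le:
  assumes x: "x \<in> K" shows "level x \<le> card V - 1"
proof (cases "exceeds x")
  case True
  have "card (excess j x) \<le> p ^ k - 1" if "j \<in> {1..m}" for j
  proof -
    have "card (excess j x) < card Col"
      by (rule psubset_card_mono[OF finite_colour_set excess_proper[OF x that]])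
    then show ?thesis by (simp add: card_colour_set)
  qed
  then have "(\<Sum>j\<in>{1..m}. card (excess j x)) \<le> (\<Sum>j\<in>{1..m}. p ^ k - 1)" by (rule sum_mono)
  then have "(\<Sum>j\<in>{1..m}. card (excess j x)) \<le> (p ^ k - 1) * m" by (simp add: mult.commute)
  then show ?thesis using True size unfolding level_def max_runs_def by simp
next
  case False
  then show ?thesis using bound[OF x False] unfolding level_def max_runs_def by simp
qed

lemma label_proper:
  assumes x: "x \<in> K" and pos: "level x > 0" shows "label x \<noteq> {}" "label x \<subset> Col"
proof -
  have "label x \<noteq> {} \<and> label x \<subset> Col"
  proof (cases "exceeds x")
    case True
    then have "(LEAST j. j \<in> {1..m} \<and> excess j x \<noteq> {}) \<in> {1..m} \<and>
        excess (LEAST j. j \<in> {1..m} \<and> excess j x \<noteq> {}) x \<noteq> {}"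
      using LeastI_ex[of "\<lambda>j. j \<in> {1..m} \<and> excess j x \<noteq> {}"] unfolding exceeds_def by blast
    then show ?thesis using excess_proper[OF x] True unfolding label_def by simp
  next
    case False
    then have "run_starts (colour_of x) None vs \<noteq> []" using pos unfolding level_def runs_def by auto
    then obtain v where "v \<in> set (run_starts (colour_of x) None vs)" by (meson last_in_set)
    then have v: "v \<in> set vs" "colour_of x v \<noteq> None" using set_run_starts by metis+
    then obtain c where c: "first_colour (colour_of x) vs = Some c" using first_colour_None by fastforce
    then have "label x = {c}" using False unfolding label_def by auto
    moreover have "c \<in> Col"
      using first_colour_Some[OF c] colour_of_K[OF x] colouringsD(2)[OF x] by blast
    moreover have "{c} \<noteq> Col"
    proof
      assume "{c} = Col"
      then have "card Col = 1" by (metis card_1_singleton_iff One_nat_def)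
      then have "p ^ k = 1" by (simp only: card_colour_set)
      then show False using q2 by linarith
    qed
    ultimately show ?thesis by auto
  qed
  then show "label x \<noteq> {}" "label x \<subset> Col" by auto
qed

end

lemma excess_shift:
  assumes "i < k" shows "excess j (apsnd (shift p k i) ` x) = shift p k i ` excess j x"
proof -
  have inj: "inj (shift p k i)" by (rule inj_shift[OF p_pos assms])
  have "(v, shift p k i c) \<in> apsnd (shift p k i) ` x \<longleftrightarrow> (v, c) \<in> x" for v c
    using inj by (force simp: inj_eq)
  then have *: "shift p k i c \<in> excess j (apsnd (shift p k i) ` x) \<longleftrightarrow> c \<in> excess j x" for c
    unfolding excess_def using shift_mem_iff[OF p_pos assms, of c] by simp
  show ?thesis
  proof
    show "shift p k i ` excess j x \<subseteq> excess j (apsnd (shift p k i) ` x)" using * by blast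
    show "excess j (apsnd (shift p k i) ` x) \<subseteq> shift p k i ` excess j x"
    proof
      fix d assume d: "d \<in> excess j (apsnd (shift p k i) ` x)"
      then have "d \<in> shift p k i ` Col"
        using bij_shift[OF p_pos assms] unfolding excess_def bij_betw_def by simp
      then show "d \<in> shift p k i ` excess j x" using * d by blast
    qed
  qed
qed

lemma colour_of_shift:
  assumes "i < k" "x \<in> K"
  shows "colour_of (apsnd (shift p k i) ` x) v = map_option (shift p k i) (colour_of x v)"
proof -
  have xK: "apsnd (shift p k i) ` x \<in> K"
    using assms(2) inj_shift[OF p_pos assms(1)] by (rule colourings_recolour) (simp add: shift_mem_iff[OF p_pos assms(1)])
  show ?thesis
  proof (cases "colour_of x v")
    case None
    then have "\<forall>c. (v, c) \<notin> apsnd (shift p k i) ` x" unfolding colour_of_eq_None by force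
    then show ?thesis using None colour_of_eq_None by (metis option.map_disc_iff)
  next
    case (Some c)
    then have "(v, shift p k i c) \<in> apsnd (shift p k i) ` x"
      using colour_of_K[OF assms(2)] by force
    then show ?thesis using Some colour_of_K[OF xK] by simp
  qed
qed

lemma colour_of_shift_fun:
  "i < k \<Longrightarrow> x \<in> K \<Longrightarrow> colour_of (apsnd (shift p k i) ` x) = (\<lambda>v. map_option (shift p k i) (colour_of x v))"
  by (rule ext) (rule colour_of_shift)

lemma exceeds_shift: "i < k \<Longrightarrow> exceeds (apsnd (shift p k i) ` x) \<longleftrightarrow> exceeds x"
  unfolding exceeds_def by (simp add: excess_shift)

lemma runs_shift: "i < k \<Longrightarrow> x \<in> K \<Longrightarrow> runs (apsnd (shift p k i) ` x) = runs x"
  unfolding runs_def colour_of_shift_fun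
  using run_starts_map[OF inj_shift[OF p_pos], of i k "colour_of x" None vs] by simp

lemma level_shift:
  assumes "i < k" "x \<in> K" shows "level (apsnd (shift p k i) ` x) = level x"
proof -
  have "card (shift p k i ` A) = card A" for A
    by (rule card_image) (use inj_shift[OF p_pos assms(1)] inj_on_subset in blast)
  then show ?thesis
    unfolding level_def by (simp add: exceeds_shift excess_shift runs_shift assms)
qed

lemma label_shift:
  assumes "i < k" "x \<in> K" shows "label (apsnd (shift p k i) ` x) = shift p k i ` label x"
proof (cases "exceeds x")
  case True
  then show ?thesis unfolding label_def by (simp add: exceeds_shift excess_shift assms)
next
  case False
  then show ?thesis
    unfolding label_def colour_of_shift_fun[OF assms] first_colour_map
    by (auto simp: exceeds_shift assms)
qed

end

section \<open>Almost fair splittings\<close>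

lemma image_funpow:
  fixes f :: "'a \<Rightarrow> 'a" shows "((`) f ^^ n) A = (f ^^ n) ` A"
  by (induction n) (auto simp: image_image)

context balanced_targets
begin

lemma exists_good_face:
  assumes res: "prime_action.resolves p k (V \<times> Col) (\<lambda>i. apsnd (shift p k i)) K (card V) u c"
    and u: "\<not> eqm p u 0"
  shows "\<exists>x\<in>K. \<not> exceeds x \<and> max_runs < runs x"
proof (rule ccontr)
  assume "\<not> (\<exists>x\<in>K. \<not> exceeds x \<and> max_runs < runs x)"
  then have bound: "\<And>x. x \<in> K \<Longrightarrow> \<not> exceeds x \<Longrightarrow> runs x \<le> max_runs" by (meson not_le)
  let ?g = "\<lambda>i. apsnd (shift p k i) :: 'a \<times> (nat \<Rightarrow> nat) \<Rightarrow> 'a \<times> (nat \<Rightarrow> nat)"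
  have o: "((`) (shift p k i) ^^ p) = id" if "i < k" for i
    by (rule ext) (simp add: image_funpow shift_order[OF p_pos that])
  have co: "(`) (shift p k i) \<circ> (`) (shift p k j) = (`) (shift p k j) \<circ> (`) (shift p k i)"
    if "i < k" "j < k" for i j
    using shift_comm[OF p_pos that] by (auto simp: fun_eq_iff image_comp)
  \<comment> \<open>The index is taken on sets of colours and pulled back along
    \<open>label\<close>; on positive levels the labels are nonempty and proper, hence moved by some
    shift.\<close>
  obtain F0 :: "(nat \<Rightarrow> nat) set \<Rightarrow> int" and l0 :: "nat \<Rightarrow> (nat \<Rightarrow> nat) set \<Rightarrow> int" where Fl:
    "\<And>A. (\<exists>i<k. shift p k i ` A \<noteq> A) \<Longrightarrow>
      (\<forall>i<k. int p dvd F0 (shift p k i ` A) - F0 A - l0 i A) \<and>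
      (\<forall>i<k. \<forall>j<k. l0 i (shift p k j ` A) = l0 i A) \<and> (\<exists>i<k. \<not> int p dvd l0 i A)"
    using equivariant_index[OF prime, of k "\<lambda>i. (`) (shift p k i)", OF o co] by blast
  have moved: "\<exists>i<k. shift p k i ` label x \<noteq> label x" if "x \<in> K" "level x > 0" for x
    using label_proper[OF bound that] shift_transitive[OF p_pos, of "label x" k] by blast
  interpret A: prime_action p k "V \<times> Col" ?g
    by (rule prime_action_shift[OF prime finV])
  interpret R: ranked_complex p k "V \<times> Col" ?g K level "\<lambda>x. F0 (label x)" "\<lambda>i x. l0 i (label x)"
  proof unfold_locales
    show "x \<subseteq> V \<times> Col" if "x \<in> K" for x using colouringsD(1,2)[OF that] by auto
    show "x \<in> K" if "y \<in> K" "x \<subseteq> y" for x y using that by (rule colourings_down)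
    show "?g i ` x \<in> K" if "i < k" "x \<in> K" for i x
      using that(2) inj_shift[OF p_pos that(1)]
      by (rule colourings_recolour) (simp add: shift_mem_iff[OF p_pos that(1)])
    show "0 < level x" if "x \<in> K" "x \<noteq> {}" for x using level_pos[OF bound that] .
    show "level x \<le> level y" if "y \<in> K" "x \<subseteq> y" for x y using level_mono[OF bound that] .
    show "level (?g i ` x) = level x" if "i < k" "x \<in> K" for i x using level_shift[OF that] .
    show "F0 (label x) = F0 (label y)" if "y \<in> K" "x \<subseteq> y" "level x = level y" "0 < level x" for x y
      using label_const[OF bound that] by simp
    show "l0 i (label x) = l0 i (label y)" if "i < k" "y \<in> K" "x \<subseteq> y" "level x = level y" "0 < level x" for i x y
      using label_const[OF bound that(2-5)] by simp
    show "int p dvd F0 (label (?g i ` x)) - F0 (label x) - l0 i (label x)" if "i < k" "x \<in> K" "0 < level x" for i x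
      using Fl[OF moved[OF that(2,3)]] that(1) unfolding label_shift[OF that(1,2)] by blast
    show "l0 i (label (?g j ` x)) = l0 i (label x)" if "i < k" "j < k" "x \<in> K" "0 < level x" for i j x
      using Fl[OF moved[OF that(3,4)]] that(1,2) unfolding label_shift[OF that(2,3)] by blast
    show "\<exists>i<k. \<not> int p dvd l0 i (label x)" if "x \<in> K" "0 < level x" for x
      using Fl[OF moved[OF that]] by blast
  qed
  \<comment> \<open>There are \<open>card V\<close> chains and the positive levels run up to
    \<open>card V - 1\<close>, which is exactly the shape excluded by
    \<open>no_resolution\<close>.\<close>
  define N where "N = card V - 1"
  have N: "card V = Suc N" using size unfolding N_def by simp
  have all: "{x \<in> K. level x \<le> N} = K" using level_le[OF bound] unfolding N_def by auto
  have "R.resolution N N u c"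
    using res unfolding R.resolution_def A.resolves_def all N by (simp add: atLeastLessThanSuc_atLeastAtMost)
  then show False using R.no_resolution[OF u] by blast
qed

lemma splitting_of_good_face:
  assumes x: "x \<in> K" and ex: "\<not> exceeds x" and rx: "max_runs < runs x"
    and vs': "vs = pth @ rest"
    and a: "\<And>j. j \<in> {1..m} \<Longrightarrow> a j + 1 = (card (P j) + 1) div p ^ k"
    and big: "\<And>j. j \<in> {1..m} \<Longrightarrow> card (P j) \<ge> p ^ k - 1"
  shows "admits_almost_fair_independent_splitting V (E \<union> walk_edges pth) m P (p ^ k)"
proof -
  define q where "q = p ^ k"
  have q: "q \<ge> 2" using q2 unfolding q_def .
  define ws where "ws = run_starts (colour_of x) None vs"
  have dws: "distinct ws" unfolding ws_def by (rule distinct_run_starts[OF vs(1)])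
  have ws: "v \<in> V \<and> (\<exists>c\<in>Col. (v, c) \<in> x)" if "v \<in> set ws" for v
  proof -
    have "v \<in> set vs" "colour_of x v \<noteq> None" using set_run_starts that unfolding ws_def by metis+
    then obtain c where "(v, c) \<in> x" using colour_of_K[OF x] by auto
    then show ?thesis using colouringsD(1,2)[OF x] by blast
  qed
  have "card {1..q} = card Col" by (simp add: card_colour_set q_def)
  then obtain h where h: "bij_betw h {1..q} Col"
    using finite_same_card_bij finite_colour_set by blast
  \<comment> \<open>A colour class keeps only the vertices at which its runs start; all other
    vertices, coloured or not, are left over.\<close>
  define S where "S i = {v \<in> set ws. (v, h i) \<in> x}" for i
  have SV: "S i \<subseteq> V" for i using ws unfolding S_def by blast
  have disjS: "disjoint_family_on S {1..q}"
    unfolding disjoint_family_on_def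
  proof (intro ballI impI)
    fix i j assume ij: "i \<in> {1..q}" "j \<in> {1..q}" "i \<noteq> j"
    then have "h i \<noteq> h j" using h unfolding bij_betw_def by (meson inj_onD)
    then show "S i \<inter> S j = {}" using colouringsD(3)[OF x] unfolding S_def by blast
  qed
  have US: "(\<Union>i\<in>{1..q}. S i) = set ws"
  proof
    show "set ws \<subseteq> (\<Union>i\<in>{1..q}. S i)"
    proof
      fix v assume v: "v \<in> set ws"
      then obtain c where "c \<in> Col" "(v, c) \<in> x" using ws by blast
      moreover have "c \<in> h ` {1..q}" using \<open>c \<in> Col\<close> h unfolding bij_betw_def by simp
      ultimately show "v \<in> (\<Union>i\<in>{1..q}. S i)" using v unfolding S_def by blast
    qed
  qed (auto simp: S_def)
  have indep: "independent_set V (E \<union> walk_edges pth) (S i)" for i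
    unfolding independent_set_def
  proof (intro conjI ballI SV)
    fix u w assume uw: "u \<in> S i" "w \<in> S i"
    then have c: "(u, h i) \<in> x" "(w, h i) \<in> x" unfolding S_def by auto
    have "{u, w} \<notin> walk_edges pth"
    proof
      assume "{u, w} \<in> walk_edges pth"
      then obtain n where n: "Suc n < length pth" "{u, w} = {pth ! n, pth ! Suc n}"
        unfolding walk_edges_def by blast
      have "pth = take n pth @ pth ! n # pth ! Suc n # drop (Suc (Suc n)) pth"
        using n(1) by (metis Cons_nth_drop_Suc Suc_lessD append_take_drop_id)
      then have split: "vs = take n pth @ pth ! n # pth ! Suc n # (drop (Suc (Suc n)) pth @ rest)"
        unfolding vs' by (metis append_Cons append_assoc)
      have "pth ! n \<in> set ws" "pth ! Suc n \<in> set ws"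
        using uw n(2) unfolding S_def by (auto simp: doubleton_eq_iff)
      then have "colour_of x (pth ! n) \<noteq> colour_of x (pth ! Suc n)"
        using run_starts_adjacent[of "take n pth" "pth ! n" "pth ! Suc n" "drop (Suc (Suc n)) pth @ rest" "colour_of x" None]
          vs(1) unfolding ws_def split[symmetric] by blast
      moreover have "colour_of x u = Some (h i)" "colour_of x w = Some (h i)"
        using c colour_of_K[OF x] by simp_all
      ultimately show False using n(2) by (auto simp: doubleton_eq_iff)
    qed
    then show "{u, w} \<notin> E \<union> walk_edges pth" using colouringsD(4)[OF x c] by blast
  qed
  have disjP: "disjoint_family_on P {1..m}" and UP: "(\<Union>j\<in>{1..m}. P j) = V"
    using part unfolding vertex_partition_def by auto
  have finP: "finite (P j)" if "j \<in> {1..m}" for j using P_V[OF that] finV finite_subset by blast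
  have St: "card (S i \<inter> Q j) \<le> a j" if i: "i \<in> {1..q}" and j: "j \<in> {1..m}" for i j
  proof -
    have hi: "h i \<in> Col" using h i unfolding bij_betw_def by blast
    have "excess j x = {}" using ex j unfolding exceeds_def by blast
    then have "h i \<notin> excess j x" by simp
    then have "card {v \<in> Q j. (v, h i) \<in> x} \<le> a j" using hi unfolding excess_def by simp
    moreover have "card (S i \<inter> Q j) \<le> card {v \<in> Q j. (v, h i) \<in> x}"
      using finQ[OF j] unfolding S_def by (intro card_mono) auto
    ultimately show ?thesis by simp
  qed
  have split_ws: "card (set ws \<inter> P j) = (\<Sum>i\<in>{1..q}. card (S i \<inter> Q j)) + card (set ws \<inter> (P j - Q j))"
    if j: "j \<in> {1..m}" for j
  proof -
    have "card (set ws \<inter> P j) = card (set ws \<inter> Q j) + card (set ws \<inter> (P j - Q j))"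
    proof -
      have "set ws \<inter> P j = (set ws \<inter> Q j) \<union> (set ws \<inter> (P j - Q j))" using Q(1)[OF j] by blast
      then show ?thesis by (simp add: card_Un_disjoint disjoint_iff)
    qed
    also have "set ws \<inter> Q j = (\<Union>i\<in>{1..q}. S i \<inter> Q j)" unfolding US[symmetric] by blast
    also have "card (\<Union>i\<in>{1..q}. S i \<inter> Q j) = (\<Sum>i\<in>{1..q}. card (S i \<inter> Q j))"
      using disjS finQ[OF j] by (intro card_UN_disjoint) (auto simp: disjoint_family_on_def)
    finally show ?thesis .
  qed
  have Qq: "card (Q j) + 1 = q * a j + q" if "j \<in> {1..m}" for j
    using Q(2)[OF that] unfolding q_def by simp
  have PQ: "card (P j) = card (Q j) + card (P j - Q j)" if j: "j \<in> {1..m}" for j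
    using Q(1)[OF j] finP[OF j] finQ[OF j] by (simp add: card_Diff_subset card_mono)
  have sum_St: "(\<Sum>i\<in>{1..q}. card (S i \<inter> Q j)) \<le> q * a j" if j: "j \<in> {1..m}" for j
    using sum_mono[OF St[OF _ j], of "{1..q}" "\<lambda>i. i"] by simp
  have rest_le: "card (set ws \<inter> (P j - Q j)) \<le> card (P j - Q j)" if j: "j \<in> {1..m}" for j
    using finP[OF j] by (intro card_mono) auto
  \<comment> \<open>At most \<open>q * a j = card (Q j) - (q - 1)\<close> kept vertices lie in
    \<open>Q j\<close>, and all of \<open>P j - Q j\<close> may be kept in addition.\<close>
  have le: "card (set ws \<inter> P j) \<le> card (P j) - (q - 1)" if j: "j \<in> {1..m}" for j
    using split_ws[OF j] sum_St[OF j] rest_le[OF j] Qq[OF j] PQ[OF j] q by linarith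
  have "card V = (\<Sum>j\<in>{1..m}. card (P j))"
    unfolding UP[symmetric] using disjP finP
    by (intro card_UN_disjoint) (auto simp: disjoint_family_on_def)
  moreover have "(\<Sum>j\<in>{1..m}. card (P j)) = (\<Sum>j\<in>{1..m}. card (P j) - (q - 1)) + (\<Sum>j\<in>{1..m}. q - 1)"
    unfolding sum.distrib[symmetric] using big unfolding q_def by (intro sum.cong refl) simp
  ultimately have cV: "card V = (\<Sum>j\<in>{1..m}. card (P j) - (q - 1)) + m * (q - 1)" by simp
  have cws: "card (set ws) = (\<Sum>j\<in>{1..m}. card (set ws \<inter> P j))"
  proof -
    have "set ws = (\<Union>j\<in>{1..m}. set ws \<inter> P j)" using ws UP by blast
    then have "card (set ws) = card (\<Union>j\<in>{1..m}. set ws \<inter> P j)" by (rule arg_cong)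
    also have "\<dots> = (\<Sum>j\<in>{1..m}. card (set ws \<inter> P j))"
      using disjP by (intro card_UN_disjoint) (auto simp: disjoint_family_on_def)
    finally show ?thesis .
  qed
  have "card (set ws) = runs x" unfolding runs_def ws_def[symmetric] by (rule distinct_card[OF dws])
  \<comment> \<open>The right-hand side is \<open>max_runs + 1\<close>. Together with the upper
    bounds \<open>le\<close> this forces equality in every class, and then for every colour in
    \<open>tight\<close>.\<close>
  then have "card (set ws) \<ge> (\<Sum>j\<in>{1..m}. card (P j) - (q - 1))"
    using rx cV size unfolding max_runs_def q_def[symmetric] by (simp add: mult.commute)
  then have "(\<Sum>j\<in>{1..m}. card (set ws \<inter> P j)) = (\<Sum>j\<in>{1..m}. card (P j) - (q - 1))"
    unfolding cws using sum_mono[OF le, of "{1..m}" "\<lambda>j. j"] by linarith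
  from sum_mono_inv[OF this le] have eq: "card (set ws \<inter> P j) = card (P j) - (q - 1)" if "j \<in> {1..m}" for j
    using that by simp
  have tight: "card (S i \<inter> Q j) = a j" if i: "i \<in> {1..q}" and j: "j \<in> {1..m}" for i j
  proof -
    have "(\<Sum>i\<in>{1..q}. card (S i \<inter> Q j)) \<ge> q * a j"
      using split_ws[OF j] rest_le[OF j] Qq[OF j] PQ[OF j] eq[OF j] q by linarith
    then have "(\<Sum>i\<in>{1..q}. card (S i \<inter> Q j)) = (\<Sum>i\<in>{1..q}. a j)" using sum_St[OF j] by simp
    from sum_mono_inv[OF this St[OF _ j]] show ?thesis using i by simp
  qed
  have "almost_fair_splitting V m P q S"
    unfolding almost_fair_splitting_def
  proof (intro conjI ballI SV disjS)
    fix i j assume i: "i \<in> {1..q}" and j: "j \<in> {1..m}"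
    have "a j \<le> card (S i \<inter> P j)"
      unfolding tight[OF i j, symmetric] using Q(1)[OF j] finP[OF j] by (intro card_mono) auto
    moreover have "\<lfloor>(real (card (P j)) + 1) / real q\<rfloor> = int ((card (P j) + 1) div q)"
      using floor_divide_of_nat_eq[of "card (P j) + 1" q, where ?'a = real] by (simp add: add.commute)
    moreover have "int ((card (P j) + 1) div q) = int (a j) + 1" using a[OF j] unfolding q_def by simp
    ultimately show "int (card (S i \<inter> P j)) \<ge> \<lfloor>(real (card (P j)) + 1) / real q\<rfloor> - 1" by simp
  next
    fix j assume j: "j \<in> {1..m}"
    have "P j - (\<Union>i\<in>{1..q}. S i) = P j - (set ws \<inter> P j)" unfolding US by blast
    then have "card (P j - (\<Union>i\<in>{1..q}. S i)) = card (P j) - card (set ws \<inter> P j)"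
      using finP[OF j] by (simp add: card_Diff_subset)
    then show "card (P j - (\<Union>i\<in>{1..q}. S i)) \<le> q - 1" unfolding eq[OF j] by simp
  qed
  then show ?thesis
    unfolding admits_almost_fair_independent_splitting_def q_def[symmetric] using indep by blast
qed

end

lemma splitting_of_resolution:
  assumes "finite V" "vertex_partition V m P" "prime p" "p ^ k \<ge> 2"
    and big: "\<And>j. j \<in> {1..m} \<Longrightarrow> card (P j) \<ge> p ^ k - 1"
    and size: "card V \<ge> (p ^ k - 1) * m + 1"
    and path: "distinct pth" "set pth \<subseteq> V"
    and res: "prime_action.resolves p k (V \<times> colour_set p k) (\<lambda>i. apsnd (shift p k i))
      (colourings E V (\<lambda>_. colour_set p k)) (card V) u c" "\<not> eqm p u 0"
  shows "admits_almost_fair_independent_splitting V (E \<union> walk_edges pth) m P (p ^ k)"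
proof -
  obtain rest where rest: "set rest = V - set pth" "distinct rest"
    using finite_distinct_list[of "V - set pth"] assms(1) by auto
  \<comment> \<open>By \<open>big\<close> the quotient is at least 1, so the subtraction does not
    truncate.\<close>
  define a where "a j = (card (P j) + 1) div p ^ k - 1" for j
  have a: "a j + 1 = (card (P j) + 1) div p ^ k" if j: "j \<in> {1..m}" for j
  proof -
    have "(card (P j) + 1) div p ^ k > 0"
      unfolding div_greater_zero_iff using big[OF j] assms(4) by linarith
    then show ?thesis unfolding a_def by simp
  qed
  have "\<exists>Q. \<forall>j\<in>{1..m}. Q j \<subseteq> P j \<and> card (Q j) + 1 = p ^ k * (a j + 1)"
  proof (rule bchoice, rule ballI)
    fix j assume j: "j \<in> {1..m}"
    have 1: "p ^ k * (a j + 1) \<le> card (P j) + 1" unfolding a[OF j] by simp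
    have "p ^ k * (a j + 1) \<ge> 1" using assms(4) by simp
    then obtain n where n: "p ^ k * (a j + 1) = n + 1" by (metis add.commute le_Suc_ex)
    then have "n \<le> card (P j)" using 1 by simp
    then obtain T where "T \<subseteq> P j" "card T = n" using obtain_subset_with_card_n by metis
    then show "\<exists>T. T \<subseteq> P j \<and> card T + 1 = p ^ k * (a j + 1)" using n by auto
  qed
  then obtain Q where Q: "\<forall>j\<in>{1..m}. Q j \<subseteq> P j \<and> card (Q j) + 1 = p ^ k * (a j + 1)" by blast
  interpret balanced_targets V E m P Q "pth @ rest" p k a
    by unfold_locales (use assms Q rest in auto)
  obtain x where x: "x \<in> K" "\<not> exceeds x" "max_runs < runs x" using exists_good_face[OF res] by blast
  show ?thesis by (rule splitting_of_good_face[OF x refl a big])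
qed

section \<open>Graphs of small degree outside a path\<close>

lemma colourings_recolour_imp:
  assumes gx: "apsnd \<gamma> ` x \<in> colourings E V (\<lambda>_. Col)" and \<gamma>: "inj \<gamma>" "\<And>c. \<gamma> c \<in> Col \<Longrightarrow> c \<in> Col"
  shows "x \<in> colourings E V (\<lambda>_. Col)"
proof (rule colouringsI)
  have mem: "(u, \<gamma> c) \<in> apsnd \<gamma> ` x" if "(u, c) \<in> x" for u c
    using that by force
  show "u \<in> V \<and> c \<in> Col" if "(u, c) \<in> x" for u c
    using colouringsD(1,2)[OF gx mem[OF that]] \<gamma>(2) by blast
  show "c = d" if "(u, c) \<in> x" "(u, d) \<in> x" for u c d
    using colouringsD(3)[OF gx mem[OF that(1)] mem[OF that(2)]] injD[OF \<gamma>(1)] by blast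
  show "{u, w} \<notin> E" if "(u, c) \<in> x" "(w, c) \<in> x" for u w c
    using colouringsD(4)[OF gx mem[OF that(1)] mem[OF that(2)]] .
qed

lemma graph_dist_eq_two:
  assumes "v \<in> V" "w \<in> V" "z \<in> V" "w \<noteq> v" "{v, w} \<notin> E" "{v, z} \<in> E" "{z, w} \<in> E"
  shows "graph_dist V E v w = 2"
  unfolding graph_dist_def
proof (rule antisym)
  let ?A = "{enat (length p - 1) | p. is_walk V E p \<and> hd p = v \<and> last p = w}"
  have "walk_edges [v, z, w] \<subseteq> E"
  proof
    fix e assume "e \<in> walk_edges [v, z, w]"
    then have "e = {v, z} \<or> e = {z, w}"
      unfolding walk_edges_def by (auto simp: less_Suc_eq)
    then show "e \<in> E" using assms(6,7) by blast
  qed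
  then have "is_walk V E [v, z, w]" using assms unfolding is_walk_def by simp
  then have "enat (length [v, z, w] - 1) \<in> ?A" by (intro CollectI exI[of _ "[v, z, w]"]) simp
  then have "Inf ?A \<le> enat (length [v, z, w] - 1)" by (rule Inf_lower)
  moreover have "enat (length [v, z, w] - 1) = 2" by (simp add: numeral_eq_enat)
  ultimately show "Inf ?A \<le> 2" by (simp only:)
  show "2 \<le> Inf ?A"
  proof (rule Inf_greatest)
    fix e assume "e \<in> ?A"
    then obtain p where p: "e = enat (length p - 1)" "is_walk V E p" "hd p = v" "last p = w" by blast
    have "length p \<ge> 3"
    proof (rule ccontr)
      assume "\<not> length p \<ge> 3"
      moreover have "p \<noteq> []" using p(2) unfolding is_walk_def by simp
      ultimately consider a where "p = [a]" | a b where "p = [a, b]"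
        by (cases p; cases "tl p"; cases "tl (tl p)") auto
      then show False
      proof cases
        case 1
        then show False using p(3,4) assms(4) by simp
      next
        case 2
        have "{p ! 0, p ! Suc 0} \<in> walk_edges p" unfolding walk_edges_def 2 by auto
        then have "{v, w} \<in> E" using p 2 unfolding is_walk_def by auto
        then show False using assms(5) by simp
      qed
    qed
    then show "2 \<le> e" unfolding p(1) by (simp add: numeral_eq_enat)
  qed
qed

lemma enough_colours_of_degree_bound:
  assumes "finite V" "finite Col"
    and "\<And>v. v \<in> V \<Longrightarrow> 2 * num_neighbors V E v + num_dist_two V E v < card Col"
  shows "enough_colours E V (\<lambda>_. Col)"
  unfolding enough_colours_def
proof (intro ballI conjI assms(2))
  fix v assume v: "v \<in> V"
  have "second_nbrs E V v \<subseteq> {w \<in> V. graph_dist V E v w = 2}"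
    unfolding second_nbrs_def using graph_dist_eq_two[OF v] by blast
  then have "card (second_nbrs E V v) \<le> num_dist_two V E v"
    unfolding num_dist_two_def using assms(1) by (intro card_mono) auto
  moreover have "card (nbrs E V v) = num_neighbors V E v"
    unfolding nbrs_def num_neighbors_def ..
  ultimately show "2 * card (nbrs E V v) + card (second_nbrs E V v) < card Col"
    using assms(3)[OF v] by simp
qed

lemma splitting_bounded_degree:
  assumes G: "finite_graph V E" "vertex_partition V m P" and q: "q \<ge> 2" "primepow q"
    and big: "\<forall>j\<in>{1..m}. card (P j) \<ge> q - 1" and size: "card V \<ge> (q - 1) * (m + 2) + 1"
    and pth: "is_simple_path V E pth"
    and deg: "\<forall>v\<in>V. 2 * num_neighbors V (E - walk_edges pth) v
                      + num_dist_two V (E - walk_edges pth) v < q"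
  shows "admits_almost_fair_independent_splitting V E m P q"
proof -
  obtain p k where pk: "prime p" "q = p ^ k" using q(2) unfolding primepow_def by blast
  have p0: "p > 0" using pk(1) prime_gt_0_nat by blast
  have finV: "finite V" and EV: "E \<subseteq> complete_edges V" using G(1) unfolding finite_graph_def by auto
  let ?E = "E - walk_edges pth" and ?Col = "colour_set p k"
  let ?K = "colourings ?E V (\<lambda>_. ?Col)"
  have loops: "{u} \<notin> ?E" for u using EV unfolding complete_edges_def by auto
  have finX: "finite (V \<times> ?Col)" using finV finite_colour_set by blast
  have "enough_colours ?E V (\<lambda>_. ?Col)"
    using finV finite_colour_set deg pk(2) by (intro enough_colours_of_degree_bound) (auto simp: card_colour_set)
  then have ac: "acyclic_below (V \<times> ?Col) ?K (card V)"
    using finX loops finV by (intro acyclic_below_colourings) auto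
  interpret A: prime_action p k "V \<times> ?Col" "\<lambda>i. apsnd (shift p k i)"
    by (rule prime_action_shift[OF pk(1) finV])
  have "\<exists>c. A.resolves ?K (card V) 1 c"
  proof (rule A.resolves_exists)
    show "x \<in> ?K" if "y \<in> ?K" "x \<subseteq> y" for x y using that by (rule colourings_down)
    show "{} \<in> ?K" by (rule colouringsI) auto
    show "x \<in> ?K" if "i < k" "apsnd (shift p k i) ` x \<in> ?K" for i x
      using that(2) inj_shift[OF p0 that(1)] by (rule colourings_recolour_imp) (simp add: shift_mem_iff[OF p0 that(1)])
  qed (use ac in auto)
  then obtain c where c: "A.resolves ?K (card V) 1 c" by blast
  have "\<not> eqm p (1 :: int poly) 0" using eqm_poly_of_nat[OF pk(1), of 1] pk(1) by auto
  moreover have "distinct pth" "set pth \<subseteq> V" "walk_edges pth \<subseteq> E"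
    using pth unfolding is_simple_path_def is_walk_def by auto
  moreover have "card V \<ge> (p ^ k - 1) * m + 1" using size unfolding pk(2) by (simp add: distrib_left)
  ultimately have "admits_almost_fair_independent_splitting V (?E \<union> walk_edges pth) m P (p ^ k)"
    using big q(1) unfolding pk(2)
    by (intro splitting_of_resolution[OF finV G(2) pk(1) _ _ _ _ _ c]) auto
  moreover have "?E \<union> walk_edges pth = E" using \<open>walk_edges pth \<subseteq> E\<close> by blast
  ultimately show ?thesis unfolding pk(2) by simp
qed

section \<open>A path together with disjoint cliques\<close>

context clique_blocks
begin

lemma K0_recolour_imp:
  assumes gx: "apsnd \<gamma> ` x \<in> K0" and \<gamma>: "inj \<gamma>" "\<And>c. \<gamma> c \<in> Col \<Longrightarrow> c \<in> Col"
  shows "x \<in> K0"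
proof -
  have mem: "(b, \<gamma> c) \<in> apsnd \<gamma> ` x \<longleftrightarrow> (b, c) \<in> x" for b c
    using \<gamma>(1) by (force simp: inj_eq)
  have sub: "apsnd \<gamma> ` x \<subseteq> B \<times> Col" "\<And>b. b \<in> B \<Longrightarrow> card {c. (b, c) \<in> apsnd \<gamma> ` x} \<le> card b"
    using gx unfolding K0_def bounded_sets_def by auto
  have "x \<subseteq> B \<times> Col"
  proof
    fix z assume "z \<in> x"
    then have "(fst z, \<gamma> (snd z)) \<in> apsnd \<gamma> ` x" using mem[of "fst z" "snd z"] by simp
    then show "z \<in> B \<times> Col" using sub(1) \<gamma>(2) by (cases z) auto
  qed
  moreover have "card {c. (b, c) \<in> x} \<le> card b" if b: "b \<in> B" for b
  proof -
    have "{c. (b, c) \<in> apsnd \<gamma> ` x} = \<gamma> ` {c. (b, c) \<in> x}" by force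
    then show ?thesis using sub(2)[OF b] \<gamma>(1) by (simp add: card_image inj_on_def inj_def)
  qed
  ultimately show ?thesis unfolding K0_def bounded_sets_def by simp
qed

end

lemma splitting_path_cliques:
  assumes G: "finite_graph V E" "vertex_partition V m P" and q: "q \<ge> 2" "prime q"
    and big: "\<forall>j\<in>{1..m}. card (P j) \<ge> q - 1" and size: "n \<ge> m + 1" "card V = (q - 1) * n + 1"
    and pc: "edge_disjoint_path_cliques V E (q - 1)"
  shows "admits_almost_fair_independent_splitting V E m P q"
proof -
  obtain pth C where pth: "is_simple_path V E pth" and C: "\<forall>K\<in>C. card K = q - 1" "disjoint C"
    and V: "V = set pth \<union> \<Union>C" and E_split: "E = walk_edges pth \<union> (\<Union>K\<in>C. complete_edges K)"
    and dis: "walk_edges pth \<inter> (\<Union>K\<in>C. complete_edges K) = {}"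
    using pc unfolding edge_disjoint_path_cliques_def by blast
  have finV: "finite V" using G(1) unfolding finite_graph_def by auto
  have q0: "q > 0" using q by simp
  let ?E = "\<Union>K\<in>C. complete_edges K" and ?Col = "colour_set q 1"
  \<comment> \<open>Vertices outside the cliques become blocks of size one. They carry no edges, and
    the blocks then cover all of \<open>V\<close>.\<close>
  define B where "B = C \<union> (\<lambda>v. {v}) ` (V - \<Union>C)"
  have uniq: "b = b'" if "b \<in> B" "b' \<in> B" "v \<in> b" "v \<in> b'" for b b' v
  proof -
    have "b \<in> C \<or> b = {v} \<and> v \<notin> \<Union>C" using that(1,3) unfolding B_def by auto
    moreover have "b' \<in> C \<or> b' = {v} \<and> v \<notin> \<Union>C" using that(2,4) unfolding B_def by auto
    moreover have "v \<in> \<Union>C" if "b \<in> C \<or> b' \<in> C" using that \<open>v \<in> b\<close> \<open>v \<in> b'\<close> by blast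
    moreover have "b = b'" if "b \<in> C" "b' \<in> C"
      using disjointD[OF C(2) that] \<open>v \<in> b\<close> \<open>v \<in> b'\<close> by blast
    ultimately show ?thesis by metis
  qed
  define blk where "blk v = (THE b. b \<in> B \<and> v \<in> b)" for v
  have ex: "\<exists>b. b \<in> B \<and> v \<in> b" if "v \<in> V" for v
  proof (cases "v \<in> \<Union>C")
    case True
    then show ?thesis unfolding B_def by blast
  next
    case False
    then have "{v} \<in> B" using that unfolding B_def by blast
    then show ?thesis by blast
  qed
  have blk: "blk v \<in> B \<and> v \<in> blk v" if "v \<in> V" for v
  proof -
    obtain b where b: "b \<in> B \<and> v \<in> b" using ex[OF \<open>v \<in> V\<close>] by blast
    show ?thesis unfolding blk_def by (rule theI[of "\<lambda>b. b \<in> B \<and> v \<in> b", OF b]) (use b uniq in blast)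
  qed
  have BV: "v \<in> V \<and> blk v = b" if "b \<in> B" "v \<in> b" for b v
  proof -
    have "\<Union>B \<subseteq> V" unfolding B_def V by auto
    then have "v \<in> V" using that by blast
    moreover have "b = blk v"
      using uniq[OF that(1) conjunct1[OF blk] that(2) conjunct2[OF blk]] \<open>v \<in> V\<close> by simp
    ultimately show ?thesis by simp
  qed
  interpret clique_blocks V B blk ?E ?Col
  proof
    show "finite V" "finite ?Col" by (rule finV, rule finite_colour_set)
    show "blk v \<in> B" "v \<in> blk v" if "v \<in> V" for v using blk[OF that] by auto
    show "v \<in> V \<and> blk v = b" if "b \<in> B" "v \<in> b" for b v using BV[OF that] .
    have "card e \<noteq> 2" if "e \<subseteq> {v}" for e and v :: 'a using card_mono[OF _ that] by simp
    then have "(\<Union>b\<in>(\<lambda>v. {v}) ` (V - \<Union>C). {e. e \<subseteq> b \<and> card e = 2}) = {}" by blast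
    then show "?E = (\<Union>b\<in>B. {e. e \<subseteq> b \<and> card e = 2})"
      unfolding B_def complete_edges_def UN_Un by (simp only: Un_empty_right)
  qed
  have cb: "card b < q" if "b \<in> B" for b
  proof -
    have "b \<in> C \<or> (\<exists>v. b = {v})" using that unfolding B_def by auto
    then have "card b = q - 1 \<or> card b = 1" using C(1) by auto
    then show ?thesis using q(1) by linarith
  qed
  have ac: "acyclic_below (B \<times> ?Col) K0 (card V)"
    by (rule acyclic_K0) (simp add: card_colour_set cb)
  interpret A: prime_action q 1 "B \<times> ?Col" "\<lambda>i. apsnd (shift q 1 i)"
    by (rule prime_action_shift[OF q(2) finB])
  have "\<exists>c. A.resolves K0 (card V) 1 c"
  proof (rule A.resolves_exists)
    show "x \<in> K0" if "y \<in> K0" "x \<subseteq> y" for x y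
      using bounded_sets_down[OF _ that[unfolded K0_def]] finite_colour_set unfolding K0_def by blast
    show "{} \<in> K0" unfolding K0_def bounded_sets_def by simp
    show "x \<in> K0" if "i < 1" "apsnd (shift q 1 i) ` x \<in> K0" for i x
      using that(2) inj_shift[OF q0 that(1)] by (rule K0_recolour_imp) (simp only: shift_mem_iff[OF q0 that(1)])
  qed (use ac in auto)
  then obtain c where c: "A.resolves K0 (card V) 1 c" by blast
  let ?u = "of_nat (\<Prod>b\<in>B. fact (card b)) :: int poly"
  have "prime_action.resolves q 1 (V \<times> ?Col) (\<lambda>i. apsnd (shift q 1 i)) K (card V) ?u (\<lambda>i. T (c i))"
  proof (rule resolves_transfer[OF A.prime_action_axioms prime_action_shift[OF q(2) finV] T_linear T_chain T_bd _ T_empty c])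
    show "T (app (pull (apsnd (shift q 1 i))) f) = app (pull (apsnd (shift q 1 i))) (T f)" if "i < 1" for i f
      by (rule T_pull) (rule bij_shift[OF q0 that], rule inj_shift[OF q0 that])
  qed
  \<comment> \<open>The degree is a product of factorials of block sizes below \<open>q\<close>.
    Here \<open>q\<close> itself has to be prime: for \<open>q = p ^ k\<close> with
    \<open>k > 1\<close> the factorial of \<open>q - 1\<close> is divisible by
    \<open>p\<close>.\<close>
  moreover have "\<not> eqm q ?u 0"
  proof -
    have "\<not> q dvd fact (card b)" if "b \<in> B" for b
      using cb[OF that] q(2) by (simp add: prime_dvd_fact_iff)
    then have "\<not> q dvd (\<Prod>b\<in>B. fact (card b))"
      using q(2) finB by (simp add: prime_dvd_prod_iff)
    then show ?thesis unfolding eqm_poly_of_nat[OF q(2)] .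
  qed
  moreover have "distinct pth" "set pth \<subseteq> V"
    using pth unfolding is_simple_path_def is_walk_def by auto
  moreover have "card V \<ge> (q ^ 1 - 1) * m + 1"
  proof -
    have "(q - 1) * m \<le> (q - 1) * n" using size(1) by (intro mult_le_mono2) simp
    then show ?thesis unfolding size(2) by simp
  qed
  ultimately have "admits_almost_fair_independent_splitting V (?E \<union> walk_edges pth) m P (q ^ 1)"
    using big q(1) unfolding K_def
    by (intro splitting_of_resolution[OF finV G(2) q(2)]) auto
  moreover have "?E \<union> walk_edges pth = E" unfolding E_split by (rule Un_commute)
  ultimately show ?thesis by simp
qed

theorem theorem5p3:
  fixes V :: "'a set" and E :: "'a set set" and m :: nat and P :: "nat \<Rightarrow> 'a set"
  assumes "finite_graph V E"
    and "vertex_partition V m P"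
  shows
    "(\<forall>q::nat. q \<ge> 2 \<and> primepow q \<and>
        (\<forall>j\<in>{1..m}. card (P j) \<ge> q - 1) \<and>
        card V \<ge> (q - 1) * (m + 2) + 1 \<and>
        (\<exists>p. is_simple_path V E p \<and>
           (\<forall>v\<in>V. 2 * num_neighbors V (E - walk_edges p) v
                      + num_dist_two V (E - walk_edges p) v < q))
        \<longrightarrow> admits_almost_fair_independent_splitting V E m P q)
     \<and>
     (\<forall>q::nat. q \<ge> 2 \<and> prime q \<and>
        (\<forall>j\<in>{1..m}. card (P j) \<ge> q - 1) \<and>
        (\<exists>n::nat. n \<ge> m + 1 \<and> card V = (q - 1) * n + 1) \<and>
        edge_disjoint_path_cliques V E (q - 1)
        \<longrightarrow> admits_almost_fair_independent_splitting V E m P q)"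
proof (intro conjI allI impI)
  fix q :: nat
  assume "q \<ge> 2 \<and> primepow q \<and> (\<forall>j\<in>{1..m}. card (P j) \<ge> q - 1) \<and>
    card V \<ge> (q - 1) * (m + 2) + 1 \<and>
    (\<exists>p. is_simple_path V E p \<and>
       (\<forall>v\<in>V. 2 * num_neighbors V (E - walk_edges p) v
                  + num_dist_two V (E - walk_edges p) v < q))"
  then show "admits_almost_fair_independent_splitting V E m P q"
    by (elim conjE exE) (rule splitting_bounded_degree[OF assms])
next
  fix q :: nat
  assume "q \<ge> 2 \<and> prime q \<and> (\<forall>j\<in>{1..m}. card (P j) \<ge> q - 1) \<and>
    (\<exists>n::nat. n \<ge> m + 1 \<and> card V = (q - 1) * n + 1) \<and>
    edge_disjoint_path_cliques V E (q - 1)"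
  then show "admits_almost_fair_independent_splitting V E m P q"
    by (elim conjE exE) (rule splitting_path_cliques[OF assms])
qed

end
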